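(* Let $\langle\mathcal M,\in^{\mathcal M}\rangle$ be a countable model of G\"odel--Bernays set theory ${\rm GB}$ (presented on domain $\omega$), and suppose $\mathbb{P}\in\mathcal M$ is a class forcing notion whose atomic forcing relation is a class in $\mathcal M$. Then from an oracle for the second-order elementary diagram of $\mathcal M$ there is a computable procedure to compute an $\mathcal M$-generic filter $G\subseteq\mathbb{P}$ and the second-order elementary diagram of (a presentation of) $\mathcal M[G]$.
   Context: Models of ${\rm GB}$ are two-sorted first-order structures with sets and classes. The second-order elementary diagram is the set of all formulae of the two-sorted language (quantifying over sets and over the classes of the model), with parameters, true in the model. $G\subseteq\mathbb{P}$ is $\mathcal M$-generic if it is a filter meeting every dense subclass of $\mathbb{P}$ in $\mathcal M$; $\mathcal M[G]$ is the extension whose sets and classes are interpretations of set and class $\mathbb{P}$-names by $G$ via the forcing relation. *)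

theory Defs
  imports Main "HOL-Library.Nat_Bijection"
begin

section \<open>Two-sorted structures and their language\<close>

text \<open>
  The sorts are disjoint: \<^term>\<open>smem\<close> is membership of sets in sets, \<^term>\<open>cmem\<close> is membership of
  sets in classes. Equality on either sort is interpreted as identity.
\<close>

record ('s, 'c) struct =
  Sets :: "'s set"
  Classes :: "'c set"
  smem :: "'s \<Rightarrow> 's \<Rightarrow> bool"
  cmem :: "'s \<Rightarrow> 'c \<Rightarrow> bool"

text \<open>A two-sorted structure is presented on \<open>\<omega>\<close> if each of its two sorts is (a copy of) \<open>\<omega>\<close>.\<close>

definition on_omega :: "(nat, nat) struct \<Rightarrow> bool" where
  "on_omega M \<longleftrightarrow> Sets M = UNIV \<and> Classes M = UNIV"

definition isomorphic :: "('s, 'c) struct \<Rightarrow> ('t, 'd) struct \<Rightarrow> bool" where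
  "isomorphic M N \<longleftrightarrow>
     (\<exists>f g. bij_betw f (Sets M) (Sets N) \<and> bij_betw g (Classes M) (Classes N) \<and>
        (\<forall>a\<in>Sets M. \<forall>b\<in>Sets M. smem M a b \<longleftrightarrow> smem N (f a) (f b)) \<and>
        (\<forall>a\<in>Sets M. \<forall>X\<in>Classes M. cmem M a X \<longleftrightarrow> cmem N (f a) (g X)))"

text \<open>
  Variables are de Bruijn indices, counted separately for the two sorts; \<open>Par\<close> is a constant naming
  an element of the structure.
\<close>

datatype 'a trm = Var nat | Par 'a

datatype (spars: 's, cpars: 'c) fm =
    SetEq "'s trm" "'s trm"
  | SetMem "'s trm" "'s trm"
  | ClsEq "'c trm" "'c trm"
  | ClsMem "'s trm" "'c trm"
  | Neg "('s, 'c) fm"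
  | Conj "('s, 'c) fm" "('s, 'c) fm"
  | AllSet "('s, 'c) fm"
  | AllCls "('s, 'c) fm"

fun tval :: "(nat \<Rightarrow> 'a) \<Rightarrow> 'a trm \<Rightarrow> 'a" where
  "tval e (Var n) = e n"
| "tval e (Par a) = a"

primrec sat :: "('s, 'c) struct \<Rightarrow> (nat \<Rightarrow> 's) \<Rightarrow> (nat \<Rightarrow> 'c) \<Rightarrow> ('s, 'c) fm \<Rightarrow> bool" where
  "sat M e E (SetEq s t) \<longleftrightarrow> tval e s = tval e t"
| "sat M e E (SetMem s t) \<longleftrightarrow> smem M (tval e s) (tval e t)"
| "sat M e E (ClsEq S T) \<longleftrightarrow> tval E S = tval E T"
| "sat M e E (ClsMem s T) \<longleftrightarrow> cmem M (tval e s) (tval E T)"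
| "sat M e E (Neg \<phi>) \<longleftrightarrow> \<not> sat M e E \<phi>"
| "sat M e E (Conj \<phi> \<psi>) \<longleftrightarrow> sat M e E \<phi> \<and> sat M e E \<psi>"
| "sat M e E (AllSet \<phi>) \<longleftrightarrow> (\<forall>x\<in>Sets M. sat M (case_nat x e) E \<phi>)"
| "sat M e E (AllCls \<phi>) \<longleftrightarrow> (\<forall>X\<in>Classes M. sat M e (case_nat X E) \<phi>)"

fun tclosed :: "nat \<Rightarrow> 'a trm \<Rightarrow> bool" where
  "tclosed k (Var n) \<longleftrightarrow> n < k"
| "tclosed k (Par a) \<longleftrightarrow> True"

text \<open>\<open>closed_fm i j \<phi>\<close>: the free set variables are below \<open>i\<close>, the free class variables below \<open>j\<close>.\<close>

primrec closed_fm :: "nat \<Rightarrow> nat \<Rightarrow> ('s, 'c) fm \<Rightarrow> bool" where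
  "closed_fm i j (SetEq s t) \<longleftrightarrow> tclosed i s \<and> tclosed i t"
| "closed_fm i j (SetMem s t) \<longleftrightarrow> tclosed i s \<and> tclosed i t"
| "closed_fm i j (ClsEq S T) \<longleftrightarrow> tclosed j S \<and> tclosed j T"
| "closed_fm i j (ClsMem s T) \<longleftrightarrow> tclosed i s \<and> tclosed j T"
| "closed_fm i j (Neg \<phi>) \<longleftrightarrow> closed_fm i j \<phi>"
| "closed_fm i j (Conj \<phi> \<psi>) \<longleftrightarrow> closed_fm i j \<phi> \<and> closed_fm i j \<psi>"
| "closed_fm i j (AllSet \<phi>) \<longleftrightarrow> closed_fm (Suc i) j \<phi>"
| "closed_fm i j (AllCls \<phi>) \<longleftrightarrow> closed_fm i (Suc j) \<phi>"

definition language :: "('s, 'c) struct \<Rightarrow> ('s, 'c) fm set" where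
  "language M = {\<phi>. spars \<phi> \<subseteq> Sets M \<and> cpars \<phi> \<subseteq> Classes M}"

text \<open>First-order formulas quantify over sets only, but may have class parameters.\<close>

primrec first_order :: "('s, 'c) fm \<Rightarrow> bool" where
  "first_order (SetEq s t) \<longleftrightarrow> True"
| "first_order (SetMem s t) \<longleftrightarrow> True"
| "first_order (ClsEq S T) \<longleftrightarrow> True"
| "first_order (ClsMem s T) \<longleftrightarrow> True"
| "first_order (Neg \<phi>) \<longleftrightarrow> first_order \<phi>"
| "first_order (Conj \<phi> \<psi>) \<longleftrightarrow> first_order \<phi> \<and> first_order \<psi>"
| "first_order (AllSet \<phi>) \<longleftrightarrow> first_order \<phi>"
| "first_order (AllCls \<phi>) \<longleftrightarrow> False"


section \<open>The second-order elementary diagram\<close>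

text \<open>An explicit, effective Goedel numbering: oracle computations act on its values.\<close>

fun trm_code :: "nat trm \<Rightarrow> nat" where
  "trm_code (Var n) = 2 * n"
| "trm_code (Par a) = 2 * a + 1"

primrec fm_code :: "(nat, nat) fm \<Rightarrow> nat" where
  "fm_code (SetEq s t) = prod_encode (0, prod_encode (trm_code s, trm_code t))"
| "fm_code (SetMem s t) = prod_encode (1, prod_encode (trm_code s, trm_code t))"
| "fm_code (ClsEq S T) = prod_encode (2, prod_encode (trm_code S, trm_code T))"
| "fm_code (ClsMem s T) = prod_encode (3, prod_encode (trm_code s, trm_code T))"
| "fm_code (Neg \<phi>) = prod_encode (4, fm_code \<phi>)"
| "fm_code (Conj \<phi> \<psi>) = prod_encode (5, prod_encode (fm_code \<phi>, fm_code \<psi>))"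
| "fm_code (AllSet \<phi>) = prod_encode (6, fm_code \<phi>)"
| "fm_code (AllCls \<phi>) = prod_encode (7, fm_code \<phi>)"

lemma trm_code_inject: "trm_code s = trm_code t \<longleftrightarrow> s = t"
  by (cases s; cases t) (auto, presburger+)

lemma fm_code_inject: "fm_code \<phi> = fm_code \<psi> \<longleftrightarrow> \<phi> = \<psi>"
proof (induction \<phi> arbitrary: \<psi>)
qed (case_tac \<psi>; simp add: trm_code_inject)+

text \<open>A sentence has no free variables, so the universal quantifier over assignments is immaterial.\<close>

definition so_diagram :: "(nat, nat) struct \<Rightarrow> nat set" where
  "so_diagram M = {fm_code \<phi> |\<phi>. \<phi> \<in> language M \<and> closed_fm 0 0 \<phi> \<and>
     (\<forall>e E. range e \<subseteq> Sets M \<longrightarrow> range E \<subseteq> Classes M \<longrightarrow> sat M e E \<phi>)}"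


section \<open>Models of GB\<close>

text \<open>Pairs are unordered pairs \<open>c = {a, b}\<close> and Kuratowski pairs \<open>z = {{a}, {a, b}}\<close> in the sense of \<open>M\<close>.\<close>

definition is_upair :: "('s, 'c) struct \<Rightarrow> 's \<Rightarrow> 's \<Rightarrow> 's \<Rightarrow> bool" where
  "is_upair M a b c \<longleftrightarrow> (\<forall>x\<in>Sets M. smem M x c \<longleftrightarrow> x = a \<or> x = b)"

definition is_pair :: "('s, 'c) struct \<Rightarrow> 's \<Rightarrow> 's \<Rightarrow> 's \<Rightarrow> bool" where
  "is_pair M a b z \<longleftrightarrow>
     (\<exists>u\<in>Sets M. \<exists>v\<in>Sets M. is_upair M a a u \<and> is_upair M a b v \<and> is_upair M u v z)"

text \<open>\<open>crel2 M X a b\<close> is \<open>\<langle>a, b\<rangle> \<in> X\<close> and \<open>crel3 M X a b c\<close> is \<open>\<langle>a, \<langle>b, c\<rangle>\<rangle> \<in> X\<close>.\<close>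

definition crel2 :: "('s, 'c) struct \<Rightarrow> 'c \<Rightarrow> 's \<Rightarrow> 's \<Rightarrow> bool" where
  "crel2 M X a b \<longleftrightarrow> (\<exists>z\<in>Sets M. is_pair M a b z \<and> cmem M z X)"

definition crel3 :: "('s, 'c) struct \<Rightarrow> 'c \<Rightarrow> 's \<Rightarrow> 's \<Rightarrow> 's \<Rightarrow> bool" where
  "crel3 M X a b c \<longleftrightarrow> (\<exists>w\<in>Sets M. is_pair M b c w \<and> crel2 M X a w)"

definition set_axioms :: "('s, 'c) struct \<Rightarrow> bool" where
  "set_axioms M \<longleftrightarrow>
     \<comment> \<open>extensionality\<close>
     (\<forall>a\<in>Sets M. \<forall>b\<in>Sets M. (\<forall>x\<in>Sets M. smem M x a \<longleftrightarrow> smem M x b) \<longrightarrow> a = b) \<and>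
     \<comment> \<open>foundation\<close>
     (\<forall>a\<in>Sets M. (\<exists>x\<in>Sets M. smem M x a) \<longrightarrow>
        (\<exists>x\<in>Sets M. smem M x a \<and> \<not> (\<exists>y\<in>Sets M. smem M y x \<and> smem M y a))) \<and>
     \<comment> \<open>pairing\<close>
     (\<forall>a\<in>Sets M. \<forall>b\<in>Sets M. \<exists>c\<in>Sets M. is_upair M a b c) \<and>
     \<comment> \<open>union\<close>
     (\<forall>a\<in>Sets M. \<exists>u\<in>Sets M. \<forall>x\<in>Sets M. smem M x u \<longleftrightarrow> (\<exists>y\<in>Sets M. smem M x y \<and> smem M y a)) \<and>
     \<comment> \<open>power set\<close>
     (\<forall>a\<in>Sets M. \<exists>p\<in>Sets M. \<forall>x\<in>Sets M.
        smem M x p \<longleftrightarrow> (\<forall>y\<in>Sets M. smem M y x \<longrightarrow> smem M y a)) \<and>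
     \<comment> \<open>infinity\<close>
     (\<exists>w\<in>Sets M.
        (\<exists>z\<in>Sets M. smem M z w \<and> (\<forall>x\<in>Sets M. \<not> smem M x z)) \<and>
        (\<forall>x\<in>Sets M. smem M x w \<longrightarrow>
           (\<exists>y\<in>Sets M. smem M y w \<and> (\<forall>u\<in>Sets M. smem M u y \<longleftrightarrow> smem M u x \<or> u = x))))"

definition class_axioms :: "('s, 'c) struct \<Rightarrow> bool" where
  "class_axioms M \<longleftrightarrow>
     \<comment> \<open>extensionality\<close>
     (\<forall>X\<in>Classes M. \<forall>Y\<in>Classes M. (\<forall>x\<in>Sets M. cmem M x X \<longleftrightarrow> cmem M x Y) \<longrightarrow> X = Y) \<and>
     \<comment> \<open>replacement; class functions may be partial, which also yields separation\<close>
     (\<forall>F\<in>Classes M.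
        (\<forall>x\<in>Sets M. \<forall>y\<in>Sets M. \<forall>z\<in>Sets M. crel2 M F x y \<and> crel2 M F x z \<longrightarrow> y = z) \<longrightarrow>
        (\<forall>a\<in>Sets M. \<exists>b\<in>Sets M. \<forall>y\<in>Sets M.
           smem M y b \<longleftrightarrow> (\<exists>x\<in>Sets M. smem M x a \<and> crel2 M F x y))) \<and>
     \<comment> \<open>comprehension for first-order formulas with set and class parameters\<close>
     (\<forall>\<phi>\<in>language M. first_order \<phi> \<longrightarrow>
        (\<forall>e E. range e \<subseteq> Sets M \<longrightarrow> range E \<subseteq> Classes M \<longrightarrow>
           (\<exists>X\<in>Classes M. \<forall>x\<in>Sets M. cmem M x X \<longleftrightarrow> sat M (case_nat x e) E \<phi>)))"

text \<open>
  No choice principle is included. Foundation is stated for sets; for classes it follows by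
  replacement and comprehension.
\<close>

definition GB :: "('s, 'c) struct \<Rightarrow> bool" where
  "GB M \<longleftrightarrow> Sets M \<noteq> {} \<and> Classes M \<noteq> {} \<and> set_axioms M \<and> class_axioms M"


section \<open>Class forcing\<close>

text \<open>
  A class forcing notion is given by two classes: \<open>P\<close>, the conditions, and \<open>L\<close>, the class of pairs
  \<open>\<langle>p, q\<rangle>\<close> with \<open>p \<le> q\<close>. It is a preorder with a greatest element; smaller conditions are stronger.
\<close>

definition conds :: "('s, 'c) struct \<Rightarrow> 'c \<Rightarrow> 's set" where
  "conds M P = {p \<in> Sets M. cmem M p P}"

definition forcing_notion :: "('s, 'c) struct \<Rightarrow> 'c \<Rightarrow> 'c \<Rightarrow> bool" where
  "forcing_notion M P L \<longleftrightarrow> P \<in> Classes M \<and> L \<in> Classes M \<and>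
     (\<forall>p\<in>conds M P. crel2 M L p p) \<and>
     (\<forall>p\<in>conds M P. \<forall>q\<in>conds M P. \<forall>r\<in>conds M P.
        crel2 M L p q \<longrightarrow> crel2 M L q r \<longrightarrow> crel2 M L p r) \<and>
     (\<exists>one\<in>conds M P. \<forall>p\<in>conds M P. crel2 M L p one)"

definition dense_class :: "('s, 'c) struct \<Rightarrow> 'c \<Rightarrow> 'c \<Rightarrow> 'c \<Rightarrow> bool" where
  "dense_class M P L D \<longleftrightarrow> D \<in> Classes M \<and> conds M D \<subseteq> conds M P \<and>
     (\<forall>p\<in>conds M P. \<exists>q\<in>conds M D. crel2 M L q p)"

definition is_filter :: "('s, 'c) struct \<Rightarrow> 'c \<Rightarrow> 'c \<Rightarrow> 's set \<Rightarrow> bool" where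
  "is_filter M P L G \<longleftrightarrow> G \<subseteq> conds M P \<and> G \<noteq> {} \<and>
     (\<forall>p\<in>G. \<forall>q\<in>conds M P. crel2 M L p q \<longrightarrow> q \<in> G) \<and>
     (\<forall>p\<in>G. \<forall>q\<in>G. \<exists>r\<in>G. crel2 M L r p \<and> crel2 M L r q)"

definition generic_filter :: "('s, 'c) struct \<Rightarrow> 'c \<Rightarrow> 'c \<Rightarrow> 's set \<Rightarrow> bool" where
  "generic_filter M P L G \<longleftrightarrow> is_filter M P L G \<and>
     (\<forall>D. dense_class M P L D \<longrightarrow> G \<inter> conds M D \<noteq> {})"

text \<open>
  The recursion inside \<open>M\<close> defining the class of set \<open>P\<close>-names: \<open>\<sigma>\<close> is a name iff every element of
  \<open>\<sigma>\<close> is a pair \<open>\<langle>\<rho>, p\<rangle>\<close> of a name \<open>\<rho>\<close> and a condition \<open>p\<close>. In a model of GB exactly one class solves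
  it. The recursion has to be internal, as \<open>M\<close> may be ill-founded.
\<close>

definition solves_name_recursion :: "('s, 'c) struct \<Rightarrow> 'c \<Rightarrow> 'c \<Rightarrow> bool" where
  "solves_name_recursion M P V \<longleftrightarrow> V \<in> Classes M \<and>
     (\<forall>\<sigma>\<in>Sets M. cmem M \<sigma> V \<longleftrightarrow>
        (\<forall>z\<in>Sets M. smem M z \<sigma> \<longrightarrow>
           (\<exists>\<rho>\<in>Sets M. \<exists>p\<in>conds M P. is_pair M \<rho> p z \<and> cmem M \<rho> V)))"

definition set_names :: "('s, 'c) struct \<Rightarrow> 'c \<Rightarrow> 's set" where
  "set_names M P = {\<sigma> \<in> Sets M. \<exists>V. solves_name_recursion M P V \<and> cmem M \<sigma> V}"

definition class_names :: "('s, 'c) struct \<Rightarrow> 'c \<Rightarrow> 'c set" where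
  "class_names M P = {\<Gamma> \<in> Classes M. \<forall>z\<in>Sets M. cmem M z \<Gamma> \<longrightarrow>
     (\<exists>\<rho>\<in>set_names M P. \<exists>p\<in>conds M P. is_pair M \<rho> p z)}"

text \<open>The pairs \<open>\<langle>\<rho>, r\<rangle>\<close> belonging to a set name, respectively to a class name.\<close>

definition set_entries :: "('s, 'c) struct \<Rightarrow> 'c \<Rightarrow> 's \<Rightarrow> ('s \<times> 's) set" where
  "set_entries M P \<sigma> = {(\<rho>, r). \<rho> \<in> set_names M P \<and> r \<in> conds M P \<and>
     (\<exists>z\<in>Sets M. is_pair M \<rho> r z \<and> smem M z \<sigma>)}"

definition class_entries :: "('s, 'c) struct \<Rightarrow> 'c \<Rightarrow> 'c \<Rightarrow> ('s \<times> 's) set" where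
  "class_entries M P \<Gamma> = {(\<rho>, r). \<rho> \<in> set_names M P \<and> r \<in> conds M P \<and> crel2 M \<Gamma> \<rho> r}"

text \<open>
  The recursive clauses for atomic forcing, for names given by their entries.
  \<open>p\<close> forces \<open>\<sigma> \<in> A\<close> iff the conditions \<open>q\<close> such that \<open>q \<le> r\<close> and \<open>q\<close> forces \<open>\<sigma> = \<rho>\<close> for some entry
  \<open>\<langle>\<rho>, r\<rangle>\<close> of \<open>A\<close> are dense below \<open>p\<close>.
  \<open>p\<close> forces \<open>A \<subseteq> B\<close> iff \<open>q\<close> forces \<open>\<rho> \<in> B\<close> for every entry \<open>\<langle>\<rho>, r\<rangle>\<close> of \<open>A\<close> and every \<open>q \<le> p, r\<close>.
\<close>

definition mem_clause ::
  "('s, 'c) struct \<Rightarrow> 'c \<Rightarrow> 'c \<Rightarrow> ('s \<Rightarrow> 's \<Rightarrow> 's \<Rightarrow> bool) \<Rightarrow> 's \<Rightarrow> 's \<Rightarrow> ('s \<times> 's) set \<Rightarrow> bool" where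
  "mem_clause M P L forces_eq p \<sigma> A \<longleftrightarrow>
     (\<forall>p'\<in>conds M P. crel2 M L p' p \<longrightarrow>
        (\<exists>q\<in>conds M P. crel2 M L q p' \<and> (\<exists>(\<rho>, r)\<in>A. crel2 M L q r \<and> forces_eq q \<sigma> \<rho>)))"

definition subset_clause ::
  "('s, 'c) struct \<Rightarrow> 'c \<Rightarrow> 'c \<Rightarrow> 's \<Rightarrow> ('s \<times> 's) set \<Rightarrow> ('s \<Rightarrow> 's \<Rightarrow> bool) \<Rightarrow> bool" where
  "subset_clause M P L p A forces_mem_B \<longleftrightarrow>
     (\<forall>(\<rho>, r)\<in>A. \<forall>q\<in>conds M P. crel2 M L q p \<longrightarrow> crel2 M L q r \<longrightarrow> forces_mem_B q \<rho>)"

text \<open>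
  \<open>FE\<close> and \<open>FI\<close> are the classes of triples \<open>\<langle>p, \<langle>\<sigma>, \<tau>\<rangle>\<rangle>\<close> such that \<open>p\<close> forces \<open>\<sigma> = \<tau>\<close>, respectively
  \<open>\<sigma> \<in> \<tau>\<close>. On conditions and set names they are determined by these clauses, by \<open>\<in>\<close>-induction in \<open>M\<close>.
\<close>

definition atomic_forcing_relation ::
  "('s, 'c) struct \<Rightarrow> 'c \<Rightarrow> 'c \<Rightarrow> 'c \<Rightarrow> 'c \<Rightarrow> bool" where
  "atomic_forcing_relation M P L FE FI \<longleftrightarrow> FE \<in> Classes M \<and> FI \<in> Classes M \<and>
     (\<forall>p\<in>conds M P. \<forall>\<sigma>\<in>set_names M P. \<forall>\<tau>\<in>set_names M P.
        (crel3 M FI p \<sigma> \<tau> \<longleftrightarrow> mem_clause M P L (crel3 M FE) p \<sigma> (set_entries M P \<tau>)) \<and>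
        (crel3 M FE p \<sigma> \<tau> \<longleftrightarrow>
           subset_clause M P L p (set_entries M P \<sigma>) (\<lambda>q \<rho>. crel3 M FI q \<rho> \<tau>) \<and>
           subset_clause M P L p (set_entries M P \<tau>) (\<lambda>q \<rho>. crel3 M FI q \<rho> \<sigma>)))"

text \<open>The same clauses give the atomic forcing relation for class names.\<close>

definition forces_class_mem ::
  "('s, 'c) struct \<Rightarrow> 'c \<Rightarrow> 'c \<Rightarrow> 'c \<Rightarrow> 's \<Rightarrow> 's \<Rightarrow> 'c \<Rightarrow> bool" where
  "forces_class_mem M P L FE p \<sigma> \<Gamma> \<longleftrightarrow>
     mem_clause M P L (crel3 M FE) p \<sigma> (class_entries M P \<Gamma>)"

definition forces_class_eq ::
  "('s, 'c) struct \<Rightarrow> 'c \<Rightarrow> 'c \<Rightarrow> 'c \<Rightarrow> 's \<Rightarrow> 'c \<Rightarrow> 'c \<Rightarrow> bool" where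
  "forces_class_eq M P L FE p \<Gamma> \<Delta> \<longleftrightarrow>
     subset_clause M P L p (class_entries M P \<Gamma>) (\<lambda>q \<rho>. forces_class_mem M P L FE q \<rho> \<Delta>) \<and>
     subset_clause M P L p (class_entries M P \<Delta>) (\<lambda>q \<rho>. forces_class_mem M P L FE q \<rho> \<Gamma>)"

text \<open>
  \<open>M[G]\<close>: set names and class names modulo forced equality, with forced membership. The names cannot
  be evaluated by an external recursion, as \<open>M\<close> may be ill-founded.
\<close>

definition set_name_eq ::
  "('s, 'c) struct \<Rightarrow> 'c \<Rightarrow> 'c \<Rightarrow> 's set \<Rightarrow> ('s \<times> 's) set" where
  "set_name_eq M P FE G = {(\<sigma>, \<tau>). \<sigma> \<in> set_names M P \<and> \<tau> \<in> set_names M P \<and>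
     (\<exists>p\<in>G. crel3 M FE p \<sigma> \<tau>)}"

definition class_name_eq ::
  "('s, 'c) struct \<Rightarrow> 'c \<Rightarrow> 'c \<Rightarrow> 'c \<Rightarrow> 's set \<Rightarrow> ('c \<times> 'c) set" where
  "class_name_eq M P L FE G = {(\<Gamma>, \<Delta>). \<Gamma> \<in> class_names M P \<and> \<Delta> \<in> class_names M P \<and>
     (\<exists>p\<in>G. forces_class_eq M P L FE p \<Gamma> \<Delta>)}"

definition generic_extension ::
  "('s, 'c) struct \<Rightarrow> 'c \<Rightarrow> 'c \<Rightarrow> 'c \<Rightarrow> 'c \<Rightarrow> 's set \<Rightarrow> ('s set, 'c set) struct" where
  "generic_extension M P L FE FI G =
     \<lparr>Sets = set_names M P // set_name_eq M P FE G,
      Classes = class_names M P // class_name_eq M P L FE G,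
      smem = (\<lambda>a b. \<exists>\<sigma>\<in>a. \<exists>\<tau>\<in>b. \<exists>p\<in>G. crel3 M FI p \<sigma> \<tau>),
      cmem = (\<lambda>a X. \<exists>\<sigma>\<in>a. \<exists>\<Gamma>\<in>X. \<exists>p\<in>G. forces_class_mem M P L FE p \<sigma> \<Gamma>)\<rparr>"


section \<open>Oracle computability\<close>

text \<open>Kleene's partial recursive functions relative to an oracle \<open>A\<close>.\<close>

datatype prog =
    Zero
  | Succ
  | Proj nat
  | Oracle
  | Comp prog "prog list"
  | PrimRec prog prog
  | Mu prog

inductive computes :: "nat set \<Rightarrow> prog \<Rightarrow> nat list \<Rightarrow> nat \<Rightarrow> bool" for A :: "nat set" where
  zero: "computes A Zero xs 0"
| succ: "computes A Succ (x # xs) (Suc x)"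
| proj: "i < length xs \<Longrightarrow> computes A (Proj i) xs (xs ! i)"
| query: "computes A Oracle (x # xs) (if x \<in> A then 1 else 0)"
| comp: "list_all2 (\<lambda>g y. computes A g xs y) gs ys \<Longrightarrow> computes A f ys z \<Longrightarrow>
    computes A (Comp f gs) xs z"
| rec_0: "computes A f xs y \<Longrightarrow> computes A (PrimRec f g) (0 # xs) y"
| rec_Suc: "computes A (PrimRec f g) (n # xs) y \<Longrightarrow> computes A g (n # y # xs) z \<Longrightarrow>
    computes A (PrimRec f g) (Suc n # xs) z"
| mu: "computes A f (n # xs) 0 \<Longrightarrow> (\<And>m. m < n \<Longrightarrow> \<exists>y. computes A f (m # xs) (Suc y)) \<Longrightarrow>
    computes A (Mu f) xs n"

definition computable_from :: "nat set \<Rightarrow> nat set \<Rightarrow> bool" where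
  "computable_from A B \<longleftrightarrow> (\<exists>f. \<forall>n. computes A f [n] (if n \<in> B then 1 else 0))"

end

theory Submission
  imports Defs "HOL-Library.Infinite_Set"
begin

text \<open>
  The filter \<open>G\<close> is generated by a descending sequence of conditions which decides every second-order
  formula with parameters, not just the dense classes: at stage \<open>n\<close> the oracle tells whether some
  extension of the current condition satisfies the formula with code \<open>n\<close>, and if so one is found by
  search. For second-order formulas, whose forcing relation need not be a class of \<open>M\<close>, this extra
  genericity is what makes the truth lemma hold. The forcing relation of a formula is itself expressed by a
  formula obtained effectively, so truth in \<open>M[G]\<close> is decided by running through the sequence until
  a condition forces the sentence or its negation. A presentation of \<open>M[G]\<close> on \<open>\<omega>\<close> arises by listing
  the names that are not equal in \<open>M[G]\<close> to a smaller name; the names \<open>x\<^sub>0 = \<emptyset>\<close>, \<open>x\<^sub>n\<^sub>+\<^sub>1 = {\<langle>x\<^sub>n, 1\<rangle>}\<close> show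
  that there are infinitely many.
\<close>

section \<open>Functions computable from an oracle\<close>

text \<open>\<open>M\<close> may be ill-founded, so nothing about names can be proved by an
  induction outside \<open>M\<close>. Induction on names runs inside \<open>M\<close>, through
  foundation applied to sets of counterexamples, and it covers only predicates shown to be
  first-order definable; \<open>definable\<close> therefore carries a flag. The oracle, in turn,
  knows sentences only, and each question put to it must be produced from numbers by a program.
  Effective substitution is avoided: a value \<open>a\<close> is plugged in as
  \<open>\<forall>x (x = a \<longrightarrow> ...)\<close>, and the finitely many formulas that
  describe the forcing notion are chosen by their meaning alone, since their codes are constants of
  the program. Formulas chosen in this way are not known to be syntactically closed, so what is
  tracked is independence of the environment, and a universal closure whose length is read off the
  code is formed before the oracle is asked. The extra genericity is spent on the universal case of
  the truth lemma, for the property of a condition to force \<open>\<not> \<phi>(\<sigma>)\<close>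
  for some name \<open>\<sigma>\<close>.\<close>

definition computable :: "nat set \<Rightarrow> nat \<Rightarrow> ((nat \<Rightarrow> nat) \<Rightarrow> nat) \<Rightarrow> bool" where
  "computable A k h \<longleftrightarrow> (\<exists>f. \<forall>e. computes A f (map e [0..<k]) (h e))"

definition decidable :: "nat set \<Rightarrow> nat \<Rightarrow> ((nat \<Rightarrow> nat) \<Rightarrow> bool) \<Rightarrow> bool" where
  "decidable A k Q \<longleftrightarrow> computable A k (\<lambda>e. of_bool (Q e))"

lemma map_case_nat_upt: "map (case_nat n e) [0..<Suc k] = n # map e [0..<k]"
  by (simp add: upt_conv_Cons map_Suc_upt[symmetric] o_def del: upt_Suc)

lemma computable_var: "i < k \<Longrightarrow> computable A k (\<lambda>e. e i)"
  unfolding computable_def using computes.proj[of i "map e [0..<k]" A for e]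
  by (intro exI[of _ "Proj i"]) simp

text \<open>Arguments are the first \<open>k\<close> values of an environment. A function of
  \<open>k\<close> arguments is thus a lambda term in \<open>e 0\<close>, ...,
  \<open>e (k - 1)\<close>, and substitution for its arguments is composition with another
  environment.\<close>

lemma computable_compose:
  assumes "computable A n g" and "\<And>i. i < n \<Longrightarrow> computable A k (h i)"
  shows "computable A k (\<lambda>e. g (\<lambda>i. h i e))"
proof -
  obtain f where f: "\<And>e. computes A f (map e [0..<n]) (g e)"
    using assms(1) by (auto simp: computable_def)
  obtain F where F: "\<And>i e. i < n \<Longrightarrow> computes A (F i) (map e [0..<k]) (h i e)"
    using assms(2) unfolding computable_def by metis
  have "computes A (Comp f (map F [0..<n])) (map e [0..<k]) (g (\<lambda>i. h i e))" for e
    by (rule computes.comp[OF _ f]) (auto simp: list_all2_conv_all_nth F)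
  then show ?thesis by (auto simp: computable_def)
qed

lemma computable_comp1:
  assumes "computable A 1 (\<lambda>e. g (e 0))" "computable A k h"
  shows "computable A k (\<lambda>e. g (h e))"
  using computable_compose[OF assms(1), of k "\<lambda>_. h"] assms(2) by simp

lemma computable_comp3:
  assumes "computable A 3 (\<lambda>e. g (e 0) (e 1) (e 2))"
    "computable A k h0" "computable A k h1" "computable A k h2"
  shows "computable A k (\<lambda>e. g (h0 e) (h1 e) (h2 e))"
  using computable_compose[OF assms(1), of k "\<lambda>i. if i = 0 then h0 else if i = 1 then h1 else h2"]
    assms(2-4) by simp

lemma computable_Suc:
  assumes "computable A k h" shows "computable A k (\<lambda>e. Suc (h e))"
proof (rule computable_comp1[OF _ assms])
  show "computable A 1 (\<lambda>e. Suc (e 0))"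
    unfolding computable_def by (intro exI[of _ Succ]) (auto intro: computes.succ)
qed

lemma computable_const: "computable A k (\<lambda>e. c)"
proof (induction c)
  case 0
  show ?case unfolding computable_def by (intro exI[of _ Zero]) (auto intro: computes.zero)
qed (rule computable_Suc)

lemma decidable_oracle:
  assumes "computable A k h" shows "decidable A k (\<lambda>e. h e \<in> A)"
  unfolding decidable_def
proof (rule computable_comp1[OF _ assms])
  have "computes A Oracle (map e [0..<1]) (of_bool (e 0 \<in> A))" for e
    using computes.query[of A "e 0" "[]"] by (cases "e 0 \<in> A") simp_all
  then show "computable A 1 (\<lambda>e. of_bool (e 0 \<in> A))"
    unfolding computable_def by blast
qed

text \<open>The step reads the counter at \<open>e 0\<close>, the previous value at
  \<open>e 1\<close> and the parameters from index 2 on. Composing with \<open>case_nat m\<close>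
  turns recursion on the first argument into recursion up to a computed bound.\<close>

lemma computable_rec:
  assumes b: "computable A k b"
    and s: "computable A (Suc (Suc k)) (\<lambda>e. s (e 0) (e 1) (\<lambda>i. e (Suc (Suc i))))"
    and m: "computable A k m"
  shows "computable A k (\<lambda>e. rec_nat (b e) (\<lambda>n y. s n y e) (m e))"
proof -
  obtain fb where fb: "\<And>e. computes A fb (map e [0..<k]) (b e)"
    using b by (auto simp: computable_def)
  obtain fs where "\<And>e. computes A fs (map e [0..<Suc (Suc k)]) (s (e 0) (e 1) (\<lambda>i. e (Suc (Suc i))))"
    using s by (auto simp: computable_def)
  from this[of "case_nat n (case_nat y e)" for n y e]
  have fs: "computes A fs (n # y # map e [0..<k]) (s n y e)" for n y e
    by (simp only: map_case_nat_upt) simp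
  have "computes A (PrimRec fb fs) (n # map e [0..<k]) (rec_nat (b e) (\<lambda>n y. s n y e) n)" for n e
    by (induction n) (auto intro: computes.rec_0 computes.rec_Suc fb fs)
  moreover have "map e [0..<Suc k] = e 0 # map (\<lambda>i. e (Suc i)) [0..<k]" for e :: "nat \<Rightarrow> nat"
    by (simp add: upt_conv_Cons map_Suc_upt[symmetric] o_def del: upt_Suc)
  ultimately have "computes A (PrimRec fb fs) (map e [0..<Suc k])
      (rec_nat (b (\<lambda>i. e (Suc i))) (\<lambda>n y. s n y (\<lambda>i. e (Suc i))) (e 0))" for e
    by (simp only:)
  then have "computable A (Suc k) (\<lambda>e. rec_nat (b (\<lambda>i. e (Suc i))) (\<lambda>n y. s n y (\<lambda>i. e (Suc i))) (e 0))"
    unfolding computable_def by blast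
  from computable_compose[OF this, of k "case_nat m (\<lambda>i e. e i)"] m
  show ?thesis by (simp add: computable_var split: nat.split)
qed

lemma computable_mu:
  assumes f: "computable A (Suc k) (\<lambda>e. f (e 0) (\<lambda>i. e (Suc i)))"
    and ex: "\<And>e. \<exists>n. f n e = 0"
  shows "computable A k (\<lambda>e. LEAST n. f n e = 0)"
proof -
  obtain c where "\<And>e. computes A c (map e [0..<Suc k]) (f (e 0) (\<lambda>i. e (Suc i)))"
    using f by (auto simp: computable_def)
  from this[of "case_nat n e" for n e]
  have c: "computes A c (n # map e [0..<k]) (f n e)" for n e
    by (simp only: map_case_nat_upt) simp
  have "computes A (Mu c) (map e [0..<k]) (LEAST n. f n e = 0)" for e
  proof (rule computes.mu)
    show "computes A c ((LEAST n. f n e = 0) # map e [0..<k]) 0"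
      using c[of "LEAST n. f n e = 0" e] LeastI_ex[OF ex[of e]] by simp
    show "\<exists>y. computes A c (m # map e [0..<k]) (Suc y)" if "m < (LEAST n. f n e = 0)" for m
      using c[of m e] not_less_Least[OF that] by (metis not0_implies_Suc)
  qed
  then show ?thesis by (auto simp: computable_def)
qed

lemma computable_pred:
  assumes "computable A k h" shows "computable A k (\<lambda>e. h e - 1)"
proof -
  have eq: "n - 1 = rec_nat 0 (\<lambda>i y. i) n" for n :: nat by (cases n) auto
  show ?thesis unfolding eq
    by (rule computable_rec[where s="\<lambda>n y e. n"]) (simp_all add: computable_const computable_var assms)
qed

lemma computable_add:
  assumes "computable A k g" "computable A k h" shows "computable A k (\<lambda>e. g e + h e)"
proof -
  have eq: "m + n = rec_nat m (\<lambda>i y. Suc y) n" for m n :: nat by (induction n) auto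
  show ?thesis unfolding eq
    by (rule computable_rec[where s="\<lambda>n y e. Suc y"])
      (simp_all add: computable_Suc computable_var assms)
qed

lemma computable_diff:
  assumes "computable A k g" "computable A k h" shows "computable A k (\<lambda>e. g e - h e)"
proof -
  have eq: "rec_nat m (\<lambda>i y. y - 1) n = m - n" for m n :: nat by (induction n) auto
  have "computable A k (\<lambda>e. rec_nat (g e) (\<lambda>i y. y - 1) (h e))"
    by (rule computable_rec[where s="\<lambda>n y e. y - 1"])
      (simp_all add: computable_pred computable_var assms del: One_nat_def)
  then show ?thesis by (simp only: eq)
qed

text \<open>A recursion of length 0 or 1 on the truth value; both branches must be total.\<close>

lemma computable_if:
  assumes "decidable A k Q" "computable A k g" "computable A k h"
  shows "computable A k (\<lambda>e. if Q e then g e else h e)"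
proof -
  have eq: "(if Q e then g e else h e) = rec_nat (h e) (\<lambda>i y. g e) (of_bool (Q e))" for e
    by simp
  have "computable A (Suc (Suc k)) (\<lambda>e. g (\<lambda>i. e (Suc (Suc i))))"
    using computable_compose[OF assms(2), of "Suc (Suc k)" "\<lambda>i e. e (Suc (Suc i))"]
    by (simp add: computable_var)
  then show ?thesis unfolding eq
    using assms(1,3) unfolding decidable_def by (intro computable_rec[where s="\<lambda>n y e. g e"])
qed

lemma decidable_not:
  assumes "decidable A k Q" shows "decidable A k (\<lambda>e. \<not> Q e)"
proof -
  have "of_bool (\<not> Q e) = (1::nat) - of_bool (Q e)" for e by simp
  then show ?thesis
    using assms unfolding decidable_def by (simp only: computable_diff computable_const)
qed

lemma decidable_conj:
  assumes "decidable A k Q" "decidable A k R" shows "decidable A k (\<lambda>e. Q e \<and> R e)"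
proof -
  have "of_bool (Q e \<and> R e) = (if Q e then of_bool (R e) else 0::nat)" for e by simp
  then show ?thesis using computable_if[OF assms(1), of "\<lambda>e. of_bool (R e)" "\<lambda>_. 0"] assms(2)
    unfolding decidable_def by (simp only: computable_const)
qed

lemma decidable_disj:
  "decidable A k Q \<Longrightarrow> decidable A k R \<Longrightarrow> decidable A k (\<lambda>e. Q e \<or> R e)"
  using decidable_not[OF decidable_conj[OF decidable_not decidable_not], of A k Q R] by simp

lemma decidable_eq_0:
  assumes "computable A k h" shows "decidable A k (\<lambda>e. h e = 0)"
proof -
  have "of_bool (h e = 0) = 1 - h e" for e by simp
  then show ?thesis
    using assms unfolding decidable_def by (simp only: computable_diff computable_const)
qed

lemma decidable_le:
  assumes "computable A k g" "computable A k h" shows "decidable A k (\<lambda>e. g e \<le> h e)"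
  using decidable_eq_0[OF computable_diff[OF assms]] by simp

lemma decidable_less:
  assumes "computable A k g" "computable A k h" shows "decidable A k (\<lambda>e. g e < h e)"
  using decidable_not[OF decidable_le[OF assms(2,1)]] by (simp add: not_le)

lemma decidable_eq:
  assumes "computable A k g" "computable A k h" shows "decidable A k (\<lambda>e. g e = h e)"
  using decidable_conj[OF decidable_le[OF assms] decidable_le[OF assms(2,1)]]
  by (simp add: eq_iff)

lemma computable_Least:
  assumes "decidable A (Suc k) (\<lambda>e. Q (e 0) (\<lambda>i. e (Suc i)))" and "\<And>e. \<exists>n. Q n e"
  shows "computable A k (\<lambda>e. LEAST n. Q n e)"
  using computable_mu[of A k "\<lambda>n e. of_bool (\<not> Q n e)"] decidable_not[OF assms(1)] assms(2)
  unfolding decidable_def by simp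

text \<open>A search for the least \<open>n\<close> that is the bound or a counterexample always
  stops, and it stops at the bound exactly if there is no counterexample.\<close>

lemma decidable_all_less:
  assumes "decidable A (Suc k) (\<lambda>e. Q (e 0) (\<lambda>i. e (Suc i)))" and m: "computable A k m"
  shows "decidable A k (\<lambda>e. \<forall>n<m e. Q n e)"
proof -
  have m': "computable A (Suc k) (\<lambda>e. m (\<lambda>i. e (Suc i)))"
    using computable_compose[OF m, of "Suc k" "\<lambda>i e. e (Suc i)"] by (simp add: computable_var)
  have "computable A k (\<lambda>e. LEAST n. n = m e \<or> \<not> Q n e)"
    by (rule computable_Least) (auto intro!: decidable_disj decidable_not decidable_eq assms m' computable_var)
  from decidable_eq[OF this m] show ?thesis
  proof (rule back_subst, intro arg_cong[where f="decidable A k"] ext)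
    fix e
    let ?R = "\<lambda>n. n = m e \<or> \<not> Q n e"
    have "?R (LEAST n. ?R n)" by (rule LeastI[of ?R "m e"]) simp
    moreover have "(LEAST n. ?R n) \<le> n" if "?R n" for n using that by (rule Least_le)
    ultimately show "((LEAST n. ?R n) = m e) = (\<forall>n<m e. Q n e)"
      by (metis le_neq_implies_less not_le)
  qed
qed

section \<open>The pairing function and its inverse\<close>

lemma computable_triangle:
  assumes "computable A k h" shows "computable A k (\<lambda>e. triangle (h e))"
proof -
  have eq: "triangle n = rec_nat 0 (\<lambda>i y. y + Suc i) n" for n by (induction n) auto
  show ?thesis unfolding eq
    by (rule computable_rec[where s="\<lambda>n y e. y + Suc n"])
      (simp_all only: computable_add computable_Suc computable_const computable_var assms lessI zero_less_Suc)
qed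

lemma computable_prod_encode:
  "computable A k g \<Longrightarrow> computable A k h \<Longrightarrow> computable A k (\<lambda>e. prod_encode (g e, h e))"
  unfolding prod_encode_def by (simp add: computable_add computable_triangle)

text \<open>As \<open>prod_encode (m, n)\<close> is \<open>triangle (m + n) + m\<close>, the
  diagonal \<open>m + n\<close> is the index of the last triangular number not above
  \<open>x\<close>. This makes decoding a search.\<close>

lemma prod_decode_triangle:
  fixes x :: nat
  defines "s \<equiv> LEAST s. x < triangle (Suc s)"
  shows "fst (prod_decode x) = x - triangle s" "snd (prod_decode x) = s - (x - triangle s)"
proof -
  obtain m n where x: "x = prod_encode (m, n)" by (metis surj_pair prod_decode_inverse)
  have mono: "triangle a \<le> triangle b" if "a \<le> b" for a b
    using that by (induction rule: dec_induct) auto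
  have "s = m + n" unfolding s_def
  proof (rule Least_equality)
    show "x < triangle (Suc (m + n))" by (simp add: x prod_encode_def)
    show "m + n \<le> t" if "x < triangle (Suc t)" for t
    proof (rule ccontr)
      assume "\<not> m + n \<le> t"
      then have "triangle (Suc t) \<le> triangle (m + n)" by (intro mono) simp
      with that show False by (simp add: x prod_encode_def)
    qed
  qed
  then show "fst (prod_decode x) = x - triangle s" "snd (prod_decode x) = s - (x - triangle s)"
    by (simp_all add: x) (simp_all add: prod_encode_def)
qed

lemma computable_prod_decode:
  assumes "computable A k h"
  shows "computable A k (\<lambda>e. fst (prod_decode (h e)))" "computable A k (\<lambda>e. snd (prod_decode (h e)))"
proof -
  have ex: "\<exists>s. x < triangle (Suc s)" for x by (rule exI[of _ x]) (induction x; simp)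
  have s: "computable A 1 (\<lambda>e. LEAST s. e 0 < triangle (Suc s))"
    by (rule computable_Least) (simp_all add: ex decidable_less computable_triangle computable_Suc computable_var
      del: triangle_Suc)
  note s' = computable_comp1[OF s assms]
  show "computable A k (\<lambda>e. fst (prod_decode (h e)))" "computable A k (\<lambda>e. snd (prod_decode (h e)))"
    unfolding prod_decode_triangle by (intro computable_diff computable_triangle s' assms)+
qed

lemma computable_mod_2:
  assumes "computable A k h" shows "computable A k (\<lambda>e. h e mod 2)"
proof -
  have eq: "n mod 2 = rec_nat 0 (\<lambda>i y. 1 - y) n" for n :: nat
  proof (induction n)
    case (Suc n)
    have "Suc n mod 2 = 1 - n mod 2" by presburger
    with Suc show ?case by simp
  qed simp
  show ?thesis unfolding eq
    by (rule computable_rec[where s="\<lambda>n y e. 1 - y"])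
      (simp_all only: computable_diff computable_const computable_var assms lessI zero_less_Suc One_nat_def)
qed

lemma computable_div_2:
  assumes "computable A k h" shows "computable A k (\<lambda>e. h e div 2)"
proof -
  have eq: "n div 2 = rec_nat 0 (\<lambda>i y. y + i mod 2) n" for n :: nat
  proof (induction n)
    case (Suc n)
    have "Suc n div 2 = n div 2 + n mod 2" by presburger
    with Suc show ?case by simp
  qed simp
  show ?thesis unfolding eq
    by (rule computable_rec[where s="\<lambda>n y e. y + n mod 2"])
      (simp_all only: computable_add computable_mod_2 computable_const computable_var assms lessI zero_less_Suc One_nat_def)
qed

text \<open>
  The history of the values \<open>T 0, \<dots>, T (n - 1)\<close> is coded as an iterated pair with the latest value first.
\<close>

primrec look_back :: "nat \<Rightarrow> nat \<Rightarrow> nat" where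
  "look_back h 0 = h"
| "look_back h (Suc n) = snd (prod_decode (look_back h n))"

definition hist_nth :: "nat \<Rightarrow> nat \<Rightarrow> nat \<Rightarrow> nat" where
  "hist_nth h n i = (if i < n then fst (prod_decode (look_back h (n - 1 - i))) else 0)"

primrec hist :: "(nat \<Rightarrow> nat \<Rightarrow> nat \<Rightarrow> nat) \<Rightarrow> (nat \<Rightarrow> nat) \<Rightarrow> (nat \<Rightarrow> nat) \<Rightarrow> nat \<Rightarrow> nat" where
  "hist H a b 0 = 0"
| "hist H a b (Suc n) = prod_encode
    (H n (hist_nth (hist H a b n) n (a n)) (hist_nth (hist H a b n) n (b n)), hist H a b n)"

lemma computable_hist_nth:
  assumes "computable A k h" "computable A k n" "computable A k i"
  shows "computable A k (\<lambda>e. hist_nth (h e) (n e) (i e))"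
proof -
  have eq: "look_back h n = rec_nat h (\<lambda>i y. snd (prod_decode y)) n" for h n by (induction n) auto
  have "computable A k (\<lambda>e. look_back (h e) (g e))" if "computable A k g" for g
    unfolding eq
    by (rule computable_rec[where s="\<lambda>n y e. snd (prod_decode y)"])
      (simp_all add: computable_prod_decode computable_var assms that)
  note look = this[OF computable_diff[OF computable_diff[OF assms(2) computable_const] assms(3)]]
  show ?thesis unfolding hist_nth_def
    by (intro computable_if decidable_less computable_prod_decode(1) look computable_const assms)
qed

lemma hist_nth_hist:
  assumes "i < n"
  shows "hist_nth (hist H a b n) n i = fst (prod_decode (hist H a b (Suc i)))"
proof -
  have shift: "look_back (snd (prod_decode h)) m = snd (prod_decode (look_back h m))" for h m
    by (induction m) simp_all
  have "look_back (hist H a b (m + Suc i)) m = hist H a b (Suc i)" for m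
  proof (induction m)
    case (Suc m)
    have "hist H a b (m + Suc i) = snd (prod_decode (hist H a b (Suc m + Suc i)))" by simp
    with Suc shift show ?case by (simp del: hist.simps)
  qed simp
  from this[of "n - 1 - i"] assms show ?thesis by (simp add: hist_nth_def del: hist.simps)
qed

text \<open>Primitive recursion sees the immediately preceding value only, while the code of a
  subformula may be any smaller number. Two look-ups, at \<open>a n\<close> and \<open>b n\<close>,
  are provided because a formula has at most two immediate subformulas; a look-up that does not go
  back returns 0.\<close>

lemma course_of_values:
  assumes H: "computable A 3 (\<lambda>e. H (e 0) (e 1) (e 2))"
    and ab: "computable A 1 (\<lambda>e. a (e 0))" "computable A 1 (\<lambda>e. b (e 0))"
  obtains T where "computable A 1 (\<lambda>e. T (e 0))"
    and "\<And>n. T n = H n (if a n < n then T (a n) else 0) (if b n < n then T (b n) else 0)"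
proof
  let ?T = "\<lambda>n. fst (prod_decode (hist H a b (Suc n)))"
  have eq: "hist H a b n = rec_nat 0 (\<lambda>n y. prod_encode
    (H n (hist_nth y n (a n)) (hist_nth y n (b n)), y)) n" for n by (induction n) auto
  have v: "computable A (Suc (Suc (Suc 0))) (\<lambda>e. e 0)" "computable A (Suc (Suc (Suc 0))) (\<lambda>e. e 1)"
    by (simp_all add: computable_var)
  have "computable A 1 (\<lambda>e. hist H a b (Suc (e 0)))"
    unfolding eq One_nat_def
    by (rule computable_rec[where s="\<lambda>n y e. prod_encode
      (H n (hist_nth y n (a n)) (hist_nth y n (b n)), y)"])
     (intro computable_Suc computable_var computable_const computable_prod_encode computable_comp3[OF H] computable_hist_nth v
       computable_comp1[OF ab(1)] computable_comp1[OF ab(2)] zero_less_Suc)+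
  from computable_prod_decode(1)[OF this] show "computable A 1 (\<lambda>e. ?T (e 0))" .
  have look: "hist_nth (hist H a b n) n i = (if i < n then ?T i else 0)" for n i
    using hist_nth_hist[of i n H a b] by (simp add: hist_nth_def del: hist.simps)
  show "?T n = H n (if a n < n then ?T (a n) else 0) (if b n < n then ?T (b n) else 0)" for n
    unfolding look[symmetric] by simp
qed

lemma computable_enumerate:
  assumes "infinite R" and "decidable A 1 (\<lambda>e. e 0 \<in> R)"
  shows "computable A 1 (\<lambda>e. enumerate R (e 0))"
proof -
  have ex: "\<exists>s. s \<in> R \<and> y < s" for y using assms(1) by (meson infinite_nat_iff_unbounded)
  have eq: "enumerate R n = rec_nat (LEAST s. s \<in> R) (\<lambda>n y. LEAST s. s \<in> R \<and> y < s) n" for n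
    using assms(1) by (induction n) (simp_all add: enumerate_0 enumerate_Suc'')
  have "computable A (Suc (Suc 1)) (\<lambda>e. LEAST s. s \<in> R \<and> e 1 < s)"
    using ex computable_comp1[OF assms(2)[unfolded decidable_def]]
    by (intro computable_Least decidable_conj decidable_less) (auto simp: decidable_def intro: computable_var)
  then show ?thesis unfolding eq
    by (intro computable_rec[where s="\<lambda>n y e. LEAST s. s \<in> R \<and> y < s"] computable_const computable_var) auto
qed

section \<open>Definability\<close>

abbreviation Imp :: "('s, 'c) fm \<Rightarrow> ('s, 'c) fm \<Rightarrow> ('s, 'c) fm" where
  "Imp \<phi> \<psi> \<equiv> Neg (Conj \<phi> (Neg \<psi>))"

abbreviation ExSet :: "('s, 'c) fm \<Rightarrow> ('s, 'c) fm" where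
  "ExSet \<phi> \<equiv> Neg (AllSet (Neg \<phi>))"

lemma tval_cong: "tclosed k t \<Longrightarrow> (\<And>n. n < k \<Longrightarrow> e n = e' n) \<Longrightarrow> tval e t = tval e' t"
  by (cases t) auto

lemma sat_cong:
  "closed_fm k l \<phi> \<Longrightarrow> (\<And>n. n < k \<Longrightarrow> e n = e' n) \<Longrightarrow> (\<And>n. n < l \<Longrightarrow> E n = E' n) \<Longrightarrow>
    sat M e E \<phi> = sat M e' E' \<phi>"
proof (induction \<phi> arbitrary: k l e e' E E')
  case (AllSet \<phi>)
  have "sat M (case_nat x e) E \<phi> = sat M (case_nat x e') E' \<phi>" for x
    by (rule AllSet.IH[of "Suc k" l]) (use AllSet.prems in \<open>auto split: nat.split\<close>)
  then show ?case by simp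
next
  case (AllCls \<phi>)
  have "sat M e (case_nat X E) \<phi> = sat M e' (case_nat X E') \<phi>" for X
    by (rule AllCls.IH[of k "Suc l"]) (use AllCls.prems in \<open>auto split: nat.split\<close>)
  then show ?case by simp
next
  case (Conj \<phi> \<psi>)
  from Conj.IH(1)[of k l e e' E E'] Conj.IH(2)[of k l e e' E E'] Conj.prems show ?case by simp
next
  case (Neg \<phi>)
  from Neg.IH[of k l e e' E E'] Neg.prems show ?case by simp
qed (simp_all, (metis tval_cong)+)

fun tinst :: "nat \<Rightarrow> (nat \<Rightarrow> 'a) \<Rightarrow> 'a trm \<Rightarrow> 'a trm" where
  "tinst k e (Var n) = (if n < k then Var n else Par (e (n - k)))"
| "tinst k e (Par a) = Par a"

text \<open>Turns the free variables from \<open>k\<close> and \<open>l\<close> on into parameters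
  holding their values. Genericity speaks of formulas in a single free variable, whereas forcing
  statements come with whole environments of names.\<close>

primrec inst :: "nat \<Rightarrow> nat \<Rightarrow> (nat \<Rightarrow> 's) \<Rightarrow> (nat \<Rightarrow> 'c) \<Rightarrow> ('s, 'c) fm \<Rightarrow> ('s, 'c) fm" where
  "inst k l e E (SetEq s t) = SetEq (tinst k e s) (tinst k e t)"
| "inst k l e E (SetMem s t) = SetMem (tinst k e s) (tinst k e t)"
| "inst k l e E (ClsEq S T) = ClsEq (tinst l E S) (tinst l E T)"
| "inst k l e E (ClsMem s T) = ClsMem (tinst k e s) (tinst l E T)"
| "inst k l e E (Neg \<phi>) = Neg (inst k l e E \<phi>)"
| "inst k l e E (Conj \<phi> \<psi>) = Conj (inst k l e E \<phi>) (inst k l e E \<psi>)"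
| "inst k l e E (AllSet \<phi>) = AllSet (inst (Suc k) l e E \<phi>)"
| "inst k l e E (AllCls \<phi>) = AllCls (inst k (Suc l) e E \<phi>)"

lemma tclosed_tinst: "tclosed k (tinst k e t)"
  by (cases t) auto

lemma closed_inst: "closed_fm k l (inst k l e E \<phi>)"
  by (induction \<phi> arbitrary: k l) (auto simp: tclosed_tinst)

lemma tval_tinst: "tval e' (tinst k e t) = tval (\<lambda>n. if n < k then e' n else e (n - k)) t"
  by (cases t) auto

lemma case_nat_append:
  "case_nat x (\<lambda>n. if n < k then f n else g (n - k)) =
    (\<lambda>n. if n < Suc k then case_nat x f n else g (n - Suc k))"
  by (auto split: nat.split)

lemma sat_inst:
  "sat M e' E' (inst k l e E \<phi>) \<longleftrightarrow>
    sat M (\<lambda>n. if n < k then e' n else e (n - k)) (\<lambda>n. if n < l then E' n else E (n - l)) \<phi>"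
  by (induction \<phi> arbitrary: k l e' E') (simp_all add: tval_tinst case_nat_append)

text \<open>Parameters of \<open>Q\<close> occur as \<open>Par\<close> in the formula;
  \<open>k\<close> and \<open>l\<close> bound its free variables. With \<open>fo\<close> set the
  notion serves comprehension in \<open>M\<close>, otherwise the oracle and the genericity of the
  sequence.\<close>

definition definable ::
  "('s, 'c) struct \<Rightarrow> bool \<Rightarrow> nat \<Rightarrow> nat \<Rightarrow> ((nat \<Rightarrow> 's) \<Rightarrow> (nat \<Rightarrow> 'c) \<Rightarrow> bool) \<Rightarrow> bool" where
  "definable M fo k l Q \<longleftrightarrow>
     (\<exists>\<phi>. closed_fm k l \<phi> \<and> (fo \<longrightarrow> first_order \<phi>) \<and> (\<forall>e E. sat M e E \<phi> \<longleftrightarrow> Q e E))"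

lemma closed_fm_mono: "closed_fm k l \<phi> \<Longrightarrow> k \<le> k' \<Longrightarrow> l \<le> l' \<Longrightarrow> closed_fm k' l' \<phi>"
proof (induction \<phi> arbitrary: k l k' l')
  case (AllSet \<phi>)
  from AllSet.IH[of "Suc k" l "Suc k'" l'] AllSet.prems show ?case by simp
next
  case (AllCls \<phi>)
  from AllCls.IH[of k "Suc l" k' "Suc l'"] AllCls.prems show ?case by simp
next
  case (SetEq s t)
  then show ?case by (cases s; cases t) auto
next
  case (SetMem s t)
  then show ?case by (cases s; cases t) auto
next
  case (ClsEq s t)
  then show ?case by (cases s; cases t) auto
next
  case (ClsMem s t)
  then show ?case by (cases s; cases t) auto
next
  case (Conj \<phi> \<psi>)
  from Conj.IH(1)[of k l k' l'] Conj.IH(2)[of k l k' l'] Conj.prems show ?case by simp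
next
  case (Neg \<phi>)
  from Neg.IH[of k l k' l'] Neg.prems show ?case by simp
qed

definition definable_term :: "nat \<Rightarrow> ((nat \<Rightarrow> 'a) \<Rightarrow> 'a) \<Rightarrow> bool" where
  "definable_term k t \<longleftrightarrow> (\<exists>\<tau>. tclosed k \<tau> \<and> t = (\<lambda>e. tval e \<tau>))"

lemma definable_term_var: "i < k \<Longrightarrow> definable_term k (\<lambda>e. e i)"
  unfolding definable_term_def by (rule exI[of _ "Var i"]) simp

lemma definable_term_const: "definable_term k (\<lambda>e. a)"
  unfolding definable_term_def by (rule exI[of _ "Par a"]) simp

lemma definable_term_shift: "definable_term k t \<Longrightarrow> definable_term (Suc k) (\<lambda>e. t (\<lambda>i. e (Suc i)))"
  unfolding definable_term_def
proof (elim exE conjE)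
  fix \<tau> :: "'a trm" assume "tclosed k \<tau>" "t = (\<lambda>e. tval e \<tau>)"
  then show "\<exists>\<tau>. tclosed (Suc k) \<tau> \<and> (\<lambda>e. t (\<lambda>i. e (Suc i))) = (\<lambda>e. tval e \<tau>)"
    by (cases \<tau>) (auto intro: exI[of _ "Var (Suc n)" for n] exI[of _ "Par a" for a])
qed

lemma definable_smem:
  "definable_term k s \<Longrightarrow> definable_term k t \<Longrightarrow> definable M fo k l (\<lambda>e E. smem M (s e) (t e))"
proof -
  assume "definable_term k s" "definable_term k t"
  then obtain \<sigma> \<tau> where "tclosed k \<sigma>" "tclosed k \<tau>" "s = (\<lambda>e. tval e \<sigma>)" "t = (\<lambda>e. tval e \<tau>)"
    by (auto simp: definable_term_def)
  then show ?thesis unfolding definable_def by (intro exI[of _ "SetMem \<sigma> \<tau>"]) simp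
qed

lemma definable_seq:
  "definable_term k s \<Longrightarrow> definable_term k t \<Longrightarrow> definable M fo k l (\<lambda>e E. s e = t e)"
proof -
  assume "definable_term k s" "definable_term k t"
  then obtain \<sigma> \<tau> where "tclosed k \<sigma>" "tclosed k \<tau>" "s = (\<lambda>e. tval e \<sigma>)" "t = (\<lambda>e. tval e \<tau>)"
    by (auto simp: definable_term_def)
  then show ?thesis unfolding definable_def by (intro exI[of _ "SetEq \<sigma> \<tau>"]) simp
qed

lemma definable_cmem:
  "definable_term k s \<Longrightarrow> definable_term l t \<Longrightarrow> definable M fo k l (\<lambda>e E. cmem M (s e) (t E))"
proof -
  assume "definable_term k s" "definable_term l t"
  then obtain \<sigma> \<tau> where "tclosed k \<sigma>" "tclosed l \<tau>" "s = (\<lambda>e. tval e \<sigma>)" "t = (\<lambda>e. tval e \<tau>)"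
    by (auto simp: definable_term_def)
  then show ?thesis unfolding definable_def by (intro exI[of _ "ClsMem \<sigma> \<tau>"]) simp
qed

lemma definable_not: "definable M fo k l Q \<Longrightarrow> definable M fo k l (\<lambda>e E. \<not> Q e E)"
  unfolding definable_def by (elim exE conjE, rule_tac x="Neg \<phi>" for \<phi> in exI) auto

lemma definable_conj:
  "definable M fo k l Q \<Longrightarrow> definable M fo k l R \<Longrightarrow> definable M fo k l (\<lambda>e E. Q e E \<and> R e E)"
proof -
  assume "definable M fo k l Q" "definable M fo k l R"
  then obtain \<phi> \<psi> where "closed_fm k l \<phi>" "fo \<longrightarrow> first_order \<phi>" "\<forall>e E. sat M e E \<phi> \<longleftrightarrow> Q e E"
    "closed_fm k l \<psi>" "fo \<longrightarrow> first_order \<psi>" "\<forall>e E. sat M e E \<psi> \<longleftrightarrow> R e E"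
    unfolding definable_def by blast
  then show ?thesis unfolding definable_def by (intro exI[of _ "Conj \<phi> \<psi>"]) simp
qed

lemma definable_disj:
  assumes "definable M fo k l Q" "definable M fo k l R"
  shows "definable M fo k l (\<lambda>e E. Q e E \<or> R e E)"
  using definable_not[OF definable_conj[OF assms[THEN definable_not]]] by simp

lemma definable_imp:
  assumes "definable M fo k l Q" "definable M fo k l R"
  shows "definable M fo k l (\<lambda>e E. Q e E \<longrightarrow> R e E)"
  using definable_disj[OF definable_not[OF assms(1)] assms(2)] by simp

lemma definable_iff:
  assumes "definable M fo k l Q" "definable M fo k l R"
  shows "definable M fo k l (\<lambda>e E. Q e E \<longleftrightarrow> R e E)"
proof -
  have eq: "(Q e E \<longleftrightarrow> R e E) = ((Q e E \<longrightarrow> R e E) \<and> (R e E \<longrightarrow> Q e E))" for e E by blast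
  show ?thesis unfolding eq
    by (rule definable_conj[OF definable_imp[OF assms] definable_imp[OF assms(2,1)]])
qed

lemma definable_mono:
  "definable M fo k l Q \<Longrightarrow> k \<le> k' \<Longrightarrow> l \<le> l' \<Longrightarrow> definable M fo k' l' Q"
  unfolding definable_def by (meson closed_fm_mono)

locale omega_struct =
  fixes M :: "('s, 'c) struct"
  assumes Sets_UNIV: "Sets M = UNIV" and Classes_UNIV: "Classes M = UNIV"
begin

lemma definable_all:
  assumes "definable M fo (Suc k) l (\<lambda>e E. Q (e 0) (\<lambda>i. e (Suc i)) E)"
  shows "definable M fo k l (\<lambda>e E. \<forall>x. Q x e E)"
proof -
  obtain \<phi> where "closed_fm (Suc k) l \<phi>" "fo \<longrightarrow> first_order \<phi>"
    "\<And>e E. sat M e E \<phi> \<longleftrightarrow> Q (e 0) (\<lambda>i. e (Suc i)) E"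
    using assms by (auto simp: definable_def)
  then show ?thesis unfolding definable_def
    by (intro exI[of _ "AllSet \<phi>"]) (simp add: Sets_UNIV)
qed

lemma definable_ex:
  assumes "definable M fo (Suc k) l (\<lambda>e E. Q (e 0) (\<lambda>i. e (Suc i)) E)"
  shows "definable M fo k l (\<lambda>e E. \<exists>x. Q x e E)"
  using definable_not[OF definable_all[where Q="\<lambda>x e E. \<not> Q x e E", OF definable_not[OF assms]]] by simp

lemma definable_all_cls:
  assumes "definable M False k (Suc l) (\<lambda>e E. Q (E 0) e (\<lambda>i. E (Suc i)))"
  shows "definable M False k l (\<lambda>e E. \<forall>X. Q X e E)"
proof -
  obtain \<phi> where "closed_fm k (Suc l) \<phi>"
    "\<And>e E. sat M e E \<phi> \<longleftrightarrow> Q (E 0) e (\<lambda>i. E (Suc i))"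
    using assms by (auto simp: definable_def)
  then show ?thesis unfolding definable_def
    by (intro exI[of _ "AllCls \<phi>"]) (simp add: Classes_UNIV)
qed

lemma definable_ex_cls:
  assumes "definable M False k (Suc l) (\<lambda>e E. Q (E 0) e (\<lambda>i. E (Suc i)))"
  shows "definable M False k l (\<lambda>e E. \<exists>X. Q X e E)"
  using definable_not[OF definable_all_cls[where Q="\<lambda>X e E. \<not> Q X e E", OF definable_not[OF assms]]] by simp

lemma definable_ball_conds:
  assumes "definable M fo (Suc k) l (\<lambda>e E. Q (e 0) (\<lambda>i. e (Suc i)) E)"
  shows "definable M fo k l (\<lambda>e E. \<forall>x\<in>conds M P. Q x e E)"
proof -
  have eq: "(\<forall>x\<in>conds M P. Q x e E) \<longleftrightarrow> (\<forall>x. cmem M x P \<longrightarrow> Q x e E)" for e E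
    by (simp add: conds_def Sets_UNIV)
  show ?thesis unfolding eq
    by (rule definable_all, rule definable_imp, rule definable_cmem, rule definable_term_var, simp, rule definable_term_const, rule assms)
qed

lemma definable_bex_conds:
  assumes "definable M fo (Suc k) l (\<lambda>e E. Q (e 0) (\<lambda>i. e (Suc i)) E)"
  shows "definable M fo k l (\<lambda>e E. \<exists>x\<in>conds M P. Q x e E)"
  using definable_not[OF definable_ball_conds[where Q="\<lambda>x e E. \<not> Q x e E", OF definable_not[OF assms]]] by simp

lemma definable_is_upair:
  assumes "definable_term k a" "definable_term k b" "definable_term k c"
  shows "definable M fo k l (\<lambda>e E. is_upair M (a e) (b e) (c e))"
  unfolding is_upair_def Sets_UNIV ball_UNIV
  by (rule definable_all definable_iff definable_disj definable_smem definable_seq definable_term_var zero_less_Suc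
     assms[THEN definable_term_shift])+

lemma definable_is_pair:
  assumes "definable_term k a" "definable_term k b" "definable_term k c"
  shows "definable M fo k l (\<lambda>e E. is_pair M (a e) (b e) (c e))"
  unfolding is_pair_def Sets_UNIV bex_UNIV
  by (rule definable_ex definable_conj definable_is_upair definable_term_var assms[THEN definable_term_shift, THEN definable_term_shift]
     zero_less_Suc Suc_mono)+

lemma definable_crel2:
  assumes "definable_term l X" "definable_term k a" "definable_term k b"
  shows "definable M fo k l (\<lambda>e E. crel2 M (X E) (a e) (b e))"
  unfolding crel2_def Sets_UNIV bex_UNIV
  by (rule definable_ex definable_conj definable_is_pair definable_cmem definable_term_var assms(1) assms(2,3)[THEN definable_term_shift]
     zero_less_Suc)+

lemma definable_crel3:
  assumes "definable_term l X" "definable_term k a" "definable_term k b" "definable_term k c"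
  shows "definable M fo k l (\<lambda>e E. crel3 M (X E) (a e) (b e) (c e))"
  unfolding crel3_def Sets_UNIV bex_UNIV
  by (rule definable_ex definable_conj definable_is_pair definable_crel2 definable_term_var assms(1) assms(2-4)[THEN definable_term_shift]
     zero_less_Suc)+

lemmas definable_intros = definable_all definable_ex definable_all_cls definable_ex_cls definable_ball_conds definable_bex_conds
  definable_not definable_conj definable_disj definable_imp definable_iff
  definable_smem definable_cmem definable_seq definable_is_upair definable_is_pair
  definable_crel2 definable_crel3 definable_term_var definable_term_const


end

section \<open>Names in models of GB\<close>

locale gb_struct = omega_struct +
  assumes GB: "GB M"
begin

abbreviation mem :: "'a \<Rightarrow> 'a \<Rightarrow> bool" (infix "\<epsilon>" 50) where
  "x \<epsilon> y \<equiv> smem M x y"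

lemma extensionality:
  assumes "\<And>x. x \<epsilon> a \<longleftrightarrow> x \<epsilon> b" shows "a = b"
proof -
  have "set_axioms M" using GB by (simp add: GB_def)
  note ax = this[unfolded set_axioms_def, THEN conjunct1]
  have ab: "a \<in> Sets M" "b \<in> Sets M" by (simp_all only: Sets_UNIV UNIV_I)
  show ?thesis
    by (rule bspec[OF bspec[OF ax ab(1)] ab(2), THEN mp]) (intro ballI assms)
qed

lemma foundation: "x \<epsilon> a \<Longrightarrow> \<exists>x. x \<epsilon> a \<and> \<not> (\<exists>y. y \<epsilon> x \<and> y \<epsilon> a)"
proof -
  have "set_axioms M" using GB by (simp add: GB_def)
  note ax = this[unfolded set_axioms_def, THEN conjunct2, THEN conjunct1]
  have a: "a \<in> Sets M" "x \<in> Sets M" by (simp_all only: Sets_UNIV UNIV_I)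
  assume "x \<epsilon> a"
  with bspec[OF ax a(1)] a(2) show ?thesis unfolding Sets_UNIV by blast
qed

definition up :: "'a \<Rightarrow> 'a \<Rightarrow> 'a" where
  "up a b = (SOME c. is_upair M a b c)"

lemma mem_up [simp]: "x \<epsilon> up a b \<longleftrightarrow> x = a \<or> x = b"
proof -
  have "\<exists>c. is_upair M a b c"
    using GB by (auto simp: GB_def set_axioms_def Sets_UNIV)
  then have "is_upair M a b (up a b)" unfolding up_def by (rule someI_ex)
  then show ?thesis by (simp add: is_upair_def Sets_UNIV)
qed

lemma is_upair_iff: "is_upair M a b c \<longleftrightarrow> c = up a b"
  by (auto simp: is_upair_def Sets_UNIV intro: extensionality)

definition pr :: "'a \<Rightarrow> 'a \<Rightarrow> 'a" where
  "pr a b = up (up a a) (up a b)"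

lemma is_pair_iff: "is_pair M a b z \<longleftrightarrow> z = pr a b"
  by (simp add: is_pair_def is_upair_iff pr_def Sets_UNIV)

lemma pr_inject [simp]: "pr a b = pr c d \<longleftrightarrow> a = c \<and> b = d"
  unfolding pr_def by (metis mem_up)

lemma crel2_iff: "crel2 M X a b \<longleftrightarrow> cmem M (pr a b) X"
  by (simp add: crel2_def is_pair_iff Sets_UNIV)

definition big_union :: "'a \<Rightarrow> 'a" where
  "big_union a = (SOME u. \<forall>x. x \<epsilon> u \<longleftrightarrow> (\<exists>y. x \<epsilon> y \<and> y \<epsilon> a))"

lemma mem_big_union [simp]: "x \<epsilon> big_union a \<longleftrightarrow> (\<exists>y. x \<epsilon> y \<and> y \<epsilon> a)"
proof -
  have "\<exists>u. \<forall>x. x \<epsilon> u \<longleftrightarrow> (\<exists>y. x \<epsilon> y \<and> y \<epsilon> a)"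
    using GB by (auto simp: GB_def set_axioms_def Sets_UNIV)
  from someI_ex[OF this] show ?thesis by (simp add: big_union_def)
qed

lemma comprehension:
  assumes "definable M True 1 0 (\<lambda>e E. Q (e 0))"
  shows "\<exists>X. \<forall>x. cmem M x X \<longleftrightarrow> Q x"
proof -
  obtain \<phi> where \<phi>: "first_order \<phi>" "\<And>e E. sat M e E \<phi> \<longleftrightarrow> Q (e 0)"
    using assms by (auto simp: definable_def)
  have "\<phi> \<in> language M" by (simp add: language_def Sets_UNIV Classes_UNIV)
  with \<phi>(1) GB have "\<forall>e E. \<exists>X. \<forall>x. cmem M x X \<longleftrightarrow> sat M (case_nat x e) E \<phi>"
    by (auto simp: GB_def class_axioms_def Sets_UNIV Classes_UNIV)
  with \<phi>(2) show ?thesis by simp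
qed

lemma class_ext: "(\<And>x. cmem M x X \<longleftrightarrow> cmem M x Y) \<Longrightarrow> X = Y"
  using GB by (auto simp: GB_def class_axioms_def Sets_UNIV Classes_UNIV)

lemma replacement:
  assumes "\<And>x y z. crel2 M F x y \<Longrightarrow> crel2 M F x z \<Longrightarrow> y = z"
  shows "\<exists>b. \<forall>y. y \<epsilon> b \<longleftrightarrow> (\<exists>x. x \<epsilon> a \<and> crel2 M F x y)"
proof -
  have "\<forall>F\<in>Classes M.
        (\<forall>x\<in>Sets M. \<forall>y\<in>Sets M. \<forall>z\<in>Sets M. crel2 M F x y \<and> crel2 M F x z \<longrightarrow> y = z) \<longrightarrow>
        (\<forall>a\<in>Sets M. \<exists>b\<in>Sets M. \<forall>y\<in>Sets M.
           smem M y b \<longleftrightarrow> (\<exists>x\<in>Sets M. smem M x a \<and> crel2 M F x y))"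
    using GB unfolding GB_def class_axioms_def by blast
  with assms show ?thesis by (simp add: Sets_UNIV Classes_UNIV) blast
qed

text \<open>Replacement for a partial class function: the identity on the class of all
  \<open>x\<close> with \<open>Q x\<close>.\<close>

lemma separation:
  assumes "definable M True 1 0 (\<lambda>e E. Q (e 0))"
  shows "\<exists>b. \<forall>x. x \<epsilon> b \<longleftrightarrow> x \<epsilon> a \<and> Q x"
proof -
  obtain X where X: "\<And>x. cmem M x X \<longleftrightarrow> Q x" using comprehension[OF assms] by blast
  have "definable M True 1 0 (\<lambda>e E. \<exists>x. is_pair M x x (e 0) \<and> cmem M x X)"
    by (rule definable_intros | simp)+
  from comprehension[OF this] obtain F where F: "\<And>z. cmem M z F \<longleftrightarrow> (\<exists>x. z = pr x x \<and> Q x)"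
    by (auto simp: X is_pair_iff)
  have "\<exists>b. \<forall>y. y \<epsilon> b \<longleftrightarrow> (\<exists>x. x \<epsilon> a \<and> crel2 M F x y)"
    by (rule replacement) (auto simp: crel2_iff F)
  then show ?thesis by (simp add: crel2_iff F)
qed

lemma infinity:
  obtains o' w where "\<And>x. \<not> x \<epsilon> o'" "o' \<epsilon> w"
    "\<And>x. x \<epsilon> w \<Longrightarrow> \<exists>y. y \<epsilon> w \<and> (\<forall>u. u \<epsilon> y \<longleftrightarrow> u \<epsilon> x \<or> u = x)"
proof -
  have "\<exists>w\<in>Sets M.
        (\<exists>z\<in>Sets M. smem M z w \<and> (\<forall>x\<in>Sets M. \<not> smem M x z)) \<and>
        (\<forall>x\<in>Sets M. smem M x w \<longrightarrow>
           (\<exists>y\<in>Sets M. smem M y w \<and> (\<forall>u\<in>Sets M. smem M u y \<longleftrightarrow> smem M u x \<or> u = x)))"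
    using GB unfolding GB_def set_axioms_def by (elim conjE)
  then show ?thesis using that unfolding Sets_UNIV ball_UNIV bex_UNIV by blast
qed

definition succ :: "'a \<Rightarrow> 'a" where
  "succ x = big_union (up x (up x x))"

lemma mem_succ [simp]: "u \<epsilon> succ x \<longleftrightarrow> u \<epsilon> x \<or> u = x"
  unfolding succ_def by (simp add: ex_disj_distrib conj_disj_distribL)

text \<open>Otherwise \<open>x\<close> and \<open>y\<close> would be elements of each other, against
  foundation for the set \<open>{x, y}\<close>.\<close>

lemma succ_inject: "succ x = succ y \<Longrightarrow> x = y"
  using foundation[of x "up x y"] by (metis mem_up mem_succ)

text \<open>
  A set \<open>f\<close> with \<open>H f\<close> approximates the recursion \<open>0 \<mapsto> a\<close>, \<open>n + 1 \<mapsto> \<Union>(f n)\<close>. The class \<open>F\<close> collects the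
  pairs \<open>\<langle>n, u\<rangle>\<close> on which all approximations agree, so it is a function by definition, and no induction along
  the infinite set \<open>w\<close> is needed to see that the image of \<open>w\<close> is closed under unions.
\<close>

lemma ex_transitive: "\<exists>T. x \<epsilon> T \<and> (\<forall>y z. y \<epsilon> T \<longrightarrow> z \<epsilon> y \<longrightarrow> z \<epsilon> T)"
proof -
  define a where "a = up x x"
  obtain o' w where o': "\<And>x. \<not> x \<epsilon> o'" and w0: "o' \<epsilon> w"
    and w: "\<And>x. x \<epsilon> w \<Longrightarrow> \<exists>y. y \<epsilon> w \<and> (\<forall>u. u \<epsilon> y \<longleftrightarrow> u \<epsilon> x \<or> u = x)"
    by (rule infinity) blast
  have wS: "succ n \<epsilon> w" if n: "n \<epsilon> w" for n
  proof -
    obtain y where "y \<epsilon> w" "\<forall>u. u \<epsilon> y \<longleftrightarrow> u \<epsilon> n \<or> u = n" using w[OF n] by blast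
    moreover from this(2) have "y = succ n" by (intro extensionality) simp
    ultimately show ?thesis by simp
  qed
  define H where "H f \<longleftrightarrow> (\<forall>z. z \<epsilon> f \<longrightarrow> is_pair M o' a z \<or> (\<exists>m v s u q. is_pair M m v q \<and> q \<epsilon> f \<and>
      (\<forall>x. x \<epsilon> s \<longleftrightarrow> x \<epsilon> m \<or> x = m) \<and> (\<forall>x. x \<epsilon> u \<longleftrightarrow> (\<exists>y. x \<epsilon> y \<and> y \<epsilon> v)) \<and> is_pair M s u z))" for f
  have sc: "(\<forall>x. x \<epsilon> s \<longleftrightarrow> x \<epsilon> m \<or> x = m) \<longleftrightarrow> s = succ m" for s m
  proof
    assume "\<forall>x. x \<epsilon> s \<longleftrightarrow> x \<epsilon> m \<or> x = m"
    then show "s = succ m" by (intro extensionality) (simp only: mem_succ)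
  qed simp
  have bu: "(\<forall>x. x \<epsilon> u \<longleftrightarrow> (\<exists>y. x \<epsilon> y \<and> y \<epsilon> v)) \<longleftrightarrow> u = big_union v" for u v
  proof
    assume "\<forall>x. x \<epsilon> u \<longleftrightarrow> (\<exists>y. x \<epsilon> y \<and> y \<epsilon> v)"
    then show "u = big_union v" by (intro extensionality) (simp only: mem_big_union)
  qed simp
  have H: "H f \<longleftrightarrow> (\<forall>z. z \<epsilon> f \<longrightarrow> z = pr o' a \<or> (\<exists>m v. pr m v \<epsilon> f \<and> z = pr (succ m) (big_union v)))" for f
    by (simp only: H_def sc bu is_pair_iff) simp
  have "definable M True 1 0 (\<lambda>e E. \<exists>n u. is_pair M n u (e 0) \<and>
      (\<exists>f q. H f \<and> is_pair M n u q \<and> q \<epsilon> f) \<and> (\<forall>f u' q. H f \<and> is_pair M n u' q \<and> q \<epsilon> f \<longrightarrow> u' = u))"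
    unfolding H_def by (rule definable_intros | simp)+
  from comprehension[OF this] obtain F where "\<And>z. cmem M z F \<longleftrightarrow> (\<exists>n u. is_pair M n u z \<and>
      (\<exists>f q. H f \<and> is_pair M n u q \<and> q \<epsilon> f) \<and> (\<forall>f u' q. H f \<and> is_pair M n u' q \<and> q \<epsilon> f \<longrightarrow> u' = u))"
    by blast
  then have F: "crel2 M F n u \<longleftrightarrow> (\<exists>f. H f \<and> pr n u \<epsilon> f) \<and> (\<forall>f u'. H f \<and> pr n u' \<epsilon> f \<longrightarrow> u' = u)" for n u
    by (auto simp: crel2_iff is_pair_iff)
  have "\<exists>b. \<forall>y. y \<epsilon> b \<longleftrightarrow> (\<exists>x. x \<epsilon> w \<and> crel2 M F x y)"
    by (rule replacement) (auto simp: F)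
  then obtain b where b: "\<And>y. y \<epsilon> b \<longleftrightarrow> (\<exists>x. x \<epsilon> w \<and> crel2 M F x y)" by blast
  have succ_ne: "succ m \<noteq> o'" for m using o'[of m] by (metis mem_succ)
  have F0: "crel2 M F o' a" unfolding F
  proof
    show "\<exists>f. H f \<and> pr o' a \<epsilon> f" by (rule exI[of _ "up (pr o' a) (pr o' a)"]) (simp add: H)
    show "\<forall>f u'. H f \<and> pr o' u' \<epsilon> f \<longrightarrow> u' = a" unfolding H using succ_ne by fastforce
  qed
  have FS: "crel2 M F (succ n) (big_union u)" if Fn: "crel2 M F n u" for n u
    unfolding F
  proof
    obtain f where f: "H f" "pr n u \<epsilon> f" using Fn by (auto simp: F)
    let ?g = "big_union (up f (up (pr (succ n) (big_union u)) (pr (succ n) (big_union u))))"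
    have "z \<epsilon> ?g \<longleftrightarrow> z \<epsilon> f \<or> z = pr (succ n) (big_union u)" for z
      by (simp add: ex_disj_distrib conj_disj_distribL)
    with f have "H ?g \<and> pr (succ n) (big_union u) \<epsilon> ?g" unfolding H by blast
    then show "\<exists>f. H f \<and> pr (succ n) (big_union u) \<epsilon> f" ..
    show "\<forall>f u'. H f \<and> pr (succ n) u' \<epsilon> f \<longrightarrow> u' = big_union u"
    proof (intro allI impI, elim conjE)
      fix f u' assume g: "H f" "pr (succ n) u' \<epsilon> f"
      then obtain m v where "pr m v \<epsilon> f" "pr (succ n) u' = pr (succ m) (big_union v)"
        unfolding H using succ_ne by (metis pr_inject)
      with g(1) Fn show "u' = big_union u" unfolding F using succ_inject by (metis pr_inject)
    qed
  qed
  have "a \<epsilon> b" using b w0 F0 by blast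
  moreover have "big_union u \<epsilon> b" if "u \<epsilon> b" for u using that b wS FS by blast
  \<comment> \<open>The transitive set is the union of \<open>b\<close>: it contains
    \<open>x\<close> because \<open>a = {x}\<close> is in \<open>b\<close>, and if
    \<open>z \<epsilon> y \<epsilon> u\<close> with \<open>u\<close> in \<open>b\<close>, then
    \<open>z\<close> is in \<open>big_union u\<close>, which is again in \<open>b\<close>.\<close>
  ultimately show ?thesis unfolding a_def
    by (intro exI[of _ "big_union b"]) (metis mem_big_union mem_up)
qed

text \<open>Foundation applies to sets, so the counterexamples are first cut down to a transitive
  set containing \<open>x\<close>. The elements of a minimal one stay in that set, hence satisfy
  \<open>Q\<close>, and the step is contradicted.\<close>

lemma mem_induct:
  assumes "definable M True 1 0 (\<lambda>e E. Q (e 0))" and step: "\<And>x. (\<And>y. y \<epsilon> x \<Longrightarrow> Q y) \<Longrightarrow> Q x"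
  shows "Q x"
proof (rule ccontr)
  assume "\<not> Q x"
  obtain T where T: "x \<epsilon> T" "\<And>y z. y \<epsilon> T \<Longrightarrow> z \<epsilon> y \<Longrightarrow> z \<epsilon> T" using ex_transitive[of x] by blast
  obtain b where b: "\<And>y. y \<epsilon> b \<longleftrightarrow> y \<epsilon> T \<and> \<not> Q y"
    using separation[OF definable_not[OF assms(1)], of T] by blast
  have "x \<epsilon> b" using \<open>\<not> Q x\<close> T(1) b by blast
  from foundation[OF this] obtain y where "y \<epsilon> b" "\<And>z. z \<epsilon> y \<Longrightarrow> \<not> z \<epsilon> b" by blast
  with b T(2) step[of y] show False by blast
qed

text \<open>The name \<open>\<rho>\<close> of an entry lies three memberships deep: \<open>\<rho>
  \<epsilon> {\<rho>} \<epsilon> pr \<rho> p \<epsilon> \<sigma>\<close>. The predicate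
  \<open>?R\<close> of the underlying membership induction therefore carries \<open>Q \<rho>\<close>
  along for \<open>w = {\<rho>}\<close> and for \<open>w = pr \<rho> p\<close>.\<close>

lemma name_induct:
  assumes "definable M True 1 0 (\<lambda>e E. Q (e 0))" and step: "\<And>\<sigma>. (\<And>\<rho> p. pr \<rho> p \<epsilon> \<sigma> \<Longrightarrow> Q \<rho>) \<Longrightarrow> Q \<sigma>"
  shows "Q \<sigma>"
proof -
  obtain X where X: "\<And>x. cmem M x X \<longleftrightarrow> Q x" using comprehension[OF assms(1)] by blast
  let ?R = "\<lambda>w. cmem M w X \<and> (\<forall>\<rho> p. is_upair M \<rho> \<rho> w \<or> is_pair M \<rho> p w \<longrightarrow> cmem M \<rho> X)"
  have "?R \<sigma>"
  proof (rule mem_induct)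
    show "definable M True 1 0 (\<lambda>e E. ?R (e 0))" by (rule definable_intros | simp)+
    fix w assume IH: "\<And>y. y \<epsilon> w \<Longrightarrow> ?R y"
    have IH': "Q y" "y = up \<rho> \<rho> \<or> y = pr \<rho> p \<Longrightarrow> Q \<rho>" if "y \<epsilon> w" for y \<rho> p
      using IH[OF that] by (auto simp: X is_upair_iff is_pair_iff)
    have "Q w" by (rule step) (use IH' in blast)
    moreover have "Q \<rho>" if "w = up \<rho> \<rho>" for \<rho> using IH'(1)[of \<rho>] that by simp
    moreover have "Q \<rho>" if "w = pr \<rho> p" for \<rho> p
      using IH'(2)[of "up \<rho> \<rho>" \<rho>] that by (simp add: pr_def)
    ultimately show "?R w" by (auto simp: X is_upair_iff is_pair_iff)
  qed
  then show ?thesis using X by blast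
qed

section \<open>The class of set names\<close>

lemma solves_name_recursion_iff:
  "solves_name_recursion M P V \<longleftrightarrow>
    (\<forall>\<sigma>. cmem M \<sigma> V \<longleftrightarrow> (\<forall>z. z \<epsilon> \<sigma> \<longrightarrow> (\<exists>\<rho> p. cmem M p P \<and> z = pr \<rho> p \<and> cmem M \<rho> V)))"
  by (simp add: solves_name_recursion_def Sets_UNIV Classes_UNIV conds_def is_pair_iff) blast

lemma solves_name_recursion_unique:
  assumes "solves_name_recursion M P V" "solves_name_recursion M P W"
  shows "V = W"
proof (rule class_ext)
  fix \<sigma>
  show "cmem M \<sigma> V \<longleftrightarrow> cmem M \<sigma> W"
  proof (rule name_induct)
    show "definable M True 1 0 (\<lambda>e E. cmem M (e 0) V \<longleftrightarrow> cmem M (e 0) W)"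
      by (rule definable_intros | simp)+
    fix \<sigma> assume IH: "\<And>\<rho> p. pr \<rho> p \<epsilon> \<sigma> \<Longrightarrow> cmem M \<rho> V \<longleftrightarrow> cmem M \<rho> W"
    show "cmem M \<sigma> V \<longleftrightarrow> cmem M \<sigma> W"
      using assms[unfolded solves_name_recursion_iff, THEN spec, of \<sigma>] IH by blast
  qed
qed

text \<open>The recursion is solved without recursing: \<open>\<sigma>\<close> counts as a name if
  it lies in a set \<open>t\<close> all of whose elements consist of pairs of an element of
  \<open>t\<close> and a condition. For the harder direction such a \<open>t\<close> is cut out of a
  transitive set containing \<open>\<sigma>\<close>: its elements in \<open>V\<close>, together with
  \<open>\<sigma>\<close>.\<close>

lemma ex_solves_name_recursion: "\<exists>V. solves_name_recursion M P V"
proof -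
  let ?closed = "\<lambda>t. \<forall>\<tau>. \<tau> \<epsilon> t \<longrightarrow> (\<forall>z. z \<epsilon> \<tau> \<longrightarrow> (\<exists>\<rho> p. \<rho> \<epsilon> t \<and> cmem M p P \<and> is_pair M \<rho> p z))"
  have "definable M True 1 0 (\<lambda>e E. \<exists>t. e 0 \<epsilon> t \<and> ?closed t)"
    by (rule definable_intros | simp)+
  from comprehension[OF this] obtain V where V: "\<And>\<sigma>. cmem M \<sigma> V \<longleftrightarrow> (\<exists>t. \<sigma> \<epsilon> t \<and> ?closed t)" by blast
  have "solves_name_recursion M P V" unfolding solves_name_recursion_iff
  proof (intro allI iffI)
    fix \<sigma> assume R: "\<forall>z. z \<epsilon> \<sigma> \<longrightarrow> (\<exists>\<rho> p. cmem M p P \<and> z = pr \<rho> p \<and> cmem M \<rho> V)"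
    obtain T where T: "\<sigma> \<epsilon> T" "\<And>y z. y \<epsilon> T \<Longrightarrow> z \<epsilon> y \<Longrightarrow> z \<epsilon> T" using ex_transitive[of \<sigma>] by blast
    have "definable M True 1 0 (\<lambda>e E. cmem M (e 0) V \<or> e 0 = \<sigma>)" by (rule definable_intros | simp)+
    from separation[OF this, of T] obtain t where t: "\<And>x. x \<epsilon> t \<longleftrightarrow> x \<epsilon> T \<and> (cmem M x V \<or> x = \<sigma>)" by blast
    have fst_T: "\<rho> \<epsilon> T" if "\<tau> \<epsilon> T" "pr \<rho> p \<epsilon> \<tau>" for \<rho> p \<tau>
      using T(2)[of "up \<rho> \<rho>" \<rho>] T(2)[of "pr \<rho> p" "up \<rho> \<rho>"] T(2)[OF that] by (simp add: pr_def)
    have "\<exists>\<rho> p. \<rho> \<epsilon> t \<and> cmem M p P \<and> z = pr \<rho> p" if \<tau>: "\<tau> \<epsilon> t" and z: "z \<epsilon> \<tau>" for \<tau> z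
    proof -
      have "\<exists>\<rho> p. cmem M p P \<and> z = pr \<rho> p \<and> cmem M \<rho> V"
      proof (cases "\<tau> = \<sigma>")
        case True
        with R z show ?thesis by blast
      next
        case False
        with \<tau> t have "cmem M \<tau> V" by blast
        then obtain s where "\<tau> \<epsilon> s" "?closed s" using V by blast
        with z V show ?thesis unfolding is_pair_iff by blast
      qed
      with t fst_T \<tau> z show ?thesis by blast
    qed
    with t T(1) have "\<sigma> \<epsilon> t \<and> ?closed t" unfolding is_pair_iff by blast
    with V show "cmem M \<sigma> V" by blast
  qed (use V is_pair_iff in blast)
  then show ?thesis by blast
qed

text \<open>Lets a definable formula bound its quantifiers over names by a class parameter.\<close>

lemma ex_class_set_names: "\<exists>V. \<forall>\<sigma>. \<sigma> \<in> set_names M P \<longleftrightarrow> cmem M \<sigma> V"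
  using ex_solves_name_recursion[of P] solves_name_recursion_unique
  by (auto simp: set_names_def Sets_UNIV)

lemma set_names_iff:
  "\<sigma> \<in> set_names M P \<longleftrightarrow> (\<forall>z. z \<epsilon> \<sigma> \<longrightarrow> (\<exists>\<rho> p. z = pr \<rho> p \<and> \<rho> \<in> set_names M P \<and> cmem M p P))"
proof -
  obtain V where V: "solves_name_recursion M P V" using ex_solves_name_recursion by blast
  then have "set_names M P = {\<sigma>. cmem M \<sigma> V}"
    using solves_name_recursion_unique by (auto simp: set_names_def Sets_UNIV)
  with V[unfolded solves_name_recursion_iff, THEN spec, of \<sigma>] show ?thesis by simp blast
qed

end

section \<open>The forcing relation\<close>

locale class_forcing = gb_struct +
  fixes P L FE FI
  assumes forcing: "forcing_notion M P L" and atomic: "atomic_forcing_relation M P L FE FI"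
begin

abbreviation below :: "'a \<Rightarrow> 'a \<Rightarrow> bool" (infix "\<preceq>" 50) where
  "p \<preceq> q \<equiv> crel2 M L p q"

abbreviation "Cond \<equiv> conds M P"
abbreviation "Names \<equiv> set_names M P"
abbreviation "CNames \<equiv> class_names M P"
abbreviation "entries \<equiv> set_entries M P"
abbreviation "centries \<equiv> class_entries M P"

text \<open>Set names and class names enter atomic forcing only through their entries. Working with
  arbitrary sets of entries treats both kinds at once, with forced equality of set names as the only
  primitive relation.\<close>

abbreviation forces_entry :: "'a \<Rightarrow> 'a \<Rightarrow> ('a \<times> 'a) set \<Rightarrow> bool" where
  "forces_entry p \<sigma> A \<equiv> mem_clause M P L (crel3 M FE) p \<sigma> A"

abbreviation forces_sub :: "'a \<Rightarrow> ('a \<times> 'a) set \<Rightarrow> ('a \<times> 'a) set \<Rightarrow> bool" where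
  "forces_sub p A B \<equiv> subset_clause M P L p A (\<lambda>q \<rho>. forces_entry q \<rho> B)"

lemma Cond_iff: "p \<in> Cond \<longleftrightarrow> cmem M p P"
  by (simp add: conds_def Sets_UNIV)

lemma below_refl: "p \<in> Cond \<Longrightarrow> p \<preceq> p"
  using forcing unfolding forcing_notion_def by blast

lemma below_trans: "p \<preceq> q \<Longrightarrow> q \<preceq> r \<Longrightarrow> p \<in> Cond \<Longrightarrow> q \<in> Cond \<Longrightarrow> r \<in> Cond \<Longrightarrow> p \<preceq> r"
  using forcing unfolding forcing_notion_def by blast

lemma ex_top: "\<exists>one\<in>Cond. \<forall>p\<in>Cond. p \<preceq> one"
  using forcing unfolding forcing_notion_def by blast

lemma entries_iff: "(\<rho>, r) \<in> entries \<sigma> \<longleftrightarrow> \<rho> \<in> Names \<and> r \<in> Cond \<and> pr \<rho> r \<epsilon> \<sigma>"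
  by (simp add: set_entries_def Sets_UNIV is_pair_iff)

lemma centries_iff: "(\<rho>, r) \<in> centries \<Gamma> \<longleftrightarrow> \<rho> \<in> Names \<and> r \<in> Cond \<and> cmem M (pr \<rho> r) \<Gamma>"
  by (simp add: class_entries_def crel2_iff)

lemma entries_subset: "entries \<sigma> \<subseteq> Names \<times> Cond" "centries \<Gamma> \<subseteq> Names \<times> Cond"
  by (auto simp: entries_iff centries_iff)

lemma forces_mem_iff:
  "p \<in> Cond \<Longrightarrow> \<sigma> \<in> Names \<Longrightarrow> \<tau> \<in> Names \<Longrightarrow> crel3 M FI p \<sigma> \<tau> \<longleftrightarrow> forces_entry p \<sigma> (entries \<tau>)"
  using atomic unfolding atomic_forcing_relation_def by blast

lemma forces_eq_iff:
  assumes "p \<in> Cond" "\<sigma> \<in> Names" "\<tau> \<in> Names"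
  shows "crel3 M FE p \<sigma> \<tau> \<longleftrightarrow> forces_sub p (entries \<sigma>) (entries \<tau>) \<and> forces_sub p (entries \<tau>) (entries \<sigma>)"
proof -
  have "subset_clause M P L p (entries \<sigma>) (\<lambda>q \<rho>. crel3 M FI q \<rho> \<tau>) \<longleftrightarrow> forces_sub p (entries \<sigma>) (entries \<tau>)"
    if "\<tau> \<in> Names" for \<sigma> \<tau>
    unfolding subset_clause_def using that by (auto simp: entries_iff forces_mem_iff)
  with assms atomic show ?thesis unfolding atomic_forcing_relation_def by blast
qed

lemma forces_class_mem_iff: "forces_class_mem M P L FE p \<sigma> \<Gamma> \<longleftrightarrow> forces_entry p \<sigma> (centries \<Gamma>)"
  by (simp add: forces_class_mem_def)

lemma forces_class_eq_iff:
  "forces_class_eq M P L FE p \<Gamma> \<Delta> \<longleftrightarrow>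
    forces_sub p (centries \<Gamma>) (centries \<Delta>) \<and> forces_sub p (centries \<Delta>) (centries \<Gamma>)"
  by (simp add: forces_class_eq_def forces_class_mem_iff)

lemma forces_entryI:
  assumes "\<And>p'. p' \<in> Cond \<Longrightarrow> p' \<preceq> p \<Longrightarrow>
    \<exists>q\<in>Cond. q \<preceq> p' \<and> (\<exists>\<rho> r. (\<rho>, r) \<in> A \<and> q \<preceq> r \<and> crel3 M FE q \<sigma> \<rho>)"
  shows "forces_entry p \<sigma> A"
  unfolding mem_clause_def using assms by fast

lemma forces_entryE:
  assumes "forces_entry p \<sigma> A" "p' \<in> Cond" "p' \<preceq> p"
  obtains q \<rho> r where "q \<in> Cond" "q \<preceq> p'" "(\<rho>, r) \<in> A" "q \<preceq> r" "crel3 M FE q \<sigma> \<rho>"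
  using assms unfolding mem_clause_def by fast

lemma forces_subI:
  "(\<And>\<rho> r q. (\<rho>, r) \<in> A \<Longrightarrow> q \<in> Cond \<Longrightarrow> q \<preceq> p \<Longrightarrow> q \<preceq> r \<Longrightarrow> forces_entry q \<rho> B) \<Longrightarrow> forces_sub p A B"
  unfolding subset_clause_def by fast

lemma forces_subD:
  "forces_sub p A B \<Longrightarrow> (\<rho>, r) \<in> A \<Longrightarrow> q \<in> Cond \<Longrightarrow> q \<preceq> p \<Longrightarrow> q \<preceq> r \<Longrightarrow> forces_entry q \<rho> B"
  unfolding subset_clause_def by fast

lemma forces_entry_mono:
  "forces_entry p \<sigma> A \<Longrightarrow> q \<preceq> p \<Longrightarrow> q \<in> Cond \<Longrightarrow> p \<in> Cond \<Longrightarrow> forces_entry q \<sigma> A"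
  unfolding mem_clause_def using below_trans by blast

lemma forces_sub_mono:
  "forces_sub p A B \<Longrightarrow> q \<preceq> p \<Longrightarrow> q \<in> Cond \<Longrightarrow> p \<in> Cond \<Longrightarrow> forces_sub q A B"
  by (rule forces_subI) (metis forces_subD below_trans)

lemma forces_entry_dense:
  assumes "p \<in> Cond" and dense: "\<And>p'. p' \<in> Cond \<Longrightarrow> p' \<preceq> p \<Longrightarrow> \<exists>q\<in>Cond. q \<preceq> p' \<and> forces_entry q \<sigma> A"
  shows "forces_entry p \<sigma> A"
proof (rule forces_entryI)
  fix p' assume p': "p' \<in> Cond" "p' \<preceq> p"
  then obtain q where q: "q \<in> Cond" "q \<preceq> p'" "forces_entry q \<sigma> A" using dense by blast
  obtain q' \<rho> r where q': "q' \<in> Cond" "q' \<preceq> q" "(\<rho>, r) \<in> A" "q' \<preceq> r" "crel3 M FE q' \<sigma> \<rho>"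
    by (rule forces_entryE[OF q(3,1) below_refl[OF q(1)]])
  moreover have "q' \<preceq> p'" using below_trans[OF q'(2) q(2)] q' q p' by blast
  ultimately show "\<exists>q\<in>Cond. q \<preceq> p' \<and> (\<exists>\<rho> r. (\<rho>, r) \<in> A \<and> q \<preceq> r \<and> crel3 M FE q \<sigma> \<rho>)" by blast
qed

lemma forces_sub_dense:
  assumes p: "p \<in> Cond" and A: "A \<subseteq> Names \<times> Cond"
    and dense: "\<And>p'. p' \<in> Cond \<Longrightarrow> p' \<preceq> p \<Longrightarrow> \<exists>q\<in>Cond. q \<preceq> p' \<and> forces_sub q A B"
  shows "forces_sub p A B"
proof (rule forces_subI)
  fix \<rho> r q assume a: "(\<rho>, r) \<in> A" "q \<in> Cond" "q \<preceq> p" "q \<preceq> r"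
  then have r: "r \<in> Cond" using A by blast
  show "forces_entry q \<rho> B"
  proof (rule forces_entry_dense[OF a(2)])
    fix q' assume q': "q' \<in> Cond" "q' \<preceq> q"
    then have "q' \<preceq> p" using below_trans[OF _ a(3)] a p by blast
    then obtain s where s: "s \<in> Cond" "s \<preceq> q'" "forces_sub s A B" using dense[OF q'(1)] by blast
    have "q' \<preceq> r" using below_trans[OF q'(2) a(4)] q' a r by blast
    then have "s \<preceq> r" using below_trans[OF s(2)] s q' r by blast
    then have "forces_entry s \<rho> B" using forces_subD[OF s(3) a(1) s(1) below_refl[OF s(1)]] by blast
    with s show "\<exists>q\<in>Cond. q \<preceq> q' \<and> forces_entry q \<rho> B" by blast
  qed
qed

lemma forces_eq_mono:
  "crel3 M FE p \<sigma> \<tau> \<Longrightarrow> q \<preceq> p \<Longrightarrow> q \<in> Cond \<Longrightarrow> p \<in> Cond \<Longrightarrow> \<sigma> \<in> Names \<Longrightarrow> \<tau> \<in> Names \<Longrightarrow> crel3 M FE q \<sigma> \<tau>"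
  unfolding forces_eq_iff using forces_sub_mono by blast

lemma forces_eq_sym:
  "crel3 M FE p \<sigma> \<tau> \<Longrightarrow> p \<in> Cond \<Longrightarrow> \<sigma> \<in> Names \<Longrightarrow> \<tau> \<in> Names \<Longrightarrow> crel3 M FE p \<tau> \<sigma>"
  unfolding forces_eq_iff by blast

lemma forces_eq_refl:
  assumes "p \<in> Cond" "\<sigma> \<in> Names" shows "crel3 M FE p \<sigma> \<sigma>"
proof -
  obtain V where V: "\<And>\<sigma>. \<sigma> \<in> Names \<longleftrightarrow> cmem M \<sigma> V" using ex_class_set_names[of P] by blast
  have "cmem M \<sigma> V \<longrightarrow> (\<forall>p\<in>Cond. crel3 M FE p \<sigma> \<sigma>)"
  proof (rule name_induct)
    show "definable M True 1 0 (\<lambda>e E. cmem M (e 0) V \<longrightarrow> (\<forall>p\<in>Cond. crel3 M FE p (e 0) (e 0)))"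
      by (rule definable_intros | simp)+
    fix \<sigma> assume IH: "\<And>\<rho> p. pr \<rho> p \<epsilon> \<sigma> \<Longrightarrow> cmem M \<rho> V \<longrightarrow> (\<forall>p\<in>Cond. crel3 M FE p \<rho> \<rho>)"
    have "forces_sub p (entries \<sigma>) (entries \<sigma>)" if p: "p \<in> Cond" for p
    proof (intro forces_subI forces_entryI)
      fix \<rho> r q p' assume a: "(\<rho>, r) \<in> entries \<sigma>" "q \<in> Cond" "q \<preceq> p" "q \<preceq> r" "p' \<in> Cond" "p' \<preceq> q"
      then have "p' \<preceq> r" using below_trans[OF a(6,4)] by (auto simp: entries_iff)
      moreover have "crel3 M FE p' \<rho> \<rho>" using IH a by (auto simp: entries_iff V)
      ultimately show "\<exists>q\<in>Cond. q \<preceq> p' \<and> (\<exists>\<rho>' r. (\<rho>', r) \<in> entries \<sigma> \<and> q \<preceq> r \<and> crel3 M FE q \<rho> \<rho>')"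
        using a below_refl by blast
    qed
    then show "cmem M \<sigma> V \<longrightarrow> (\<forall>p\<in>Cond. crel3 M FE p \<sigma> \<sigma>)"
      by (simp add: forces_eq_iff V)
  qed
  with assms V show ?thesis by blast
qed

text \<open>Induction on the first name, for all conditions and all choices of the other two names.
  Either inclusion follows an entry through \<open>\<tau>\<close> to the remaining name, passing
  twice to a stronger condition; the induction hypothesis closes the chain.\<close>

lemma forces_eq_trans:
  assumes "crel3 M FE p \<sigma> \<tau>" "crel3 M FE p \<tau> \<pi>" "p \<in> Cond" "\<sigma> \<in> Names" "\<tau> \<in> Names" "\<pi> \<in> Names"
  shows "crel3 M FE p \<sigma> \<pi>"
proof -
  obtain V where V: "\<And>\<sigma>. \<sigma> \<in> Names \<longleftrightarrow> cmem M \<sigma> V" using ex_class_set_names[of P] by blast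
  let ?Q = "\<lambda>\<sigma>. cmem M \<sigma> V \<longrightarrow> (\<forall>\<tau> \<pi>. cmem M \<tau> V \<and> cmem M \<pi> V \<longrightarrow>
    (\<forall>p\<in>Cond. crel3 M FE p \<sigma> \<tau> \<and> crel3 M FE p \<tau> \<pi> \<longrightarrow> crel3 M FE p \<sigma> \<pi>))"
  have "?Q \<sigma>"
  proof (rule name_induct)
    show "definable M True 1 0 (\<lambda>e E. ?Q (e 0))"
      by (rule definable_intros | simp)+
    fix \<sigma> assume "\<And>\<rho> p. pr \<rho> p \<epsilon> \<sigma> \<Longrightarrow> ?Q \<rho>"
    then have IH: "crel3 M FE q \<rho> \<pi>" if "(\<rho>, r) \<in> entries \<sigma>" "crel3 M FE q \<rho> \<tau>" "crel3 M FE q \<tau> \<pi>"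
        "q \<in> Cond" "\<tau> \<in> Names" "\<pi> \<in> Names" for q \<rho> r \<tau> \<pi>
      using that by (simp add: entries_iff V) blast
    {
      fix \<tau> \<pi> p assume n: "\<sigma> \<in> Names" "\<tau> \<in> Names" "\<pi> \<in> Names" "p \<in> Cond"
        and eq: "crel3 M FE p \<sigma> \<tau>" "crel3 M FE p \<tau> \<pi>"
      have sub: "forces_sub p (entries \<sigma>) (entries \<tau>)" "forces_sub p (entries \<tau>) (entries \<sigma>)"
        "forces_sub p (entries \<tau>) (entries \<pi>)" "forces_sub p (entries \<pi>) (entries \<tau>)"
        using eq n by (simp_all add: forces_eq_iff)
      have "forces_sub p (entries \<sigma>) (entries \<pi>)"
      proof (intro forces_subI forces_entryI)
        fix \<rho> r q p' assume a: "(\<rho>, r) \<in> entries \<sigma>" "q \<in> Cond" "q \<preceq> p" "q \<preceq> r" "p' \<in> Cond" "p' \<preceq> q"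
        obtain q1 \<rho>1 r1 where 1: "q1 \<in> Cond" "q1 \<preceq> p'" "(\<rho>1, r1) \<in> entries \<tau>" "q1 \<preceq> r1" "crel3 M FE q1 \<rho> \<rho>1"
          using forces_entryE[OF forces_subD[OF sub(1) a(1-4)] a(5,6)] by blast
        have "q1 \<preceq> q" using below_trans[OF 1(2) a(6)] 1 a by blast
        then have "q1 \<preceq> p" using below_trans[OF _ a(3)] 1 a n by blast
        from forces_entryE[OF forces_subD[OF sub(3) 1(3,1) this 1(4)] 1(1) below_refl[OF 1(1)]]
        obtain q2 \<rho>2 r2 where 2: "q2 \<in> Cond" "q2 \<preceq> q1" "(\<rho>2, r2) \<in> entries \<pi>" "q2 \<preceq> r2" "crel3 M FE q2 \<rho>1 \<rho>2"
          by blast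
        have "crel3 M FE q2 \<rho> \<rho>1" using forces_eq_mono[OF 1(5) 2(2)] 1 2 a by (simp add: entries_iff)
        then have "crel3 M FE q2 \<rho> \<rho>2" using IH[OF a(1) _ 2(5)] 1 2 by (simp add: entries_iff)
        moreover have "q2 \<preceq> p'" using below_trans[OF 2(2) 1(2)] 1 2 a by blast
        ultimately show "\<exists>q\<in>Cond. q \<preceq> p' \<and> (\<exists>\<rho>' r. (\<rho>', r) \<in> entries \<pi> \<and> q \<preceq> r \<and> crel3 M FE q \<rho> \<rho>')"
          using 2 by blast
      qed
      moreover have "forces_sub p (entries \<pi>) (entries \<sigma>)"
      proof (intro forces_subI forces_entryI)
        fix \<rho> r q p' assume a: "(\<rho>, r) \<in> entries \<pi>" "q \<in> Cond" "q \<preceq> p" "q \<preceq> r" "p' \<in> Cond" "p' \<preceq> q"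
        obtain q1 \<rho>1 r1 where 1: "q1 \<in> Cond" "q1 \<preceq> p'" "(\<rho>1, r1) \<in> entries \<tau>" "q1 \<preceq> r1" "crel3 M FE q1 \<rho> \<rho>1"
          using forces_entryE[OF forces_subD[OF sub(4) a(1-4)] a(5,6)] by blast
        have "q1 \<preceq> q" using below_trans[OF 1(2) a(6)] 1 a by blast
        then have "q1 \<preceq> p" using below_trans[OF _ a(3)] 1 a n by blast
        from forces_entryE[OF forces_subD[OF sub(2) 1(3,1) this 1(4)] 1(1) below_refl[OF 1(1)]]
        obtain q2 \<rho>2 r2 where 2: "q2 \<in> Cond" "q2 \<preceq> q1" "(\<rho>2, r2) \<in> entries \<sigma>" "q2 \<preceq> r2" "crel3 M FE q2 \<rho>1 \<rho>2"
          by blast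
        have "crel3 M FE q2 \<rho> \<rho>1" using forces_eq_mono[OF 1(5) 2(2)] 1 2 a by (simp add: entries_iff)
        \<comment> \<open>This chain runs from \<open>\<pi>\<close> to \<open>\<sigma>\<close>, but
          the hypothesis is about names occurring in \<open>\<sigma>\<close>. So both equalities are
          reversed, and the result is reversed back.\<close>
        then have "crel3 M FE q2 \<rho>2 \<rho>" using IH[OF 2(3), of q2 \<rho>1 \<rho>] forces_eq_sym 1 2 a by (simp add: entries_iff)
        then have "crel3 M FE q2 \<rho> \<rho>2" using forces_eq_sym 2 a by (simp add: entries_iff)
        moreover have "q2 \<preceq> p'" using below_trans[OF 2(2) 1(2)] 1 2 a by blast
        ultimately show "\<exists>q\<in>Cond. q \<preceq> p' \<and> (\<exists>\<rho>' r. (\<rho>', r) \<in> entries \<sigma> \<and> q \<preceq> r \<and> crel3 M FE q \<rho> \<rho>')"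
          using 2 by blast
      qed
      ultimately have "crel3 M FE p \<sigma> \<pi>" using n by (simp add: forces_eq_iff)
    }
    then show "?Q \<sigma>" unfolding V[symmetric] by blast
  qed
  with assms V show ?thesis by blast
qed

lemma forces_entry_cong:
  assumes "forces_entry p \<sigma> A" "crel3 M FE p \<sigma> \<sigma>'" "p \<in> Cond" "\<sigma> \<in> Names" "\<sigma>' \<in> Names" "A \<subseteq> Names \<times> Cond"
  shows "forces_entry p \<sigma>' A"
proof (rule forces_entryI)
  fix p' assume p': "p' \<in> Cond" "p' \<preceq> p"
  obtain q \<rho> r where q: "q \<in> Cond" "q \<preceq> p'" "(\<rho>, r) \<in> A" "q \<preceq> r" "crel3 M FE q \<sigma> \<rho>"
    using forces_entryE[OF assms(1) p'] by blast
  have "q \<preceq> p" using below_trans[OF q(2) p'(2)] q p' assms by blast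
  then have "crel3 M FE q \<sigma>' \<sigma>" using forces_eq_mono[OF assms(2)] forces_eq_sym q assms by blast
  then have "crel3 M FE q \<sigma>' \<rho>" using forces_eq_trans[OF _ q(5)] q assms by blast
  with q show "\<exists>q\<in>Cond. q \<preceq> p' \<and> (\<exists>\<rho> r. (\<rho>, r) \<in> A \<and> q \<preceq> r \<and> crel3 M FE q \<sigma>' \<rho>)" by blast
qed

lemma forces_entry_sub:
  assumes "forces_entry p \<sigma> A" "forces_sub p A B" "p \<in> Cond" "\<sigma> \<in> Names"
    "A \<subseteq> Names \<times> Cond" "B \<subseteq> Names \<times> Cond"
  shows "forces_entry p \<sigma> B"
proof (rule forces_entry_dense[OF assms(3)])
  fix p' assume p': "p' \<in> Cond" "p' \<preceq> p"
  obtain q \<rho> r where q: "q \<in> Cond" "q \<preceq> p'" "(\<rho>, r) \<in> A" "q \<preceq> r" "crel3 M FE q \<sigma> \<rho>"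
    using forces_entryE[OF assms(1) p'] by blast
  have "q \<preceq> p" using below_trans[OF q(2) p'(2)] q p' assms by blast
  then have "forces_entry q \<rho> B" using forces_subD[OF assms(2) q(3,1) _ q(4)] by blast
  then have "forces_entry q \<sigma> B" using forces_entry_cong[OF _ forces_eq_sym[OF q(5)]] q assms by blast
  with q show "\<exists>q\<in>Cond. q \<preceq> p' \<and> forces_entry q \<sigma> B" by blast
qed

lemma forces_sub_refl: "p \<in> Cond \<Longrightarrow> A \<subseteq> Names \<times> Cond \<Longrightarrow> forces_sub p A A"
proof (intro forces_subI forces_entryI)
  fix \<rho> r q p' assume A: "A \<subseteq> Names \<times> Cond"
    and a: "(\<rho>, r) \<in> A" "q \<in> Cond" "q \<preceq> p" "q \<preceq> r" "p' \<in> Cond" "p' \<preceq> q"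
  then have "p' \<preceq> r" using below_trans[OF a(6,4)] by auto
  moreover have "crel3 M FE p' \<rho> \<rho>" using forces_eq_refl A a by blast
  ultimately show "\<exists>q\<in>Cond. q \<preceq> p' \<and> (\<exists>\<rho>' r. (\<rho>', r) \<in> A \<and> q \<preceq> r \<and> crel3 M FE q \<rho> \<rho>')"
    using a below_refl by blast
qed

lemma forces_sub_trans:
  assumes "forces_sub p A B" "forces_sub p B D" "p \<in> Cond"
    "A \<subseteq> Names \<times> Cond" "B \<subseteq> Names \<times> Cond" "D \<subseteq> Names \<times> Cond"
  shows "forces_sub p A D"
proof (rule forces_subI)
  fix \<rho> r q assume a: "(\<rho>, r) \<in> A" "q \<in> Cond" "q \<preceq> p" "q \<preceq> r"
  have "forces_entry q \<rho> B" using forces_subD[OF assms(1) a] .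
  moreover have "forces_sub q B D" using forces_sub_mono[OF assms(2)] a assms by blast
  ultimately show "forces_entry q \<rho> D" using forces_entry_sub[of q \<rho> B D] a assms by blast
qed

section \<open>Forcing of arbitrary formulas\<close>

lemma range_case_nat: "range (case_nat x e) \<subseteq> S \<longleftrightarrow> x \<in> S \<and> range e \<subseteq> S"
  by (fastforce split: nat.splits)

text \<open>The formulas belong to the language of a presentation of \<open>M[G]\<close>, whose
  parameters \<open>rs\<close> and \<open>rc\<close> translate into names. Conjunction and
  quantifiers need no clause of the form "densely below \<open>p\<close>": closure under density is
  inherited from the atomic clauses, see \<open>forces_dense\<close>.\<close>

primrec forces ::
  "('x \<Rightarrow> 'a) \<Rightarrow> ('y \<Rightarrow> 'b) \<Rightarrow> 'a \<Rightarrow> (nat \<Rightarrow> 'a) \<Rightarrow> (nat \<Rightarrow> 'b) \<Rightarrow> ('x, 'y) fm \<Rightarrow> bool" where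
  "forces rs rc p e E (SetEq s t) \<longleftrightarrow> crel3 M FE p (tval e (map_trm rs s)) (tval e (map_trm rs t))"
| "forces rs rc p e E (SetMem s t) \<longleftrightarrow> crel3 M FI p (tval e (map_trm rs s)) (tval e (map_trm rs t))"
| "forces rs rc p e E (ClsEq S T) \<longleftrightarrow>
    forces_class_eq M P L FE p (tval E (map_trm rc S)) (tval E (map_trm rc T))"
| "forces rs rc p e E (ClsMem s T) \<longleftrightarrow>
    forces_class_mem M P L FE p (tval e (map_trm rs s)) (tval E (map_trm rc T))"
| "forces rs rc p e E (Neg \<phi>) \<longleftrightarrow> (\<forall>q\<in>Cond. q \<preceq> p \<longrightarrow> \<not> forces rs rc q e E \<phi>)"
| "forces rs rc p e E (Conj \<phi> \<psi>) \<longleftrightarrow> forces rs rc p e E \<phi> \<and> forces rs rc p e E \<psi>"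
| "forces rs rc p e E (AllSet \<phi>) \<longleftrightarrow> (\<forall>\<sigma>\<in>Names. forces rs rc p (case_nat \<sigma> e) E \<phi>)"
| "forces rs rc p e E (AllCls \<phi>) \<longleftrightarrow> (\<forall>\<Gamma>\<in>CNames. forces rs rc p e (case_nat \<Gamma> E) \<phi>)"

lemma forces_cong:
  "closed_fm k l \<phi> \<Longrightarrow> (\<And>n. n < k \<Longrightarrow> e n = e' n) \<Longrightarrow> (\<And>n. n < l \<Longrightarrow> E n = E' n) \<Longrightarrow>
    forces rs rc p e E \<phi> = forces rs rc p e' E' \<phi>"
proof (induction \<phi> arbitrary: k l e e' E E' p)
  case (AllSet \<phi>)
  have "forces rs rc p (case_nat x e) E \<phi> = forces rs rc p (case_nat x e') E' \<phi>" for x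
    by (rule AllSet.IH[of "Suc k" l]) (use AllSet.prems in \<open>auto split: nat.split\<close>)
  then show ?case by simp
next
  case (AllCls \<phi>)
  have "forces rs rc p e (case_nat X E) \<phi> = forces rs rc p e' (case_nat X E') \<phi>" for X
    by (rule AllCls.IH[of k "Suc l"]) (use AllCls.prems in \<open>auto split: nat.split\<close>)
  then show ?case by simp
next
  case (Conj \<phi> \<psi>)
  from Conj.IH(1)[of k l e e' E E'] Conj.IH(2)[of k l e e' E E'] Conj.prems show ?case by simp
next
  case (Neg \<phi>)
  from Neg.IH[of k l e e' E E'] Neg.prems show ?case by simp
next
  case (SetEq s t)
  then have "tval e (map_trm rs u) = tval e' (map_trm rs u)" if "u = s \<or> u = t" for u
    using that by (cases u) auto
  then show ?case by simp
next
  case (SetMem s t)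
  then have "tval e (map_trm rs u) = tval e' (map_trm rs u)" if "u = s \<or> u = t" for u
    using that by (cases u) auto
  then show ?case by simp
next
  case (ClsEq s t)
  then have "tval E (map_trm rc u) = tval E' (map_trm rc u)" if "u = s \<or> u = t" for u
    using that by (cases u) auto
  then show ?case by simp
next
  case (ClsMem s t)
  then have "tval e (map_trm rs s) = tval e' (map_trm rs s)" "tval E (map_trm rc t) = tval E' (map_trm rc t)"
    by (cases s; cases t; auto)+
  then show ?case by simp
qed

context
  fixes rs :: "'x \<Rightarrow> 'a" and rc :: "'y \<Rightarrow> 'b"
  assumes rs: "\<And>a. rs a \<in> Names" and rc: "\<And>a. rc a \<in> CNames"
begin

lemma tval_Names: "range e \<subseteq> Names \<Longrightarrow> tval e (map_trm rs t) \<in> Names"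
  using rs by (cases t) auto

lemma forces_mono:
  "forces rs rc p e E \<phi> \<Longrightarrow> q \<preceq> p \<Longrightarrow> q \<in> Cond \<Longrightarrow> p \<in> Cond \<Longrightarrow> range e \<subseteq> Names \<Longrightarrow> range E \<subseteq> CNames \<Longrightarrow>
    forces rs rc q e E \<phi>"
proof (induction \<phi> arbitrary: e E)
  case (AllSet \<phi>)
  then have "forces rs rc q (case_nat \<sigma> e) E \<phi>" if "\<sigma> \<in> Names" for \<sigma>
    using that by (intro AllSet.IH) (simp_all add: range_case_nat)
  then show ?case by simp
next
  case (AllCls \<phi>)
  then have "forces rs rc q e (case_nat \<sigma> E) \<phi>" if "\<sigma> \<in> CNames" for \<sigma>
    using that by (intro AllCls.IH) (simp_all add: range_case_nat)
  then show ?case by simp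
next
  case (Neg \<phi>)
  then show ?case using below_trans by auto
next
  case (ClsMem s t)
  then show ?case by (simp add: forces_class_mem_iff forces_entry_mono[of p])
next
  case (ClsEq s t)
  then show ?case by (simp add: forces_class_eq_iff forces_sub_mono[of p])
next
  case (SetMem s t)
  then show ?case by (simp add: forces_mem_iff tval_Names forces_entry_mono[of p])
next
  case (SetEq s t)
  then show ?case by (simp add: forces_eq_iff tval_Names forces_sub_mono[of p])
qed auto

text \<open>For atomic formulas this holds because forced membership is itself a density statement,
  for negation because forcing passes to stronger conditions. Together with the clause for
  \<open>Neg\<close> it shows that \<open>p\<close> forces \<open>\<phi>\<close> if no extension of
  \<open>p\<close> forces \<open>Neg \<phi>\<close>.\<close>

lemma forces_dense:
  "p \<in> Cond \<Longrightarrow> (\<And>p'. p' \<in> Cond \<Longrightarrow> p' \<preceq> p \<Longrightarrow> \<exists>q\<in>Cond. q \<preceq> p' \<and> forces rs rc q e E \<phi>) \<Longrightarrow>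
    range e \<subseteq> Names \<Longrightarrow> range E \<subseteq> CNames \<Longrightarrow> forces rs rc p e E \<phi>"
proof (induction \<phi> arbitrary: e E)
  case (SetEq s t)
  then have "\<exists>q\<in>Cond. q \<preceq> p' \<and> forces_sub q (entries (tval e (map_trm rs s))) (entries (tval e (map_trm rs t)))
       \<and> forces_sub q (entries (tval e (map_trm rs t))) (entries (tval e (map_trm rs s)))"
    if "p' \<in> Cond" "p' \<preceq> p" for p'
    using that by (simp add: forces_eq_iff tval_Names)
  then have "forces_sub p (entries (tval e (map_trm rs s))) (entries (tval e (map_trm rs t)))"
    "forces_sub p (entries (tval e (map_trm rs t))) (entries (tval e (map_trm rs s)))"
    by (intro forces_sub_dense SetEq.prems(1) entries_subset, blast)+
  with SetEq.prems show ?case by (simp add: forces_eq_iff tval_Names)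
next
  case (SetMem s t)
  then have "\<exists>q\<in>Cond. q \<preceq> p' \<and> forces_entry q (tval e (map_trm rs s)) (entries (tval e (map_trm rs t)))"
    if "p' \<in> Cond" "p' \<preceq> p" for p'
    using that by (metis forces.simps(2) forces_mem_iff tval_Names)
  from forces_entry_dense[OF SetMem.prems(1) this] SetMem.prems
  show ?case by (simp add: forces_mem_iff tval_Names)
next
  case (ClsEq s t)
  then have "forces_sub p (centries (tval E (map_trm rc s))) (centries (tval E (map_trm rc t)))"
    "forces_sub p (centries (tval E (map_trm rc t))) (centries (tval E (map_trm rc s)))"
    by (intro forces_sub_dense ClsEq.prems(1) entries_subset, force simp: forces_class_eq_iff)+
  then show ?case by (simp add: forces_class_eq_iff)
next
  case (ClsMem s t)
  then show ?case by (simp add: forces_class_mem_iff forces_entry_dense)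
next
  case (Neg \<phi>)
  have False if q: "q \<in> Cond" "q \<preceq> p" "forces rs rc q e E \<phi>" for q
  proof -
    obtain r where r: "r \<in> Cond" "r \<preceq> q" "forces rs rc r e E (Neg \<phi>)" using Neg.prems(2)[OF q(1,2)] by blast
    have "forces rs rc r e E \<phi>" using forces_mono[OF q(3) r(2)] r q Neg.prems by blast
    with r below_refl show False by auto
  qed
  then show ?case by auto
next
  case (Conj \<phi> \<psi>)
  have "forces rs rc p e E \<phi>" by (rule Conj.IH(1)) (use Conj.prems in force)+
  moreover have "forces rs rc p e E \<psi>" by (rule Conj.IH(2)) (use Conj.prems in force)+
  ultimately show ?case by simp
next
  case (AllSet \<phi>)
  have "forces rs rc p (case_nat \<sigma> e) E \<phi>" if "\<sigma> \<in> Names" for \<sigma>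
  proof (rule AllSet.IH)
    show "range (case_nat \<sigma> e) \<subseteq> Names" using that AllSet.prems(3) by (simp add: range_case_nat)
    fix p' assume "p' \<in> Cond" "p' \<preceq> p"
    with AllSet.prems(2) that show "\<exists>q\<in>Cond. q \<preceq> p' \<and> forces rs rc q (case_nat \<sigma> e) E \<phi>" by fastforce
  qed (use AllSet.prems in simp_all)
  then show ?case by simp
next
  case (AllCls \<phi>)
  have "forces rs rc p e (case_nat \<sigma> E) \<phi>" if "\<sigma> \<in> CNames" for \<sigma>
  proof (rule AllCls.IH)
    show "range (case_nat \<sigma> E) \<subseteq> CNames" using that AllCls.prems(4) by (simp add: range_case_nat)
    fix p' assume "p' \<in> Cond" "p' \<preceq> p"
    with AllCls.prems(2) that show "\<exists>q\<in>Cond. q \<preceq> p' \<and> forces rs rc q e (case_nat \<sigma> E) \<phi>" by fastforce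
  qed (use AllCls.prems in simp_all)
  then show ?case by simp
qed

end

end

section \<open>The truth lemma\<close>

context class_forcing
begin

lemma class_names_iff:
  "\<Gamma> \<in> CNames \<longleftrightarrow> (\<forall>z. cmem M z \<Gamma> \<longrightarrow> (\<exists>\<rho> p. \<rho> \<in> Names \<and> cmem M p P \<and> is_pair M \<rho> p z))"
  by (simp add: class_names_def Sets_UNIV Classes_UNIV Bex_def conds_def)

end

locale generic_sequence = class_forcing +
  fixes pn :: "nat \<Rightarrow> 'a"
  assumes pn_Cond: "\<And>n. pn n \<in> Cond" and pn_Suc: "\<And>n. pn (Suc n) \<preceq> pn n"
    and decides: "\<And>Q. definable M False 1 0 (\<lambda>e E. Q (e 0)) \<Longrightarrow>
      \<exists>n. Q (pn n) \<or> (\<forall>q\<in>Cond. q \<preceq> pn n \<longrightarrow> \<not> Q q)"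
begin

lemma pn_mono: "m \<le> n \<Longrightarrow> pn n \<preceq> pn m"
  by (induction rule: dec_induct) (use below_refl below_trans pn_Cond pn_Suc in blast)+

definition G :: "'a set" where
  "G = {p \<in> Cond. \<exists>n. pn n \<preceq> p}"

lemma pn_G: "pn n \<in> G"
  unfolding G_def using pn_Cond below_refl by blast

text \<open>Allows the sequence to replace the filter in all that follows.\<close>

lemma bex_G_iff:
  assumes "\<And>p q. R p \<Longrightarrow> q \<preceq> p \<Longrightarrow> q \<in> Cond \<Longrightarrow> p \<in> Cond \<Longrightarrow> R q"
  shows "(\<exists>p\<in>G. R p) \<longleftrightarrow> (\<exists>n. R (pn n))"
  using assms pn_G pn_Cond unfolding G_def by blast

lemma eventually_pn:
  assumes "\<And>p q. R p \<Longrightarrow> q \<preceq> p \<Longrightarrow> q \<in> Cond \<Longrightarrow> p \<in> Cond \<Longrightarrow> R q" "R (pn m)" "m \<le> n"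
  shows "R (pn n)"
  using assms(1)[OF assms(2) pn_mono[OF assms(3)]] pn_Cond by blast

lemma generic_filter_G: "generic_filter M P L G"
proof -
  have "is_filter M P L G" unfolding is_filter_def
  proof (intro conjI ballI impI)
    show "G \<subseteq> Cond" by (auto simp: G_def)
    show "G \<noteq> {}" using pn_G by blast
    show "q \<in> G" if "p \<in> G" "q \<in> Cond" "p \<preceq> q" for p q
      using that below_trans pn_Cond unfolding G_def by blast
    show "\<exists>r\<in>G. r \<preceq> p \<and> r \<preceq> q" if pq: "p \<in> G" "q \<in> G" for p q
    proof -
      obtain m n where mn: "pn m \<preceq> p" "pn n \<preceq> q" "p \<in> Cond" "q \<in> Cond"
        using pq unfolding G_def by blast
      have "pn (max m n) \<preceq> p" "pn (max m n) \<preceq> q"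
        using below_trans[OF pn_mono[of m "max m n"] mn(1)] below_trans[OF pn_mono[of n "max m n"] mn(2)]
          pn_Cond mn by auto
      with pn_G show ?thesis by blast
    qed
  qed
  moreover have "G \<inter> conds M D \<noteq> {}" if D: "dense_class M P L D" for D
  proof -
    have "definable M False 1 0 (\<lambda>e E. cmem M (e 0) D)" by (rule definable_intros | simp)+
    from decides[OF this] obtain n where n: "cmem M (pn n) D \<or> (\<forall>q\<in>Cond. q \<preceq> pn n \<longrightarrow> \<not> cmem M q D)" by blast
    \<comment> \<open>Density of \<open>D\<close> excludes that no extension of \<open>pn n\<close>
      lies in \<open>D\<close>, so the decision made at \<open>n\<close> puts \<open>pn n\<close>
      into \<open>D\<close>.\<close>
    have "cmem M (pn n) D"
    proof (rule ccontr)
      assume "\<not> ?thesis"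
      with n have *: "\<forall>q\<in>Cond. q \<preceq> pn n \<longrightarrow> \<not> cmem M q D" by blast
      obtain q where "q \<in> conds M D" "q \<preceq> pn n" using D pn_Cond unfolding dense_class_def by blast
      with * D show False unfolding dense_class_def by (auto simp: conds_def)
    qed
    then show ?thesis using pn_G by (auto simp: conds_def Sets_UNIV)
  qed
  ultimately show ?thesis by (simp add: generic_filter_def)
qed

section \<open>Equality and membership in \<open>M[G]\<close>, read off the sequence\<close>

definition set_eq :: "'a \<Rightarrow> 'a \<Rightarrow> bool" where
  "set_eq \<sigma> \<tau> \<longleftrightarrow> (\<exists>n. crel3 M FE (pn n) \<sigma> \<tau>)"

definition cls_eq :: "'b \<Rightarrow> 'b \<Rightarrow> bool" where
  "cls_eq \<Gamma> \<Delta> \<longleftrightarrow> (\<exists>n. forces_class_eq M P L FE (pn n) \<Gamma> \<Delta>)"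

definition set_in :: "'a \<Rightarrow> 'a \<Rightarrow> bool" where
  "set_in \<sigma> \<tau> \<longleftrightarrow> (\<exists>n. crel3 M FI (pn n) \<sigma> \<tau>)"

definition cls_in :: "'a \<Rightarrow> 'b \<Rightarrow> bool" where
  "cls_in \<sigma> \<Gamma> \<longleftrightarrow> (\<exists>n. forces_class_mem M P L FE (pn n) \<sigma> \<Gamma>)"

lemma set_eq_refl: "\<sigma> \<in> Names \<Longrightarrow> set_eq \<sigma> \<sigma>"
  using forces_eq_refl pn_Cond by (auto simp: set_eq_def)

lemma set_eq_sym: "set_eq \<sigma> \<tau> \<Longrightarrow> \<sigma> \<in> Names \<Longrightarrow> \<tau> \<in> Names \<Longrightarrow> set_eq \<tau> \<sigma>"
  using forces_eq_sym pn_Cond unfolding set_eq_def by blast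

lemma set_eq_at:
  "set_eq \<sigma> \<tau> \<Longrightarrow> \<sigma> \<in> Names \<Longrightarrow> \<tau> \<in> Names \<Longrightarrow> \<exists>m. \<forall>n\<ge>m. crel3 M FE (pn n) \<sigma> \<tau>"
  using eventually_pn[of "\<lambda>p. crel3 M FE p \<sigma> \<tau>"] forces_eq_mono unfolding set_eq_def by blast

lemma set_eq_trans:
  assumes "set_eq \<sigma> \<tau>" "set_eq \<tau> \<pi>" "\<sigma> \<in> Names" "\<tau> \<in> Names" "\<pi> \<in> Names" shows "set_eq \<sigma> \<pi>"
proof -
  obtain m n where "\<forall>i\<ge>m. crel3 M FE (pn i) \<sigma> \<tau>" "\<forall>i\<ge>n. crel3 M FE (pn i) \<tau> \<pi>"
    using set_eq_at assms by metis
  then have "crel3 M FE (pn (max m n)) \<sigma> \<tau>" "crel3 M FE (pn (max m n)) \<tau> \<pi>" by simp_all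
  then have "crel3 M FE (pn (max m n)) \<sigma> \<pi>" using forces_eq_trans pn_Cond assms by blast
  then show ?thesis by (auto simp: set_eq_def)
qed

lemma cls_eq_refl: "cls_eq \<Gamma> \<Gamma>"
  using forces_sub_refl pn_Cond entries_subset by (auto simp: cls_eq_def forces_class_eq_iff)

lemma cls_eq_sym: "cls_eq \<Gamma> \<Delta> \<Longrightarrow> cls_eq \<Delta> \<Gamma>"
  by (auto simp: cls_eq_def forces_class_eq_iff)

lemma cls_eq_at: "cls_eq \<Gamma> \<Delta> \<Longrightarrow> \<exists>m. \<forall>n\<ge>m. forces_class_eq M P L FE (pn n) \<Gamma> \<Delta>"
  using eventually_pn[of "\<lambda>p. forces_class_eq M P L FE p \<Gamma> \<Delta>"] forces_sub_mono
  unfolding cls_eq_def forces_class_eq_iff by blast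

lemma cls_eq_trans:
  assumes "cls_eq \<Gamma> \<Delta>" "cls_eq \<Delta> \<Theta>" shows "cls_eq \<Gamma> \<Theta>"
proof -
  obtain m n where "\<forall>i\<ge>m. forces_class_eq M P L FE (pn i) \<Gamma> \<Delta>" "\<forall>i\<ge>n. forces_class_eq M P L FE (pn i) \<Delta> \<Theta>"
    using cls_eq_at assms by metis
  then have "forces_class_eq M P L FE (pn (max m n)) \<Gamma> \<Theta>"
    using forces_sub_trans pn_Cond entries_subset(2) unfolding forces_class_eq_iff by (meson max.cobounded1 max.cobounded2)
  then show ?thesis by (auto simp: cls_eq_def)
qed

lemma set_in_cong:
  assumes "set_in \<sigma> \<tau>" "set_eq \<sigma> \<sigma>'" "set_eq \<tau> \<tau>'"
    "\<sigma> \<in> Names" "\<tau> \<in> Names" "\<sigma>' \<in> Names" "\<tau>' \<in> Names"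
  shows "set_in \<sigma>' \<tau>'"
proof -
  obtain k m n where "\<forall>i\<ge>m. crel3 M FE (pn i) \<sigma> \<sigma>'" "\<forall>i\<ge>n. crel3 M FE (pn i) \<tau> \<tau>'"
    and k: "crel3 M FI (pn k) \<sigma> \<tau>"
    using set_eq_at assms unfolding set_in_def by metis
  moreover define i where "i = max k (max m n)"
  ultimately have eq: "crel3 M FE (pn i) \<sigma> \<sigma>'" "crel3 M FE (pn i) \<tau> \<tau>'" by simp_all
  have "forces_entry (pn i) \<sigma> (entries \<tau>)"
    using forces_entry_mono[of "pn k"] k pn_mono[of k i] pn_Cond assms by (simp add: forces_mem_iff i_def)
  then have "forces_entry (pn i) \<sigma>' (entries \<tau>)"
    using forces_entry_cong eq pn_Cond assms entries_subset by blast
  moreover have "forces_sub (pn i) (entries \<tau>) (entries \<tau>')"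
    using eq(2) pn_Cond assms by (simp add: forces_eq_iff)
  ultimately have "forces_entry (pn i) \<sigma>' (entries \<tau>')"
    using forces_entry_sub pn_Cond assms entries_subset by blast
  then show ?thesis using pn_Cond assms by (auto simp: set_in_def forces_mem_iff)
qed

lemma cls_in_cong:
  assumes "cls_in \<sigma> \<Gamma>" "set_eq \<sigma> \<sigma>'" "cls_eq \<Gamma> \<Delta>" "\<sigma> \<in> Names" "\<sigma>' \<in> Names"
  shows "cls_in \<sigma>' \<Delta>"
proof -
  obtain k m n where "\<forall>i\<ge>m. crel3 M FE (pn i) \<sigma> \<sigma>'" "\<forall>i\<ge>n. forces_class_eq M P L FE (pn i) \<Gamma> \<Delta>"
    and k: "forces_entry (pn k) \<sigma> (centries \<Gamma>)"
    using set_eq_at cls_eq_at assms unfolding cls_in_def forces_class_mem_iff by metis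
  moreover define i where "i = max k (max m n)"
  ultimately have eq: "crel3 M FE (pn i) \<sigma> \<sigma>'" "forces_class_eq M P L FE (pn i) \<Gamma> \<Delta>" by simp_all
  have "forces_entry (pn i) \<sigma> (centries \<Gamma>)"
    using forces_entry_mono[of "pn k"] k pn_mono[of k i] pn_Cond by (simp add: i_def)
  then have "forces_entry (pn i) \<sigma>' (centries \<Gamma>)"
    using forces_entry_cong eq pn_Cond assms entries_subset by blast
  moreover have "forces_sub (pn i) (centries \<Gamma>) (centries \<Delta>)"
    using eq(2) by (simp add: forces_class_eq_iff)
  ultimately have "forces_entry (pn i) \<sigma>' (centries \<Delta>)"
    using forces_entry_sub pn_Cond assms entries_subset by blast
  then show ?thesis by (auto simp: cls_in_def forces_class_mem_iff)
qed

lemma set_name_eq_iff: "(\<sigma>, \<tau>) \<in> set_name_eq M P FE G \<longleftrightarrow> \<sigma> \<in> Names \<and> \<tau> \<in> Names \<and> set_eq \<sigma> \<tau>"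
proof -
  have "(\<exists>p\<in>G. crel3 M FE p \<sigma> \<tau>) \<longleftrightarrow> (\<exists>n. crel3 M FE (pn n) \<sigma> \<tau>)" if "\<sigma> \<in> Names" "\<tau> \<in> Names"
    by (rule bex_G_iff) (use that forces_eq_mono in blast)
  then show ?thesis unfolding set_name_eq_def set_eq_def by blast
qed

lemma class_name_eq_iff: "(\<Gamma>, \<Delta>) \<in> class_name_eq M P L FE G \<longleftrightarrow> \<Gamma> \<in> CNames \<and> \<Delta> \<in> CNames \<and> cls_eq \<Gamma> \<Delta>"
proof -
  have "(\<exists>p\<in>G. forces_class_eq M P L FE p \<Gamma> \<Delta>) \<longleftrightarrow> (\<exists>n. forces_class_eq M P L FE (pn n) \<Gamma> \<Delta>)"
    by (rule bex_G_iff) (use forces_sub_mono in \<open>unfold forces_class_eq_iff, blast\<close>)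
  then show ?thesis unfolding class_name_eq_def cls_eq_def by blast
qed

lemma set_in_iff:
  assumes "\<sigma> \<in> Names" "\<tau> \<in> Names" shows "(\<exists>p\<in>G. crel3 M FI p \<sigma> \<tau>) \<longleftrightarrow> set_in \<sigma> \<tau>"
  unfolding set_in_def
proof (rule bex_G_iff)
  fix p q assume "crel3 M FI p \<sigma> \<tau>" "q \<preceq> p" "q \<in> Cond" "p \<in> Cond"
  with assms forces_entry_mono show "crel3 M FI q \<sigma> \<tau>" by (simp only: forces_mem_iff)
qed

lemma cls_in_iff: "(\<exists>p\<in>G. forces_class_mem M P L FE p \<sigma> \<Gamma>) \<longleftrightarrow> cls_in \<sigma> \<Gamma>"
  unfolding cls_in_def forces_class_mem_iff by (rule bex_G_iff) (rule forces_entry_mono)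

section \<open>The presentation on representatives and its truth lemma\<close>

context
  fixes rs :: "'x \<Rightarrow> 'a" and rc :: "'y \<Rightarrow> 'b"
  assumes rs: "\<And>a. rs a \<in> Names" and rc: "\<And>a. rc a \<in> CNames"
    and rs_inj: "\<And>a b. set_eq (rs a) (rs b) \<Longrightarrow> a = b" and rc_inj: "\<And>a b. cls_eq (rc a) (rc b) \<Longrightarrow> a = b"
    and rs_surj: "\<And>\<sigma>. \<sigma> \<in> Names \<Longrightarrow> \<exists>a. set_eq (rs a) \<sigma>"
    and rc_surj: "\<And>\<Gamma>. \<Gamma> \<in> CNames \<Longrightarrow> \<exists>a. cls_eq (rc a) \<Gamma>"
begin

definition N :: "('x, 'y) struct" where
  "N = \<lparr>Sets = UNIV, Classes = UNIV, smem = (\<lambda>a b. set_in (rs a) (rs b)), cmem = (\<lambda>a X. cls_in (rs a) (rc X))\<rparr>"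

text \<open>A number is sent to the equivalence class of its representative. Representatives meet
  each class exactly once, which gives bijections, and membership carries over because it is
  invariant under equality along the sequence.\<close>

lemma isomorphic_N: "isomorphic N (generic_extension M P L FE FI G)"
proof -
  let ?f = "\<lambda>a. set_name_eq M P FE G `` {rs a}" and ?g = "\<lambda>a. class_name_eq M P L FE G `` {rc a}"
  have f: "\<sigma> \<in> ?f a \<longleftrightarrow> \<sigma> \<in> Names \<and> set_eq (rs a) \<sigma>" for \<sigma> a using rs by (simp add: set_name_eq_iff)
  have g: "\<sigma> \<in> ?g a \<longleftrightarrow> \<sigma> \<in> CNames \<and> cls_eq (rc a) \<sigma>" for \<sigma> a using rc by (simp add: class_name_eq_iff)
  have "bij_betw ?f UNIV (Names // set_name_eq M P FE G)"
  proof (rule bij_betw_imageI)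
    show "inj ?f"
    proof (rule injI)
      fix a b assume "?f a = ?f b"
      then have "rs b \<in> ?f a" using f[of "rs b" b] rs set_eq_refl by simp
      then show "a = b" using f rs_inj by blast
    qed
    show "range ?f = Names // set_name_eq M P FE G"
    proof
      show "range ?f \<subseteq> Names // set_name_eq M P FE G" using rs by (auto simp: quotient_def)
      have "\<exists>a. set_name_eq M P FE G `` {\<sigma>} = ?f a" if \<sigma>: "\<sigma> \<in> Names" for \<sigma>
      proof -
        obtain a where a: "set_eq (rs a) \<sigma>" using rs_surj[OF \<sigma>] by blast
        have "set_name_eq M P FE G `` {\<sigma>} = ?f a"
        proof (rule set_eqI)
          fix \<tau>
          show "\<tau> \<in> set_name_eq M P FE G `` {\<sigma>} \<longleftrightarrow> \<tau> \<in> ?f a"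
            unfolding f using set_eq_trans[of "rs a" \<sigma> \<tau>] set_eq_trans[of \<sigma> "rs a" \<tau>] set_eq_sym[of "rs a" \<sigma>]
              a \<sigma> rs[of a] by (simp only: set_name_eq_iff Image_singleton_iff) blast
        qed
        then show ?thesis ..
      qed
      then show "Names // set_name_eq M P FE G \<subseteq> range ?f" unfolding quotient_def by blast
    qed
  qed
  moreover have "bij_betw ?g UNIV (CNames // class_name_eq M P L FE G)"
  proof (rule bij_betw_imageI)
    show "inj ?g"
    proof (rule injI)
      fix a b assume "?g a = ?g b"
      then have "rc b \<in> ?g a" using g[of "rc b" b] rc cls_eq_refl by simp
      then show "a = b" using g rc_inj by blast
    qed
    show "range ?g = CNames // class_name_eq M P L FE G"
    proof
      show "range ?g \<subseteq> CNames // class_name_eq M P L FE G" using rc by (auto simp: quotient_def)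
      have "\<exists>a. class_name_eq M P L FE G `` {\<sigma>} = ?g a" if \<sigma>: "\<sigma> \<in> CNames" for \<sigma>
      proof -
        obtain a where a: "cls_eq (rc a) \<sigma>" using rc_surj[OF \<sigma>] by blast
        have "class_name_eq M P L FE G `` {\<sigma>} = ?g a"
        proof (rule set_eqI)
          fix \<tau>
          show "\<tau> \<in> class_name_eq M P L FE G `` {\<sigma>} \<longleftrightarrow> \<tau> \<in> ?g a"
            unfolding g using cls_eq_trans[of "rc a" \<sigma> \<tau>] cls_eq_trans[of \<sigma> "rc a" \<tau>] cls_eq_sym[of "rc a" \<sigma>]
              a \<sigma> by (simp only: class_name_eq_iff Image_singleton_iff) blast
        qed
        then show ?thesis ..
      qed
      then show "CNames // class_name_eq M P L FE G \<subseteq> range ?g" unfolding quotient_def by blast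
    qed
  qed
  moreover have "set_in (rs a) (rs b) \<longleftrightarrow> (\<exists>\<sigma>\<in>?f a. \<exists>\<tau>\<in>?f b. \<exists>p\<in>G. crel3 M FI p \<sigma> \<tau>)" for a b
  proof
    assume "set_in (rs a) (rs b)"
    then have "\<exists>p\<in>G. crel3 M FI p (rs a) (rs b)" using set_in_iff rs by blast
    then show "\<exists>\<sigma>\<in>?f a. \<exists>\<tau>\<in>?f b. \<exists>p\<in>G. crel3 M FI p \<sigma> \<tau>" using f rs set_eq_refl by blast
  next
    assume "\<exists>\<sigma>\<in>?f a. \<exists>\<tau>\<in>?f b. \<exists>p\<in>G. crel3 M FI p \<sigma> \<tau>"
    then obtain \<sigma> \<tau> where "\<sigma> \<in> ?f a" "\<tau> \<in> ?f b" and in': "\<exists>p\<in>G. crel3 M FI p \<sigma> \<tau>" by (elim bexE) blast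
    then have "\<sigma> \<in> Names" "set_eq (rs a) \<sigma>" "\<tau> \<in> Names" "set_eq (rs b) \<tau>" by (simp_all only: f)
    moreover from this in' have "set_in \<sigma> \<tau>" using set_in_iff by simp
    ultimately show "set_in (rs a) (rs b)"
      using set_in_cong[of \<sigma> \<tau> "rs a" "rs b"] set_eq_sym[of "rs a" \<sigma>] set_eq_sym[of "rs b" \<tau>] rs by simp
  qed
  moreover have "cls_in (rs a) (rc b) \<longleftrightarrow> (\<exists>\<sigma>\<in>?f a. \<exists>\<tau>\<in>?g b. \<exists>p\<in>G. forces_class_mem M P L FE p \<sigma> \<tau>)" for a b
  proof
    assume "cls_in (rs a) (rc b)"
    then have "\<exists>p\<in>G. forces_class_mem M P L FE p (rs a) (rc b)" using cls_in_iff by blast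
    then show "\<exists>\<sigma>\<in>?f a. \<exists>\<tau>\<in>?g b. \<exists>p\<in>G. forces_class_mem M P L FE p \<sigma> \<tau>"
      using f g rs rc set_eq_refl cls_eq_refl by blast
  next
    assume "\<exists>\<sigma>\<in>?f a. \<exists>\<tau>\<in>?g b. \<exists>p\<in>G. forces_class_mem M P L FE p \<sigma> \<tau>"
    then obtain \<sigma> \<tau> where "\<sigma> \<in> Names" "set_eq (rs a) \<sigma>" "cls_eq (rc b) \<tau>" "cls_in \<sigma> \<tau>"
      using f g cls_in_iff by blast
    then show "cls_in (rs a) (rc b)" using cls_in_cong set_eq_sym cls_eq_sym rs by blast
  qed
  ultimately show ?thesis unfolding isomorphic_def
    by (intro exI[of _ ?f] exI[of _ ?g] conjI ballI) (simp_all only: N_def generic_extension_def struct.select_convs)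
qed

context
  assumes expressible: "\<And>\<phi>. \<exists>\<psi>. \<forall>p e E. sat M (case_nat p e) E \<psi> \<longleftrightarrow> forces rs rc p e E \<phi>"
begin

text \<open>The environments become parameters, except for the condition and, in the last two
  versions, one name or class name. These leave room for the quantifier over names in the properties
  to which genericity is applied.\<close>

lemma definable_forces:
  "definable M False 1 0 (\<lambda>e' E'. forces rs rc (e' 0) e E \<phi>)"
  "definable M False 2 0 (\<lambda>e' E'. forces rs rc (e' 0) (case_nat (e' 1) e) E \<phi>)"
  "definable M False 1 1 (\<lambda>e' E'. forces rs rc (e' 0) e (case_nat (E' 0) E) \<phi>)"
proof -
  obtain \<psi> where \<psi>: "\<And>p e E. sat M (case_nat p e) E \<psi> \<longleftrightarrow> forces rs rc p e E \<phi>" using expressible by blast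
  have 1: "(\<lambda>n. if n = 0 then e' n else e (n - Suc 0)) = case_nat (e' 0) e" for e' e :: "nat \<Rightarrow> 'a"
    by (rule HOL.ext) (simp split: nat.split)
  have 3: "(\<lambda>n. if n = 0 then e' n else e (n - Suc 0)) = case_nat (e' 0) e" for e' e :: "nat \<Rightarrow> 'b"
    by (rule HOL.ext) (simp split: nat.split)
  have 2: "(\<lambda>n. if n < 2 then e' n else e (n - 2)) = case_nat (e' 0) (case_nat (e' 1) e)" for e' :: "nat \<Rightarrow> 'a"
    by (rule HOL.ext) (auto split: nat.split simp: numeral_2_eq_2)
  show "definable M False 1 0 (\<lambda>e' E'. forces rs rc (e' 0) e E \<phi>)"
    unfolding definable_def by (rule exI[of _ "inst 1 0 e E \<psi>"]) (simp add: closed_inst sat_inst 1 3 \<psi>)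
  show "definable M False 2 0 (\<lambda>e' E'. forces rs rc (e' 0) (case_nat (e' 1) e) E \<phi>)"
    unfolding definable_def by (rule exI[of _ "inst 2 0 e E \<psi>"]) (simp add: closed_inst sat_inst 2[simplified] \<psi>)
  show "definable M False 1 1 (\<lambda>e' E'. forces rs rc (e' 0) e (case_nat (E' 0) E) \<phi>)"
    unfolding definable_def by (rule exI[of _ "inst 1 1 e E \<psi>"]) (simp add: closed_inst sat_inst 1 3 \<psi>)
qed

text \<open>That no extension of \<open>pn n\<close> forces \<open>\<phi>\<close> is literally the
  clause for \<open>Neg \<phi>\<close>.\<close>

lemma decides_forces: "(\<exists>n. forces rs rc (pn n) e E \<phi>) \<or> (\<exists>n. forces rs rc (pn n) e E (Neg \<phi>))"
  using decides[OF definable_forces(1)[of e E \<phi>]] by auto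

text \<open>The names \<open>e\<close> may be any names of the values \<open>e'\<close>, not just
  their representatives, since forcing a universal formula speaks of all names.\<close>

theorem truth:
  assumes "range e \<subseteq> Names" "range E \<subseteq> CNames" "\<And>i. set_eq (rs (e' i)) (e i)" "\<And>i. cls_eq (rc (E' i)) (E i)"
  shows "sat N e' E' \<phi> \<longleftrightarrow> (\<exists>n. forces rs rc (pn n) e E \<phi>)"
  using assms
proof (induction \<phi> arbitrary: e e' E E')
  case (Neg \<phi>)
  have IH: "sat N e' E' \<phi> \<longleftrightarrow> (\<exists>n. forces rs rc (pn n) e E \<phi>)" by (rule Neg.IH[OF Neg.prems])
  have False if n: "forces rs rc (pn m) e E \<phi>" "forces rs rc (pn n) e E (Neg \<phi>)" for m n
  proof -
    have "forces rs rc (pn (max m n)) e E \<phi>"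
      using forces_mono[of rs rc, OF rs rc n(1) pn_mono[of m "max m n"]] pn_Cond Neg.prems by simp
    then show False using n(2) pn_mono[of n "max m n"] pn_Cond by auto
  qed
  with IH decides_forces show ?case by auto
next
  case (Conj \<phi> \<psi>)
  have IH: "sat N e' E' \<phi> \<longleftrightarrow> (\<exists>n. forces rs rc (pn n) e E \<phi>)" "sat N e' E' \<psi> \<longleftrightarrow> (\<exists>n. forces rs rc (pn n) e E \<psi>)"
    by (rule Conj.IH[OF Conj.prems])+
  have "\<exists>n. forces rs rc (pn n) e E (Conj \<phi> \<psi>)"
    if n: "forces rs rc (pn m) e E \<phi>" "forces rs rc (pn n) e E \<psi>" for m n
    using forces_mono[of rs rc, OF rs rc n(1) pn_mono[of m "max m n"]]
      forces_mono[of rs rc, OF rs rc n(2) pn_mono[of n "max m n"]] pn_Cond Conj.prems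
    by (intro exI[of _ "max m n"]) simp
  with IH show ?case by auto
next
  case (AllSet \<phi>)
  have IH: "sat N (case_nat a e') E' \<phi> \<longleftrightarrow> (\<exists>n. forces rs rc (pn n) (case_nat \<sigma> e) E \<phi>)"
    if "\<sigma> \<in> Names" "set_eq (rs a) \<sigma>" for a \<sigma>
    by (rule AllSet.IH) (use AllSet.prems that in \<open>auto simp: range_case_nat split: nat.split\<close>)
  have IHn: "\<not> sat N (case_nat a e') E' \<phi>" if h: "\<sigma> \<in> Names" "set_eq (rs a) \<sigma>"
      "forces rs rc (pn n) (case_nat \<sigma> e) E (Neg \<phi>)" for a \<sigma> n
  proof
    assume "sat N (case_nat a e') E' \<phi>"
    then obtain m where m: "forces rs rc (pn m) (case_nat \<sigma> e) E \<phi>" using IH[OF h(1,2)] by blast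
    have "forces rs rc (pn (max m n)) (case_nat \<sigma> e) E \<phi>"
      using forces_mono[of rs rc, OF rs rc m pn_mono[of m "max m n"]] pn_Cond AllSet.prems that
      by (simp add: range_case_nat)
    then show False using that(3) pn_mono[of n "max m n"] pn_Cond by auto
  qed
  obtain V where V: "\<And>\<sigma>. \<sigma> \<in> Names \<longleftrightarrow> cmem M \<sigma> V" using ex_class_set_names[of P] by blast
  \<comment> \<open>If \<open>pn n\<close> had this property, the universal formula would fail in
    \<open>N\<close>. So for a true formula no extension of the deciding \<open>pn n\<close> has it.
    For each name \<open>\<sigma>\<close> the conditions forcing \<open>\<phi>\<close> are then
    dense below this one \<open>pn n\<close>, which by \<open>forces_dense\<close> forces all
    instances at once.\<close>
  let ?Q = "\<lambda>q. \<exists>\<sigma>. cmem M \<sigma> V \<and> forces rs rc q (case_nat \<sigma> e) E (Neg \<phi>)"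
  \<comment> \<open>\<open>definable_forces(2)\<close> wants the condition at index 0 and the name
    at index 1, while under the quantifier over \<open>\<sigma>\<close> they stand the other way
    round. Requantifying both as \<open>\<sigma>'\<close> and \<open>q\<close> restores the
    order.\<close>
  have "definable M False 1 0 (\<lambda>e' E'. \<exists>\<sigma>. cmem M \<sigma> V \<and> (\<exists>\<sigma>' q. q = e' 0 \<and> \<sigma>' = \<sigma> \<and>
      forces rs rc q (case_nat \<sigma>' e) E (Neg \<phi>)))"
    by (rule definable_ex definable_conj definable_seq definable_cmem definable_term_var definable_term_const
        definable_mono[OF definable_forces(2)[unfolded One_nat_def]] | simp del: forces.simps)+
  then have "definable M False 1 0 (\<lambda>e E. ?Q (e 0))" by simp
  from decides[OF this] obtain n where n: "?Q (pn n) \<or> (\<forall>q\<in>Cond. q \<preceq> pn n \<longrightarrow> \<not> ?Q q)" by blast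
  show ?case
  proof
    assume R: "\<exists>n. forces rs rc (pn n) e E (AllSet \<phi>)"
    then have "sat N (case_nat a e') E' \<phi>" for a
      using IH[of "rs a" a] rs set_eq_refl by auto
    then show "sat N e' E' (AllSet \<phi>)" by simp
  next
    assume sat: "sat N e' E' (AllSet \<phi>)"
    have "\<not> ?Q (pn n)"
    proof
      assume "?Q (pn n)"
      then obtain \<sigma> where \<sigma>: "\<sigma> \<in> Names" "forces rs rc (pn n) (case_nat \<sigma> e) E (Neg \<phi>)" using V by blast
      obtain a where "set_eq (rs a) \<sigma>" using rs_surj[OF \<sigma>(1)] by blast
      from IHn[OF \<sigma>(1) this \<sigma>(2)] sat show False by (simp add: N_def)
    qed
    with n have n: "\<not> forces rs rc q (case_nat \<sigma> e) E (Neg \<phi>)" if "q \<in> Cond" "q \<preceq> pn n" "\<sigma> \<in> Names" for q \<sigma>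
      using that V by blast
    have "forces rs rc (pn n) (case_nat \<sigma> e) E \<phi>" if "\<sigma> \<in> Names" for \<sigma>
      by (rule forces_dense[of rs rc, OF rs rc pn_Cond])
        (use n that AllSet.prems in \<open>auto simp: range_case_nat\<close>)
    then show "\<exists>n. forces rs rc (pn n) e E (AllSet \<phi>)" by auto
  qed
next
  case (AllCls \<phi>)
  have IH: "sat N e' (case_nat a E') \<phi> \<longleftrightarrow> (\<exists>n. forces rs rc (pn n) e (case_nat \<sigma> E) \<phi>)"
    if "\<sigma> \<in> CNames" "cls_eq (rc a) \<sigma>" for a \<sigma>
    by (rule AllCls.IH) (use AllCls.prems that in \<open>auto simp: range_case_nat split: nat.split\<close>)
  have IHn: "\<not> sat N e' (case_nat a E') \<phi>" if h: "\<sigma> \<in> CNames" "cls_eq (rc a) \<sigma>"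
      "forces rs rc (pn n) e (case_nat \<sigma> E) (Neg \<phi>)" for a \<sigma> n
  proof
    assume "sat N e' (case_nat a E') \<phi>"
    then obtain m where m: "forces rs rc (pn m) e (case_nat \<sigma> E) \<phi>" using IH[OF h(1,2)] by blast
    have "forces rs rc (pn (max m n)) e (case_nat \<sigma> E) \<phi>"
      using forces_mono[of rs rc, OF rs rc m pn_mono[of m "max m n"]] pn_Cond AllCls.prems that
      by (simp add: range_case_nat)
    then show False using that(3) pn_mono[of n "max m n"] pn_Cond by auto
  qed
  obtain V where V: "\<And>\<sigma>. \<sigma> \<in> Names \<longleftrightarrow> cmem M \<sigma> V" using ex_class_set_names[of P] by blast
  let ?Q = "\<lambda>q. \<exists>\<Gamma>. \<Gamma> \<in> CNames \<and> forces rs rc q e (case_nat \<Gamma> E) (Neg \<phi>)"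
  have "definable M False 1 0 (\<lambda>e' E'. ?Q (e' 0))"
    unfolding class_names_iff V
    by (rule definable_ex_cls definable_conj definable_mono[OF definable_forces(3)] definable_intros | simp del: forces.simps)+
  from decides[OF this] obtain n where n: "?Q (pn n) \<or> (\<forall>q\<in>Cond. q \<preceq> pn n \<longrightarrow> \<not> ?Q q)" by blast
  show ?case
  proof
    assume R: "\<exists>n. forces rs rc (pn n) e E (AllCls \<phi>)"
    then have "sat N e' (case_nat a E') \<phi>" for a
      using IH[of "rc a" a] rc cls_eq_refl by auto
    then show "sat N e' E' (AllCls \<phi>)" by simp
  next
    assume sat: "sat N e' E' (AllCls \<phi>)"
    have "\<not> ?Q (pn n)"
    proof
      assume "?Q (pn n)"
      then obtain \<sigma> where \<sigma>: "\<sigma> \<in> CNames" "forces rs rc (pn n) e (case_nat \<sigma> E) (Neg \<phi>)" by blast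
      obtain a where "cls_eq (rc a) \<sigma>" using rc_surj[OF \<sigma>(1)] by blast
      from IHn[OF \<sigma>(1) this \<sigma>(2)] sat show False by (simp add: N_def)
    qed
    with n have n: "\<not> forces rs rc q e (case_nat \<sigma> E) (Neg \<phi>)" if "q \<in> Cond" "q \<preceq> pn n" "\<sigma> \<in> CNames" for q \<sigma>
      using that by blast
    have "forces rs rc (pn n) e (case_nat \<sigma> E) \<phi>" if "\<sigma> \<in> CNames" for \<sigma>
      by (rule forces_dense[of rs rc, OF rs rc pn_Cond])
        (use n that AllCls.prems in \<open>auto simp: range_case_nat\<close>)
    then show "\<exists>n. forces rs rc (pn n) e E (AllCls \<phi>)" by auto
  qed
next
  case (SetEq s t)
  have t: "set_eq (rs (tval e' u)) (tval e (map_trm rs u))" "tval e (map_trm rs u) \<in> Names" for u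
    using SetEq.prems rs set_eq_refl by (cases u; auto)+
  have "tval e' s = tval e' t \<longleftrightarrow> set_eq (tval e (map_trm rs s)) (tval e (map_trm rs t))"
    using t rs rs_inj set_eq_trans set_eq_sym by metis
  then show ?case by (simp add: set_eq_def)
next
  case (SetMem s t)
  have t: "set_eq (rs (tval e' u)) (tval e (map_trm rs u))" "tval e (map_trm rs u) \<in> Names" for u
    using SetMem.prems rs set_eq_refl by (cases u; auto)+
  have "set_in (rs (tval e' s)) (rs (tval e' t)) \<longleftrightarrow> set_in (tval e (map_trm rs s)) (tval e (map_trm rs t))"
    using t rs set_in_cong set_eq_sym by metis
  then show ?case by (simp add: N_def set_in_def)
next
  case (ClsEq s t)
  have t: "cls_eq (rc (tval E' u)) (tval E (map_trm rc u))" for u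
    using ClsEq.prems cls_eq_refl by (cases u; auto)+
  have "tval E' s = tval E' t \<longleftrightarrow> cls_eq (tval E (map_trm rc s)) (tval E (map_trm rc t))"
    using t rc_inj cls_eq_trans cls_eq_sym by metis
  then show ?case by (simp add: cls_eq_def)
next
  case (ClsMem s t)
  have s: "set_eq (rs (tval e' s)) (tval e (map_trm rs s))" "tval e (map_trm rs s) \<in> Names"
    using ClsMem.prems rs set_eq_refl by (cases s; auto)+
  have t: "cls_eq (rc (tval E' t)) (tval E (map_trm rc t))"
    using ClsMem.prems cls_eq_refl by (cases t; auto)+
  have "cls_in (rs (tval e' s)) (rc (tval E' t)) \<longleftrightarrow> cls_in (tval e (map_trm rs s)) (tval E (map_trm rc t))"
    using s t rs cls_in_cong set_eq_sym cls_eq_sym by metis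
  then show ?case by (simp add: N_def cls_in_def)
qed

end

end

end

section \<open>Effectivity of the forcing translation\<close>

lemma computable_code_Neg:
  "computable A k (\<lambda>e. fm_code (\<Phi> e)) \<Longrightarrow> computable A k (\<lambda>e. fm_code (Neg (\<Phi> e)))"
  unfolding fm_code.simps by (rule computable_prod_encode[OF computable_const])

lemma computable_code_Conj:
  "computable A k (\<lambda>e. fm_code (\<Phi> e)) \<Longrightarrow> computable A k (\<lambda>e. fm_code (\<Psi> e)) \<Longrightarrow>
    computable A k (\<lambda>e. fm_code (Conj (\<Phi> e) (\<Psi> e)))"
  unfolding fm_code.simps by (rule computable_prod_encode[OF computable_const computable_prod_encode])

lemma computable_code_AllSet:
  "computable A k (\<lambda>e. fm_code (\<Phi> e)) \<Longrightarrow> computable A k (\<lambda>e. fm_code (AllSet (\<Phi> e)))"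
  unfolding fm_code.simps by (rule computable_prod_encode[OF computable_const])

lemma computable_code_AllCls:
  "computable A k (\<lambda>e. fm_code (\<Phi> e)) \<Longrightarrow> computable A k (\<lambda>e. fm_code (AllCls (\<Phi> e)))"
  unfolding fm_code.simps by (rule computable_prod_encode[OF computable_const])

lemma computable_code_SetEq_Par:
  "computable A k h \<Longrightarrow> computable A k (\<lambda>e. fm_code (SetEq (Var i) (Par (h e))))"
  unfolding fm_code.simps trm_code.simps mult_2
  by (rule computable_prod_encode computable_const computable_add | assumption)+

lemma computable_code_ClsEq_Par:
  "computable A k h \<Longrightarrow> computable A k (\<lambda>e. fm_code (ClsEq (Var i) (Par (h e))))"
  unfolding fm_code.simps trm_code.simps mult_2
  by (rule computable_prod_encode computable_const computable_add | assumption)+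

lemmas computable_code_intros = computable_code_Neg computable_code_Conj computable_code_AllSet
  computable_code_AllCls computable_code_SetEq_Par computable_code_ClsEq_Par

text \<open>
  \<open>drop_var k \<psi>\<close> says \<open>\<psi>\<close> of the environment with its \<open>k\<close>-th entry removed. Instead of substituting, which
  would need a recursion with a changing parameter, all free variables of \<open>\<psi>\<close> are captured by new
  quantifiers \<open>\<forall>y (y = x \<longrightarrow> \<dots>)\<close>; the code of \<open>\<psi>\<close> bounds their number.
\<close>

definition skip :: "nat \<Rightarrow> nat \<Rightarrow> nat" where
  "skip k i = (if i < k then i else Suc i)"

primrec rename_upto :: "nat \<Rightarrow> nat \<Rightarrow> ('s, 'c) fm \<Rightarrow> nat \<Rightarrow> ('s, 'c) fm" where
  "rename_upto k n \<psi> 0 = \<psi>"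
| "rename_upto k n \<psi> (Suc j) =
    AllSet (Imp (SetEq (Var 0) (Var (skip k j + (n - j)))) (rename_upto k n \<psi> j))"

definition drop_var :: "nat \<Rightarrow> (nat, nat) fm \<Rightarrow> (nat, nat) fm" where
  "drop_var k \<psi> = rename_upto k (Suc (fm_code \<psi>)) \<psi> (Suc (fm_code \<psi>))"

lemma trm_bound: "trm_code t \<le> n \<Longrightarrow> tclosed (Suc n) t"
  by (cases t) auto

text \<open>A pair is never below its components and \<open>Var n\<close> has code
  \<open>2 * n\<close>, so no variable index exceeds the code. A program thus bounds the free
  variables without analysing the formula.\<close>

lemma closed_fm_code: "fm_code \<phi> \<le> n \<Longrightarrow> closed_fm (Suc n) (Suc n) \<phi>"
proof (induction \<phi> arbitrary: n)
  case (AllSet \<phi>)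
  then have "closed_fm (Suc n) (Suc n) \<phi>" using le_prod_encode_2 by (metis fm_code.simps(7) order_trans)
  then show ?case by (simp add: closed_fm_mono[of "Suc n" "Suc n"])
next
  case (AllCls \<phi>)
  then have "closed_fm (Suc n) (Suc n) \<phi>" using le_prod_encode_2 by (metis fm_code.simps(8) order_trans)
  then show ?case by (simp add: closed_fm_mono[of "Suc n" "Suc n"])
next
  case (Neg \<phi>)
  then show ?case using le_prod_encode_2 by (metis fm_code.simps(5) closed_fm.simps(5) order_trans)
next
  case (Conj \<phi> \<psi>)
  have "prod_encode (fm_code \<phi>, fm_code \<psi>) \<le> n"
    using Conj.prems le_prod_encode_2 by (metis fm_code.simps(6) order_trans)
  then have "fm_code \<phi> \<le> n" "fm_code \<psi> \<le> n"
    using le_prod_encode_1 le_prod_encode_2 order_trans by blast+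
  with Conj.IH show ?case by simp
next
  case (SetEq s t)
  have "prod_encode (trm_code s, trm_code t) \<le> n"
    using SetEq le_prod_encode_2 by (metis fm_code.simps(1) order_trans)
  then have "trm_code s \<le> n" "trm_code t \<le> n"
    using le_prod_encode_1 le_prod_encode_2 order_trans by blast+
  then show ?case by (simp add: trm_bound)
next
  case (SetMem s t)
  have "prod_encode (trm_code s, trm_code t) \<le> n"
    using SetMem le_prod_encode_2 by (metis fm_code.simps(2) order_trans)
  then have "trm_code s \<le> n" "trm_code t \<le> n"
    using le_prod_encode_1 le_prod_encode_2 order_trans by blast+
  then show ?case by (simp add: trm_bound)
next
  case (ClsEq s t)
  have "prod_encode (trm_code s, trm_code t) \<le> n"
    using ClsEq le_prod_encode_2 by (metis fm_code.simps(3) order_trans)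
  then have "trm_code s \<le> n" "trm_code t \<le> n"
    using le_prod_encode_1 le_prod_encode_2 order_trans by blast+
  then show ?case by (simp add: trm_bound)
next
  case (ClsMem s t)
  have "prod_encode (trm_code s, trm_code t) \<le> n"
    using ClsMem le_prod_encode_2 by (metis fm_code.simps(4) order_trans)
  then have "trm_code s \<le> n" "trm_code t \<le> n"
    using le_prod_encode_1 le_prod_encode_2 order_trans by blast+
  then show ?case by (simp add: trm_bound)
qed

text \<open>\<open>drop_var\<close> on codes: the tags 6, 4, 5 and 4 spell
  \<open>AllSet (Neg (Conj ... (Neg ...)))\<close>, the two zeros are the tag of
  \<open>SetEq\<close> and the code of \<open>Var 0\<close>, and the doubled sum is the code of the
  second variable.\<close>

definition drop_code :: "nat \<Rightarrow> nat \<Rightarrow> nat" where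
  "drop_code k c = rec_nat c (\<lambda>j y. prod_encode (6, prod_encode (4, prod_encode (5, prod_encode
     (prod_encode (0, prod_encode (0, (skip k j + (Suc c - j)) + (skip k j + (Suc c - j)))),
      prod_encode (4, y)))))) (Suc c)"

lemma fm_code_drop_var: "fm_code (drop_var k \<psi>) = drop_code k (fm_code \<psi>)"
proof -
  have "fm_code (rename_upto k n \<psi> m) = rec_nat (fm_code \<psi>) (\<lambda>j y. prod_encode (6, prod_encode (4, prod_encode (5, prod_encode
     (prod_encode (0, prod_encode (0, (skip k j + (n - j)) + (skip k j + (n - j)))),
      prod_encode (4, y)))))) m" for n m
    by (induction m) (simp_all add: mult_2)
  then show ?thesis by (simp only: drop_var_def drop_code_def)
qed

lemma computable_drop_code:
  assumes "computable A k h" shows "computable A k (\<lambda>e. drop_code i (h e))"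
proof -
  have h: "computable A (Suc (Suc k)) (\<lambda>e. h (\<lambda>i. e (Suc (Suc i))))"
    using computable_compose[OF assms, of "Suc (Suc k)" "\<lambda>i e. e (Suc (Suc i))"]
    by (simp add: computable_var)
  have skip: "computable A (Suc (Suc k)) (\<lambda>e. skip i (e 0))"
    unfolding skip_def by (rule computable_if decidable_less computable_var computable_const computable_Suc | simp)+
  show ?thesis unfolding drop_code_def
    by (rule computable_rec[where m="\<lambda>e. Suc (h e)", OF assms])
     (rule computable_prod_encode computable_add computable_diff computable_const computable_Suc h skip computable_var assms zero_less_Suc Suc_mono lessI | simp)+
qed

text \<open>The invariant of the capture. When the quantifiers for the entries \<open>n - 1\<close>
  down to \<open>j\<close> have been passed, the environment starts with copies of the entries
  \<open>skip k j\<close>, ..., \<open>skip k (n - 1)\<close> and continues with the old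
  environment, shifted by their number \<open>n - j\<close>. This shift is also the source of the
  index in \<open>rename_upto\<close>.\<close>

lemma rename_upto:
  assumes "Sets M = UNIV" "j \<le> n"
  shows "sat M (\<lambda>i. if i < n - j then e (skip k (j + i)) else e (i - (n - j))) E (rename_upto k n \<psi> j) \<longleftrightarrow>
    sat M (\<lambda>i. if i < n then e (skip k i) else e (i - n)) E \<psi>"
  using assms(2)
proof (induction j)
  case (Suc j)
  let ?f = "\<lambda>j i. if i < n - j then e (skip k (j + i)) else e (i - (n - j))"
  have eq: "?f (Suc j) (skip k j + (n - Suc j)) = e (skip k j)" by simp
  have shift: "case_nat (e (skip k j)) (?f (Suc j)) = ?f j"
  proof
    fix i show "case_nat (e (skip k j)) (?f (Suc j)) i = ?f j i"
      using Suc.prems by (cases i) auto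
  qed
  have idx: "skip k j + (n - j) = Suc (skip k j + (n - Suc j))" using Suc.prems by simp
  have "sat M (?f (Suc j)) E (rename_upto k n \<psi> (Suc j)) \<longleftrightarrow>
      sat M (case_nat (e (skip k j)) (?f (Suc j))) E (rename_upto k n \<psi> j)"
    unfolding rename_upto.simps idx using eq assms(1) by simp
  with Suc show ?case unfolding shift by simp
qed (simp only: diff_zero add_0 rename_upto.simps)

lemma sat_drop_var:
  assumes "Sets M = UNIV"
  shows "sat M e E (drop_var k \<psi>) \<longleftrightarrow> sat M (\<lambda>i. e (skip k i)) E \<psi>"
proof -
  let ?n = "Suc (fm_code \<psi>)"
  have "sat M e E (drop_var k \<psi>) \<longleftrightarrow> sat M (\<lambda>i. if i < ?n then e (skip k i) else e (i - ?n)) E \<psi>"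
    using rename_upto[OF assms order_refl, of ?n e k E \<psi>] by (simp add: drop_var_def)
  also have "\<dots> \<longleftrightarrow> sat M (\<lambda>i. e (skip k i)) E \<psi>"
    by (rule sat_cong[OF closed_fm_code[OF order_refl]]) auto
  finally show ?thesis .
qed

fun tlift :: "nat \<Rightarrow> ('a \<Rightarrow> 'b) \<Rightarrow> 'a trm \<Rightarrow> 'b trm" where
  "tlift d r (Var n) = Var (n + d)"
| "tlift d r (Par a) = Par (r a)"

lemma tval_tlift: "tval e (tlift d r t) = tval (\<lambda>n. e (n + d)) (map_trm r t)"
  by (cases t) auto

text \<open>Even codes are variables and odd codes parameters: a shift by \<open>d\<close> adds
  \<open>2 * d\<close>, and the parameter \<open>c div 2\<close> is mapped by \<open>r\<close> and
  coded again.\<close>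

definition tlift_code :: "nat \<Rightarrow> (nat \<Rightarrow> nat) \<Rightarrow> nat \<Rightarrow> nat" where
  "tlift_code d r c = (if c mod 2 = 0 then c + 2 * d else r (c div 2) + r (c div 2) + 1)"

lemma trm_code_tlift: "trm_code (tlift d r t) = tlift_code d r (trm_code t)"
  by (cases t) (auto simp: tlift_code_def)

lemma computable_tlift_code:
  assumes "computable A 1 (\<lambda>e. r (e 0))" "computable A k h"
  shows "computable A k (\<lambda>e. tlift_code d r (h e))"
  unfolding tlift_code_def
  by (rule computable_if decidable_eq_0 computable_mod_2 computable_add computable_const
      computable_comp1[OF assms(1)] computable_div_2 assms(2))+

text \<open>
  In \<open>trans \<phi>\<close> the set variable \<open>0\<close> is the condition and the set variables of \<open>\<phi>\<close> are shifted by one.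
  The constants \<open>LE\<close>, \<dots> stand for formulas with these meanings of their variables, the last bound one
  being \<open>0\<close>.
\<close>

locale forcing_translation =
  fixes LE NAME CNAME FEQ FMEM FCEQ FCMEM :: "(nat, nat) fm" and rs rc :: "nat \<Rightarrow> nat"
begin

text \<open>The offsets count what stands in front of the variables of the formula: the condition
  and the quantifiers just added, so 2 and then 3 for sets, but 1 and then 2 for classes, where
  there is no condition. In \<open>Neg\<close> the old condition has index 1 and is dropped. In
  \<open>AllSet\<close> the name comes before the condition, so a copy of the condition is put in
  front and the original, now at index 2, is dropped.\<close>

primrec trans :: "(nat, nat) fm \<Rightarrow> (nat, nat) fm" where
  "trans (SetEq s t) = AllSet (Imp (SetEq (Var 0) (tlift 2 rs s)) (AllSet (Imp (SetEq (Var 0) (tlift 3 rs t)) FEQ)))"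
| "trans (SetMem s t) = AllSet (Imp (SetEq (Var 0) (tlift 2 rs s)) (AllSet (Imp (SetEq (Var 0) (tlift 3 rs t)) FMEM)))"
| "trans (ClsEq S T) = AllCls (Imp (ClsEq (Var 0) (tlift 1 rc S)) (AllCls (Imp (ClsEq (Var 0) (tlift 2 rc T)) FCEQ)))"
| "trans (ClsMem s T) = AllSet (Imp (SetEq (Var 0) (tlift 2 rs s)) (AllCls (Imp (ClsEq (Var 0) (tlift 1 rc T)) FCMEM)))"
| "trans (Neg \<phi>) = AllSet (Neg (Conj LE (drop_var 1 (trans \<phi>))))"
| "trans (Conj \<phi> \<psi>) = Conj (trans \<phi>) (trans \<psi>)"
| "trans (AllSet \<phi>) = AllSet (Imp NAME (AllSet (Imp (SetEq (Var 0) (Var 2)) (drop_var 2 (trans \<phi>)))))"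
| "trans (AllCls \<phi>) = AllCls (Imp CNAME (trans \<phi>))"

lemma computable_trans:
  assumes rs: "computable A 1 (\<lambda>e. rs (e 0))" and rc: "computable A 1 (\<lambda>e. rc (e 0))"
    and \<Phi>: "computable A k (\<lambda>e. fm_code (\<Phi> e))"
  shows "computable A k (\<lambda>e. fm_code (trans (\<Phi> e)))"
proof -
  let ?tag = "\<lambda>n. fst (prod_decode n)" and ?body = "\<lambda>n. snd (prod_decode n)"
  let ?f = "\<lambda>n. fst (prod_decode (?body n))" and ?g = "\<lambda>n. snd (prod_decode (?body n))"
  let ?all = "\<lambda>u. prod_encode (6, u)" and ?allc = "\<lambda>u. prod_encode (7, u)"
  let ?conj = "\<lambda>u v. prod_encode (5, prod_encode (u, v))"
  let ?neg = "\<lambda>u. prod_encode (4, u)"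
  let ?imp = "\<lambda>u v. ?neg (?conj u (?neg v))"
  let ?eq = "\<lambda>t. prod_encode (0, prod_encode (0, t))" and ?eqc = "\<lambda>t. prod_encode (2, prod_encode (0, t))"
  \<comment> \<open>\<open>H\<close> repeats the clauses of \<open>trans\<close> on codes, with
    \<open>u\<close> and \<open>v\<close> for the values at the subformulas. In
    \<open>?eq 4\<close>, the number 4 is the code of \<open>Var 2\<close>.\<close>
  define H where "H n u v =
    (if ?tag n = 0 then ?all (?imp (?eq (tlift_code 2 rs (?f n))) (?all (?imp (?eq (tlift_code 3 rs (?g n))) (fm_code FEQ))))
     else if ?tag n = 1 then ?all (?imp (?eq (tlift_code 2 rs (?f n))) (?all (?imp (?eq (tlift_code 3 rs (?g n))) (fm_code FMEM))))
     else if ?tag n = 2 then ?allc (?imp (?eqc (tlift_code 1 rc (?f n))) (?allc (?imp (?eqc (tlift_code 2 rc (?g n))) (fm_code FCEQ))))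
     else if ?tag n = 3 then ?all (?imp (?eq (tlift_code 2 rs (?f n))) (?allc (?imp (?eqc (tlift_code 1 rc (?g n))) (fm_code FCMEM))))
     else if ?tag n = 4 then ?all (?neg (?conj (fm_code LE) (drop_code 1 u)))
     else if ?tag n = 5 then ?conj u v
     else if ?tag n = 6 then ?all (?imp (fm_code NAME) (?all (?imp (?eq 4) (drop_code 2 u))))
     else ?allc (?imp (fm_code CNAME) u))" for n u v
  \<comment> \<open>A conjunction has the codes of its parts paired in the body, while for
    \<open>Neg\<close> and the quantifiers the body is itself the code of the subformula.\<close>
  let ?a = "\<lambda>n. if ?tag n = 5 then ?f n else ?body n"
  have H: "computable A 3 (\<lambda>e. H (e 0) (e 1) (e 2))"
    unfolding H_def
    by (rule computable_if decidable_eq computable_prod_encode computable_tlift_code[OF rs] computable_tlift_code[OF rc]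
       computable_drop_code computable_prod_decode computable_const computable_var | simp)+
  have a: "computable A 1 (\<lambda>e. ?a (e 0))"
    by (rule computable_if decidable_eq computable_prod_decode computable_const computable_var | simp)+
  have b: "computable A 1 (\<lambda>e. ?g (e 0))"
    by (rule computable_prod_decode computable_const computable_var | simp)+
  obtain T where T: "computable A 1 (\<lambda>e. T (e 0))"
    and T_rec: "\<And>n. T n = H n (if ?a n < n then T (?a n) else 0) (if ?g n < n then T (?g n) else 0)"
    by (rule course_of_values[OF H a b]) blast
  \<comment> \<open>Look-ups must go strictly back, which a positive tag ensures; all formulas with
    subformulas have tags from 4 on.\<close>
  have less: "c < prod_encode (m, c)" if "0 < m" for m c
  proof -
    have "k \<le> triangle k" for k by (induction k) auto
    from this[of "m + c"] that show ?thesis by (simp add: prod_encode_def)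
  qed
  have "T (fm_code \<phi>) = fm_code (trans \<phi>)" for \<phi>
  proof (induction \<phi>)
    case (Conj \<phi> \<psi>)
    have "prod_encode (fm_code \<phi>, fm_code \<psi>) < fm_code (Conj \<phi> \<psi>)" by (simp add: less)
    then have "fm_code \<phi> < fm_code (Conj \<phi> \<psi>)" "fm_code \<psi> < fm_code (Conj \<phi> \<psi>)"
      using le_prod_encode_1 le_prod_encode_2 le_less_trans by blast+
    then show ?case using Conj T_rec[of "fm_code (Conj \<phi> \<psi>)"] by (simp add: H_def)
  next
    case (Neg \<phi>)
    then show ?case using T_rec[of "fm_code (Neg \<phi>)"] by (simp add: H_def less fm_code_drop_var)
  next
    case (AllSet \<phi>)
    then show ?case using T_rec[of "fm_code (AllSet \<phi>)"] by (simp add: H_def less fm_code_drop_var)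
  next
    case (AllCls \<phi>)
    then show ?case using T_rec[of "fm_code (AllCls \<phi>)"] by (simp add: H_def less)
  next
    case (SetEq s t)
    show ?case using T_rec[of "fm_code (SetEq s t)"] by (simp add: H_def trm_code_tlift)
  next
    case (SetMem s t)
    show ?case using T_rec[of "fm_code (SetMem s t)"] by (simp add: H_def trm_code_tlift)
  next
    case (ClsEq s t)
    show ?case using T_rec[of "fm_code (ClsEq s t)"] by (simp add: H_def trm_code_tlift)
  next
    case (ClsMem s t)
    show ?case using T_rec[of "fm_code (ClsMem s t)"] by (simp add: H_def trm_code_tlift)
  qed
  then show ?thesis using computable_comp1[OF T \<Phi>] by simp
qed

end

text \<open>By \<open>closed_fm_code\<close> this many quantifiers of either sort close any formula.
  The free variables themselves need not be computed.\<close>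

definition univ_closure :: "(nat, nat) fm \<Rightarrow> (nat, nat) fm" where
  "univ_closure \<phi> = (AllSet ^^ Suc (fm_code \<phi>)) ((AllCls ^^ Suc (fm_code \<phi>)) \<phi>)"

lemma computable_code_funpow:
  assumes g: "\<And>\<phi>. fm_code (F \<phi>) = prod_encode (c, fm_code \<phi>)"
    and "computable A k (\<lambda>e. fm_code (\<Phi> e))" "computable A k h"
  shows "computable A k (\<lambda>e. fm_code ((F ^^ h e) (\<Phi> e)))"
proof -
  have eq: "fm_code ((F ^^ n) \<phi>) = rec_nat (fm_code \<phi>) (\<lambda>i y. prod_encode (c, y)) n" for n \<phi>
    by (induction n) (simp_all add: g)
  show ?thesis unfolding eq
    by (rule computable_rec[where s="\<lambda>n y e. prod_encode (c, y)"])
      (rule assms computable_prod_encode computable_const computable_var | simp)+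
qed

lemma computable_code_univ_closure:
  assumes "computable A k (\<lambda>e. fm_code (\<Phi> e))"
  shows "computable A k (\<lambda>e. fm_code (univ_closure (\<Phi> e)))"
  unfolding univ_closure_def
  by (intro computable_code_funpow[where c=6] computable_code_funpow[where c=7] computable_Suc assms) simp_all

lemma closed_univ_closure: "closed_fm 0 0 (univ_closure \<phi>)"
proof -
  have "closed_fm k (l - n) ((AllCls ^^ n) \<phi>)" if "closed_fm k l \<phi>" for k l n \<phi>
    using that by (induction n) (auto intro: closed_fm_mono simp: Suc_diff_le diff_Suc split: nat.split)
  moreover have "closed_fm (k - n) l ((AllSet ^^ n) \<phi>)" if "closed_fm k l \<phi>" for k l n \<phi>
    using that by (induction n) (auto intro: closed_fm_mono simp: diff_Suc split: nat.split)
  ultimately show ?thesis unfolding univ_closure_def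
    using closed_fm_code[OF order_refl, of \<phi>] by (metis diff_self_eq_0)
qed

section \<open>A computable generic sequence\<close>

lemma sat_univ_closure:
  assumes M: "Sets M = UNIV" "Classes M = UNIV"
    and const: "\<And>e E e' E'. sat M e E \<phi> = sat M e' E' \<phi>"
  shows "sat M e E (univ_closure \<phi>) \<longleftrightarrow> sat M e E \<phi>"
proof -
  have "\<forall>e E. sat M e E ((AllCls ^^ n) \<psi>) \<longleftrightarrow> sat M e0 E0 \<psi>"
    if "\<And>e E. sat M e E \<psi> \<longleftrightarrow> sat M e0 E0 \<psi>" for n \<psi> e0 E0
    using that by (induction n) (simp_all add: M)
  moreover have "\<forall>e E. sat M e E ((AllSet ^^ n) \<psi>) \<longleftrightarrow> b" if "\<And>e E. sat M e E \<psi> \<longleftrightarrow> b" for n \<psi> b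
    using that by (induction n) (simp_all add: M)
  ultimately show ?thesis unfolding univ_closure_def using const by metis
qed

lemma so_diagram_iff:
  assumes M: "Sets M = UNIV" "Classes M = UNIV"
  shows "fm_code \<phi> \<in> so_diagram M \<longleftrightarrow> closed_fm 0 0 \<phi> \<and> sat M e E \<phi>"
proof -
  have "sat M e E \<phi> = sat M e' E' \<phi>" if "closed_fm 0 0 \<phi>" for e' E'
    by (rule sat_cong[OF that]) simp_all
  then show ?thesis
    by (auto simp: so_diagram_def fm_code_inject language_def M)
qed

definition closed_code :: "nat \<Rightarrow> nat \<Rightarrow> bool" where
  "closed_code i n \<longleftrightarrow> (\<exists>\<phi>. fm_code \<phi> = n \<and> closed_fm i 0 \<phi>)"

text \<open>Every number is made to stand for a formula, with a true sentence as default for numbers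
  that code none. This gives a total enumeration of the formulas in one set variable
  (\<open>i = 1\<close>) and of the sentences (\<open>i = 0\<close>).\<close>

definition fm_of :: "nat \<Rightarrow> nat \<Rightarrow> (nat, nat) fm" where
  "fm_of i n = (if closed_code i n then SOME \<phi>. fm_code \<phi> = n \<and> closed_fm i 0 \<phi> else SetEq (Par 0) (Par 0))"

lemma fm_of:
  "closed_fm i 0 (fm_of i n)"
  "fm_code (fm_of i n) = (if closed_code i n then n else fm_code (SetEq (Par 0) (Par 0)))"
proof -
  have "fm_code (fm_of i n) = n \<and> closed_fm i 0 (fm_of i n)" if "closed_code i n"
    using someI_ex[OF that[unfolded closed_code_def]] that by (simp add: fm_of_def)
  then show "closed_fm i 0 (fm_of i n)"
    "fm_code (fm_of i n) = (if closed_code i n then n else fm_code (SetEq (Par 0) (Par 0)))"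
    by (cases "closed_code i n"; simp add: fm_of_def)+
qed

lemma fm_of_code: "closed_fm i 0 \<phi> \<Longrightarrow> fm_of i (fm_code \<phi>) = \<phi>"
  using fm_of(2)[of i "fm_code \<phi>"] by (auto simp: closed_code_def fm_code_inject split: if_splits)

text \<open>The oracle recognises sentences only, so the free variable is bound by
  \<open>AllSet\<close>, whose tag is 6.\<close>

lemma closed_code_1: "closed_code 1 n \<longleftrightarrow> closed_code 0 (prod_encode (6, n))"
proof
  assume "closed_code 1 n"
  then obtain \<phi> where "fm_code \<phi> = n" "closed_fm 1 0 \<phi>" by (auto simp: closed_code_def)
  then show "closed_code 0 (prod_encode (6, n))"
    unfolding closed_code_def by (intro exI[of _ "AllSet \<phi>"]) simp
next
  assume "closed_code 0 (prod_encode (6, n))"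
  then obtain \<phi> where "fm_code \<phi> = prod_encode (6, n)" "closed_fm 0 0 \<phi>" by (auto simp: closed_code_def)
  then show "closed_code 1 n" unfolding closed_code_def by (cases \<phi>) auto
qed

text \<open>The oracle recognises codes of sentences: \<open>n\<close> is one iff \<open>taut_code n\<close> codes a true sentence.\<close>

definition taut_code :: "nat \<Rightarrow> nat" where
  "taut_code n = prod_encode (4, prod_encode (5, prod_encode (n, prod_encode (4, n))))"

lemma closed_code_0:
  assumes M: "Sets M = UNIV" "Classes M = UNIV"
  shows "closed_code 0 n \<longleftrightarrow> taut_code n \<in> so_diagram M"
proof
  assume "closed_code 0 n"
  then obtain \<phi> where "fm_code \<phi> = n" "closed_fm 0 0 \<phi>" by (auto simp: closed_code_def)
  then have "taut_code n = fm_code (Neg (Conj \<phi> (Neg \<phi>)))" "closed_fm 0 0 (Neg (Conj \<phi> (Neg \<phi>)))"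
    by (simp_all add: taut_code_def)
  moreover have "sat M e E (Neg (Conj \<phi> (Neg \<phi>)))" for e E by simp
  ultimately show "taut_code n \<in> so_diagram M" using so_diagram_iff[OF M] by metis
next
  assume "taut_code n \<in> so_diagram M"
  then obtain \<chi> where \<chi>: "taut_code n = fm_code \<chi>" "closed_fm 0 0 \<chi>" by (auto simp: so_diagram_def)
  then obtain \<chi>' where \<chi>': "\<chi> = Neg \<chi>'" by (cases \<chi>) (auto simp: taut_code_def)
  with \<chi> obtain \<phi> \<psi> where "\<chi>' = Conj \<phi> \<psi>" by (cases \<chi>') (auto simp: taut_code_def)
  with \<chi> \<chi>' show "closed_code 0 n" by (auto simp: taut_code_def closed_code_def)
qed

lemma decidable_closed_code:
  assumes M: "Sets M = UNIV" "Classes M = UNIV" and h: "computable (so_diagram M) k h"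
  shows "decidable (so_diagram M) k (\<lambda>e. closed_code 0 (h e))" "decidable (so_diagram M) k (\<lambda>e. closed_code 1 (h e))"
  unfolding closed_code_1 closed_code_0[OF M] taut_code_def
  by (intro decidable_oracle computable_prod_encode computable_const h)+

lemma computable_fm_of:
  assumes M: "Sets M = UNIV" "Classes M = UNIV" and h: "computable (so_diagram M) k h"
  shows "computable (so_diagram M) k (\<lambda>e. fm_code (fm_of 0 (h e)))" "computable (so_diagram M) k (\<lambda>e. fm_code (fm_of 1 (h e)))"
  unfolding fm_of(2) by (intro computable_if computable_const decidable_closed_code M h)+

lemma decidable_sat:
  assumes M: "Sets M = UNIV" "Classes M = UNIV"
    and \<Phi>: "computable (so_diagram M) k (\<lambda>e. fm_code (\<Phi> e))"
    and const: "\<And>x e E e' E'. sat M e E (\<Phi> x) = sat M e' E' (\<Phi> x)"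
  shows "decidable (so_diagram M) k (\<lambda>x. sat M e E (\<Phi> x))"
proof -
  have "sat M e E (\<Phi> x) \<longleftrightarrow> fm_code (univ_closure (\<Phi> x)) \<in> so_diagram M" for x
    unfolding so_diagram_iff[OF M, of _ e E] using sat_univ_closure[OF M const] closed_univ_closure by blast
  then show ?thesis
    using decidable_oracle[OF computable_code_univ_closure[OF \<Phi>]] by simp
qed

locale coded_forcing = class_forcing M P L FE FI for M :: "(nat, nat) struct" and P L FE FI
begin

abbreviation "A \<equiv> so_diagram M"
abbreviation "z \<equiv> (\<lambda>_::nat. 0::nat)"

text \<open>The choice is not effective and need not be: it is made for finitely many fixed
  properties, and the resulting codes are built into programs as constants.\<close>

definition formula_for :: "((nat \<Rightarrow> nat) \<Rightarrow> (nat \<Rightarrow> nat) \<Rightarrow> bool) \<Rightarrow> (nat, nat) fm" where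
  "formula_for Q = (SOME \<phi>. \<forall>e E. sat M e E \<phi> \<longleftrightarrow> Q e E)"

lemma sat_formula_for:
  assumes "definable M False k l Q"
  shows "sat M e E (formula_for Q) \<longleftrightarrow> Q e E"
proof -
  have "\<exists>\<phi>. \<forall>e E. sat M e E \<phi> \<longleftrightarrow> Q e E" using assms by (auto simp: definable_def)
  from someI_ex[OF this] show ?thesis by (simp add: formula_for_def)
qed

definition "LE = formula_for (\<lambda>e E. e 0 \<in> Cond \<and> e 0 \<preceq> e (Suc 0))"
definition "NAME = formula_for (\<lambda>e E. e 0 \<in> Names)"
definition "CNAME = formula_for (\<lambda>e E. E 0 \<in> CNames)"
definition "FEQ = formula_for (\<lambda>e E. crel3 M FE (e (Suc (Suc 0))) (e (Suc 0)) (e 0))"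
definition "FMEM = formula_for (\<lambda>e E. crel3 M FI (e (Suc (Suc 0))) (e (Suc 0)) (e 0))"
definition "FCEQ = formula_for (\<lambda>e E. forces_class_eq M P L FE (e 0) (E (Suc 0)) (E 0))"
definition "FCMEM = formula_for (\<lambda>e E. forces_class_mem M P L FE (e (Suc 0)) (e 0) (E 0))"

lemma sat_LE: "sat M e E LE \<longleftrightarrow> e 0 \<in> Cond \<and> e 0 \<preceq> e (Suc 0)"
proof -
  have "definable M False 2 0 (\<lambda>e E. e 0 \<in> Cond \<and> e 0 \<preceq> e (Suc 0))"
    unfolding Cond_iff by (rule definable_intros | simp)+
  then show ?thesis unfolding LE_def by (rule sat_formula_for)
qed

lemma sat_NAME: "sat M e E NAME \<longleftrightarrow> e 0 \<in> Names"
proof -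
  obtain V where V: "\<And>\<sigma>. \<sigma> \<in> Names \<longleftrightarrow> cmem M \<sigma> V" using ex_class_set_names[of P] by blast
  have "definable M False 1 0 (\<lambda>e E. e 0 \<in> Names)"
    unfolding V by (rule definable_intros | simp)+
  then show ?thesis unfolding NAME_def by (rule sat_formula_for)
qed

lemma sat_CNAME: "sat M e E CNAME \<longleftrightarrow> E 0 \<in> CNames"
proof -
  obtain V where V: "\<And>\<sigma>. \<sigma> \<in> Names \<longleftrightarrow> cmem M \<sigma> V" using ex_class_set_names[of P] by blast
  have "definable M False 0 1 (\<lambda>e E. E 0 \<in> CNames)"
    unfolding class_names_iff V by (rule definable_intros | simp)+
  then show ?thesis unfolding CNAME_def by (rule sat_formula_for)
qed

lemma sat_FEQ: "sat M e E FEQ \<longleftrightarrow> crel3 M FE (e (Suc (Suc 0))) (e (Suc 0)) (e 0)"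
proof -
  have "definable M False 3 0 (\<lambda>e E. crel3 M FE (e (Suc (Suc 0))) (e (Suc 0)) (e 0))"
    by (rule definable_intros | simp)+
  then show ?thesis unfolding FEQ_def by (rule sat_formula_for)
qed

lemma sat_FMEM: "sat M e E FMEM \<longleftrightarrow> crel3 M FI (e (Suc (Suc 0))) (e (Suc 0)) (e 0)"
proof -
  have "definable M False 3 0 (\<lambda>e E. crel3 M FI (e (Suc (Suc 0))) (e (Suc 0)) (e 0))"
    by (rule definable_intros | simp)+
  then show ?thesis unfolding FMEM_def by (rule sat_formula_for)
qed

text \<open>Sets of entries consist of external pairs, over which no formula quantifies. Spelled out
  with separate quantifiers and the class \<open>V\<close> of names, the clause fits the
  definability rules.\<close>

lemma forces_class_mem_unfold:
  assumes "\<And>\<sigma>. \<sigma> \<in> Names \<longleftrightarrow> cmem M \<sigma> V"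
  shows "forces_class_mem M P L FE p \<sigma> \<Gamma> \<longleftrightarrow> (\<forall>p'\<in>Cond. p' \<preceq> p \<longrightarrow> (\<exists>q\<in>Cond. q \<preceq> p' \<and>
    (\<exists>\<rho>. \<exists>r\<in>Cond. cmem M \<rho> V \<and> crel2 M \<Gamma> \<rho> r \<and> q \<preceq> r \<and> crel3 M FE q \<sigma> \<rho>)))"
  unfolding forces_class_mem_def mem_clause_def class_entries_def using assms by (auto, blast+)

lemma forces_class_eq_unfold:
  assumes "\<And>\<sigma>. \<sigma> \<in> Names \<longleftrightarrow> cmem M \<sigma> V"
  shows "forces_class_eq M P L FE p \<Gamma> \<Delta> \<longleftrightarrow>
    (\<forall>\<rho>. \<forall>r\<in>Cond. cmem M \<rho> V \<and> crel2 M \<Gamma> \<rho> r \<longrightarrow>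
      (\<forall>q\<in>Cond. q \<preceq> p \<longrightarrow> q \<preceq> r \<longrightarrow> forces_class_mem M P L FE q \<rho> \<Delta>)) \<and>
    (\<forall>\<rho>. \<forall>r\<in>Cond. cmem M \<rho> V \<and> crel2 M \<Delta> \<rho> r \<longrightarrow>
      (\<forall>q\<in>Cond. q \<preceq> p \<longrightarrow> q \<preceq> r \<longrightarrow> forces_class_mem M P L FE q \<rho> \<Gamma>))"
  unfolding forces_class_eq_def subset_clause_def class_entries_def using assms by auto

lemma sat_FCMEM: "sat M e E FCMEM \<longleftrightarrow> forces_class_mem M P L FE (e (Suc 0)) (e 0) (E 0)"
proof -
  obtain V where V: "\<And>\<sigma>. \<sigma> \<in> Names \<longleftrightarrow> cmem M \<sigma> V" using ex_class_set_names[of P] by blast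
  have "definable M False 2 1 (\<lambda>e E. forces_class_mem M P L FE (e (Suc 0)) (e 0) (E 0))"
    unfolding forces_class_mem_unfold[OF V] by (rule definable_intros | simp)+
  then show ?thesis unfolding FCMEM_def by (rule sat_formula_for)
qed

lemma sat_FCEQ: "sat M e E FCEQ \<longleftrightarrow> forces_class_eq M P L FE (e 0) (E (Suc 0)) (E 0)"
proof -
  obtain V where V: "\<And>\<sigma>. \<sigma> \<in> Names \<longleftrightarrow> cmem M \<sigma> V" using ex_class_set_names[of P] by blast
  have "definable M False 1 2 (\<lambda>e E. forces_class_eq M P L FE (e 0) (E (Suc 0)) (E 0))"
    unfolding forces_class_eq_unfold[OF V] forces_class_mem_unfold[OF V] by (rule definable_intros | simp)+
  then show ?thesis unfolding FCEQ_def by (rule sat_formula_for)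
qed

abbreviation trans :: "(nat \<Rightarrow> nat) \<Rightarrow> (nat \<Rightarrow> nat) \<Rightarrow> (nat, nat) fm \<Rightarrow> (nat, nat) fm" where
  "trans \<equiv> forcing_translation.trans LE NAME CNAME FEQ FMEM FCEQ FCMEM"

lemma sat_trans: "sat M (case_nat p e) E (trans rs rc \<phi>) \<longleftrightarrow> forces rs rc p e E \<phi>"
proof (induction \<phi> arbitrary: p e E)
  case (Neg \<phi>)
  have "(\<lambda>i. case_nat q (case_nat p e) (skip 1 i)) = case_nat q e" for q
    by (rule HOL.ext) (auto simp: skip_def split: nat.split)
  then show ?case using Neg
    by (auto simp: forcing_translation.trans.simps sat_drop_var[OF Sets_UNIV] sat_LE Sets_UNIV)
next
  case (AllSet \<phi>)
  have "(\<lambda>i. case_nat q (case_nat \<sigma> (case_nat p e)) (skip 2 i)) = case_nat q (case_nat \<sigma> e)" for q \<sigma>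
    by (rule HOL.ext) (auto simp: skip_def split: nat.split)
  then show ?case using AllSet
    by (auto simp: forcing_translation.trans.simps sat_drop_var[OF Sets_UNIV] sat_NAME Sets_UNIV numeral_2_eq_2)
qed (auto simp: forcing_translation.trans.simps sat_CNAME sat_FEQ sat_FMEM sat_FCEQ sat_FCMEM Sets_UNIV
  Classes_UNIV tval_tlift numeral_2_eq_2 numeral_3_eq_3)

lemma expressible: "\<exists>\<psi>. \<forall>p e E. sat M (case_nat p e) E \<psi> \<longleftrightarrow> forces rs rc p e E (\<phi> :: (nat, nat) fm)"
  by (rule exI[of _ "trans rs rc \<phi>"]) (intro allI sat_trans)

section \<open>Questions about conditions, put to the oracle\<close>

abbreviation holds :: "(nat, nat) fm \<Rightarrow> nat \<Rightarrow> bool" where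
  "holds \<psi> p \<equiv> sat M (case_nat p z) z \<psi>"

text \<open>The equation places \<open>p\<close> in the environment without substitution. Under
  \<open>ExSet\<close>, \<open>LE\<close> finds the extension at index 0 and \<open>p\<close> at
  index 1; \<open>\<psi>\<close> is meant to depend on index 0 alone.\<close>

definition ext_fm :: "(nat, nat) fm \<Rightarrow> nat \<Rightarrow> (nat, nat) fm" where
  "ext_fm \<psi> p = AllSet (Imp (SetEq (Var 0) (Par p)) (ExSet (Conj LE \<psi>)))"

definition ext_at_fm :: "(nat, nat) fm \<Rightarrow> nat \<Rightarrow> nat \<Rightarrow> (nat, nat) fm" where
  "ext_at_fm \<psi> p q = AllSet (Imp (SetEq (Var 0) (Par p)) (AllSet (Imp (SetEq (Var 0) (Par q)) (Conj LE \<psi>))))"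

context
  fixes \<psi> :: "(nat, nat) fm"
  assumes const: "\<And>p e E e' E'. sat M (case_nat p e) E \<psi> = sat M (case_nat p e') E' \<psi>"
begin

lemma sat_ext_fm: "sat M e E (ext_fm \<psi> p) \<longleftrightarrow> (\<exists>q\<in>Cond. q \<preceq> p \<and> holds \<psi> q)"
  using const[of _ "case_nat p e" E z z] by (auto simp: ext_fm_def Sets_UNIV sat_LE)

lemma sat_ext_at_fm: "sat M e E (ext_at_fm \<psi> p q) \<longleftrightarrow> q \<in> Cond \<and> q \<preceq> p \<and> holds \<psi> q"
  using const[of _ "case_nat p e" E z z] by (auto simp: ext_at_fm_def Sets_UNIV sat_LE)

lemma sat_at_fm: "sat M e E (AllSet (Imp (SetEq (Var 0) (Par p)) \<psi>)) \<longleftrightarrow> holds \<psi> p"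
  using const[of _ e E z z] by (auto simp: Sets_UNIV)

end

lemma decidable_ext:
  assumes const: "\<And>x p e E e' E'. sat M (case_nat p e) E (\<Psi> x) = sat M (case_nat p e') E' (\<Psi> x)"
    and \<Psi>: "computable A k (\<lambda>e. fm_code (\<Psi> e))" and p: "computable A k p" and q: "computable A k q"
  shows "decidable A k (\<lambda>x. \<exists>q\<in>Cond. q \<preceq> p x \<and> holds (\<Psi> x) q)"
    "decidable A k (\<lambda>x. q x \<in> Cond \<and> q x \<preceq> p x \<and> holds (\<Psi> x) (q x))"
    "decidable A k (\<lambda>x. holds (\<Psi> x) (p x))"
proof -
  have "decidable A k (\<lambda>x. sat M z z (ext_fm (\<Psi> x) (p x)))"
  proof (rule decidable_sat[OF Sets_UNIV Classes_UNIV])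
    show "computable A k (\<lambda>e. fm_code (ext_fm (\<Psi> e) (p e)))"
      unfolding ext_fm_def by (intro computable_code_intros computable_const \<Psi> p)
    show "sat M e E (ext_fm (\<Psi> x) (p x)) = sat M e' E' (ext_fm (\<Psi> x) (p x))" for x e E e' E'
      using sat_ext_fm[of "\<Psi> x", OF const] by simp
  qed
  then show "decidable A k (\<lambda>x. \<exists>q\<in>Cond. q \<preceq> p x \<and> holds (\<Psi> x) q)"
    using sat_ext_fm[OF const] by simp
  have "decidable A k (\<lambda>x. sat M z z (ext_at_fm (\<Psi> x) (p x) (q x)))"
  proof (rule decidable_sat[OF Sets_UNIV Classes_UNIV])
    show "computable A k (\<lambda>e. fm_code (ext_at_fm (\<Psi> e) (p e) (q e)))"
      unfolding ext_at_fm_def by (intro computable_code_intros computable_const \<Psi> p q)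
    show "sat M e E (ext_at_fm (\<Psi> x) (p x) (q x)) = sat M e' E' (ext_at_fm (\<Psi> x) (p x) (q x))" for x e E e' E'
      using sat_ext_at_fm[of "\<Psi> x", OF const] by simp
  qed
  then show "decidable A k (\<lambda>x. q x \<in> Cond \<and> q x \<preceq> p x \<and> holds (\<Psi> x) (q x))"
    using sat_ext_at_fm[OF const] by simp
  have "decidable A k (\<lambda>x. sat M z z (AllSet (Imp (SetEq (Var 0) (Par (p x))) (\<Psi> x))))"
  proof (rule decidable_sat[OF Sets_UNIV Classes_UNIV])
    show "computable A k (\<lambda>x. fm_code (AllSet (Imp (SetEq (Var 0) (Par (p x))) (\<Psi> x))))"
      by (intro computable_code_intros computable_const \<Psi> p)
    show "sat M e E (AllSet (Imp (SetEq (Var 0) (Par (p x))) (\<Psi> x))) =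
        sat M e' E' (AllSet (Imp (SetEq (Var 0) (Par (p x))) (\<Psi> x)))" for x e E e' E'
      using sat_at_fm[of "\<Psi> x", OF const] by simp
  qed
  then show "decidable A k (\<lambda>x. holds (\<Psi> x) (p x))"
    using sat_at_fm[OF const] by simp
qed

text \<open>
  The second disjunct under \<open>LEAST\<close> makes the search total, as programs evaluate both branches.
\<close>

definition next_cond :: "nat \<Rightarrow> nat \<Rightarrow> nat" where
  "next_cond n p = (if \<exists>q\<in>Cond. q \<preceq> p \<and> holds (fm_of 1 n) q
     then LEAST q. (q \<in> Cond \<and> q \<preceq> p \<and> holds (fm_of 1 n) q) \<or> \<not> (\<exists>q\<in>Cond. q \<preceq> p \<and> holds (fm_of 1 n) q)
     else p)"

definition pn :: "nat \<Rightarrow> nat" where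
  "pn n = rec_nat (SOME p. p \<in> Cond) next_cond n"

lemma holds_fm_of_const: "sat M (case_nat p e) E (fm_of 1 n) = sat M (case_nat p e') E' (fm_of 1 n)"
  by (rule sat_cong[OF fm_of(1)]) simp_all

lemma computable_pn: "computable A k h \<Longrightarrow> computable A k (\<lambda>e. pn (h e))"
  unfolding pn_def
proof (rule computable_rec[where s="\<lambda>n y e. next_cond n y"], rule computable_const)
  let ?k = "Suc (Suc k)"
  have v: "computable A ?k (\<lambda>e. e 0)" "computable A ?k (\<lambda>e. e 1)" by (simp_all add: computable_var)
  have w: "computable A (Suc ?k) (\<lambda>e. e 0)" "computable A (Suc ?k) (\<lambda>e. e (Suc 0))" "computable A (Suc ?k) (\<lambda>e. e (Suc 1))"
    by (simp_all add: computable_var)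
  note fo = computable_fm_of(2)[OF Sets_UNIV Classes_UNIV]
  note ext = decidable_ext[OF holds_fm_of_const]
  have "computable A ?k (\<lambda>e. LEAST q. (q \<in> Cond \<and> q \<preceq> e 1 \<and> holds (fm_of 1 (e 0)) q) \<or>
      \<not> (\<exists>q\<in>Cond. q \<preceq> e 1 \<and> holds (fm_of 1 (e 0)) q))"
    by (rule computable_Least[OF decidable_disj[OF ext(2) decidable_not[OF ext(1)]]])
      (use fo w in blast)+
  then show "computable A ?k (\<lambda>e. next_cond (e 0) (e 1))"
    unfolding next_cond_def by (intro computable_if ext(1) fo v)
qed

lemma next_cond:
  assumes "p \<in> Cond"
  shows "next_cond n p \<in> Cond" "next_cond n p \<preceq> p"
    "holds (fm_of 1 n) (next_cond n p) \<or> \<not> (\<exists>q\<in>Cond. q \<preceq> p \<and> holds (fm_of 1 n) q)"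
proof -
  let ?R = "\<lambda>q. q \<in> Cond \<and> q \<preceq> p \<and> holds (fm_of 1 n) q"
  have "next_cond n p \<in> Cond \<and> next_cond n p \<preceq> p \<and>
    (holds (fm_of 1 n) (next_cond n p) \<or> \<not> (\<exists>q\<in>Cond. q \<preceq> p \<and> holds (fm_of 1 n) q))"
  proof (cases "\<exists>q. ?R q")
    case True
    then have "next_cond n p = (LEAST q. ?R q)" unfolding next_cond_def by (simp add: Bex_def)
    with LeastI_ex[OF True] show ?thesis by simp
  next
    case False
    then have "next_cond n p = p" unfolding next_cond_def by auto
    with False assms below_refl show ?thesis by auto
  qed
  then show "next_cond n p \<in> Cond" "next_cond n p \<preceq> p"
    "holds (fm_of 1 n) (next_cond n p) \<or> \<not> (\<exists>q\<in>Cond. q \<preceq> p \<and> holds (fm_of 1 n) q)" by blast+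
qed

lemma pn_in_Cond: "pn n \<in> Cond"
proof (induction n)
  case 0
  have "\<exists>p. p \<in> Cond" using ex_top by blast
  then show ?case unfolding pn_def by simp (rule someI_ex)
next
  case (Suc n)
  then show ?case using next_cond(1)[of "pn n" n] by (simp add: pn_def)
qed

sublocale generic_sequence M P L FE FI pn
proof
  show "pn n \<in> Cond" for n by (rule pn_in_Cond)
  show "pn (Suc n) \<preceq> pn n" for n
    using next_cond(2)[OF pn_in_Cond[of n], of n] by (simp add: pn_def)
  fix Q assume "definable M False 1 0 (\<lambda>e E. Q (e 0))"
  then obtain \<phi> where \<phi>: "closed_fm 1 0 \<phi>" "\<And>e E. sat M e E \<phi> \<longleftrightarrow> Q (e 0)" by (auto simp: definable_def)
  let ?n = "fm_code \<phi>"
  have "holds (fm_of 1 ?n) q \<longleftrightarrow> Q q" for q using \<phi> by (simp add: fm_of_code)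
  with next_cond(3)[OF pn_in_Cond[of ?n], of ?n]
  have "Q (next_cond ?n (pn ?n)) \<or> \<not> (\<exists>q\<in>Cond. q \<preceq> pn ?n \<and> Q q)" by simp
  moreover have "next_cond ?n (pn ?n) = pn (Suc ?n)" by (simp add: pn_def)
  ultimately show "\<exists>n. Q (pn n) \<or> (\<forall>q\<in>Cond. q \<preceq> pn n \<longrightarrow> \<not> Q q)" by metis
qed

text \<open>The statement looks only semidecidable. But by genericity some \<open>pn n\<close>
  satisfies the property or has no extension that does, and which of the two holds is decidable at
  each \<open>n\<close>. At the first such \<open>n\<close> the answer is final: a later
  \<open>pn m\<close> with the property would be an extension of \<open>pn n\<close>, and an earlier
  one would pass it on to \<open>pn n\<close>.\<close>

lemma decidable_generic:
  assumes const: "\<And>x p e E e' E'. sat M (case_nat p e) E (\<Psi> x) = sat M (case_nat p e') E' (\<Psi> x)"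
    and \<Psi>: "computable A k (\<lambda>e. fm_code (\<Psi> e))"
    and mono: "\<And>x p q. holds (\<Psi> x) p \<Longrightarrow> q \<preceq> p \<Longrightarrow> q \<in> Cond \<Longrightarrow> p \<in> Cond \<Longrightarrow> holds (\<Psi> x) q"
  shows "decidable A k (\<lambda>x. \<exists>n. holds (\<Psi> x) (pn n))"
proof -
  let ?D = "\<lambda>n x. holds (\<Psi> x) (pn n) \<or> \<not> (\<exists>q\<in>Cond. q \<preceq> pn n \<and> holds (\<Psi> x) q)"
  have ex: "\<exists>n. ?D n x" for x
  proof -
    have 1: "(\<lambda>n. if n < 1 then e' n else z (n - 1)) = case_nat (e' 0) z" for e'
      by (rule HOL.ext) (simp split: nat.split)
    have "definable M False 1 0 (\<lambda>e E. holds (\<Psi> x) (e 0))"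
      unfolding definable_def
      by (rule exI[of _ "inst 1 0 z z (\<Psi> x)"]) (use 1 in \<open>simp add: closed_inst sat_inst\<close>)
    from decides[OF this] show ?thesis by blast
  qed
  have \<Psi>': "computable A (Suc k) (\<lambda>e. fm_code (\<Psi> (\<lambda>i. e (Suc i))))"
    using computable_compose[OF \<Psi>, of "Suc k" "\<lambda>i e. e (Suc i)"] by (simp add: computable_var)
  have c: "sat M (case_nat p e) E (\<Psi> (\<lambda>i. x (Suc i))) = sat M (case_nat p e') E' (\<Psi> (\<lambda>i. x (Suc i)))" for x p e E e' E'
    by (rule const)
  have p: "computable A (Suc k) (\<lambda>e. pn (e 0))" by (rule computable_pn) (simp add: computable_var)
  have least: "computable A k (\<lambda>x. LEAST n. ?D n x)"
    by (rule computable_Least[OF decidable_disj[OF decidable_ext(3)[OF c \<Psi>' p p] decidable_not[OF decidable_ext(1)[OF c \<Psi>' p p]]]])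
      (rule ex)
  have "(\<exists>n. holds (\<Psi> x) (pn n)) \<longleftrightarrow> holds (\<Psi> x) (pn (LEAST n. ?D n x))" for x
  proof
    assume "\<exists>n. holds (\<Psi> x) (pn n)"
    then obtain m where m: "holds (\<Psi> x) (pn m)" by blast
    let ?n = "LEAST n. ?D n x"
    have "?D ?n x" using LeastI_ex[OF ex] .
    moreover have "holds (\<Psi> x) (pn (max m ?n))"
      using mono[OF m pn_mono[of m "max m ?n"]] pn_Cond by simp
    ultimately show "holds (\<Psi> x) (pn ?n)" using pn_mono[of ?n "max m ?n"] pn_Cond by auto
  qed blast
  then show ?thesis
    using decidable_ext(3)[OF const \<Psi> computable_pn[OF least] computable_pn[OF least]] by simp
qed

end

section \<open>Representatives of names\<close>

lemma computable_representatives: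
  assumes S: "decidable A 1 (\<lambda>e. e 0 \<in> S)"
    and R: "decidable A 2 (\<lambda>e. e 0 \<in> S \<and> e 1 \<in> S \<and> R (e 0) (e 1))"
    and refl: "\<And>s. s \<in> S \<Longrightarrow> R s s" and sym: "\<And>s t. R s t \<Longrightarrow> s \<in> S \<Longrightarrow> t \<in> S \<Longrightarrow> R t s"
    and trans: "\<And>s t u. R s t \<Longrightarrow> R t u \<Longrightarrow> s \<in> S \<Longrightarrow> t \<in> S \<Longrightarrow> u \<in> S \<Longrightarrow> R s u"
    and x: "\<And>n::nat. x n \<in> S" "\<And>m n. R (x m) (x n) \<Longrightarrow> m = n"
  obtains r where "computable A 1 (\<lambda>e. r (e 0))" "\<And>n. r n \<in> S" "\<And>a b. R (r a) (r b) \<Longrightarrow> a = b"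
    "\<And>s. s \<in> S \<Longrightarrow> \<exists>a. R (r a) s"
proof -
  define D where "D = {s \<in> S. \<forall>t<s. \<not> (t \<in> S \<and> s \<in> S \<and> R t s)}"
  have D_ex: "\<exists>t\<in>D. R t s" if s: "s \<in> S" for s
  proof -
    let ?t = "LEAST t. t \<in> S \<and> R t s"
    have t: "?t \<in> S \<and> R ?t s" by (rule LeastI[of _ s]) (use s refl in blast)
    moreover have "\<not> (u \<in> S \<and> R u ?t)" if "u < ?t" for u
      using not_less_Least[OF that] t trans s by blast
    ultimately show ?thesis unfolding D_def by blast
  qed
  then have "\<forall>n. \<exists>t. t \<in> D \<and> R t (x n)" using x(1) by blast
  from choice[OF this] obtain m where m: "\<And>n. m n \<in> D" "\<And>n. R (m n) (x n)" by blast
  \<comment> \<open>The \<open>x n\<close> lie in distinct classes, so their representatives in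
    \<open>D\<close> are distinct. Hence \<open>D\<close> is infinite, as a total enumeration
    requires.\<close>
  have "inj m"
  proof (rule injI)
    fix i j assume "m i = m j"
    then have "R (x i) (x j)" using m[of i] m[of j] trans sym x(1) unfolding D_def by (metis (no_types, lifting) mem_Collect_eq)
    then show "i = j" by (rule x(2))
  qed
  then have "infinite (range m)" by (rule range_inj_infinite)
  then have inf: "infinite D" using m(1) by (meson finite_subset image_subset_iff)
  show thesis
  proof (rule that[of "enumerate D"])
    have "decidable A (Suc 1) (\<lambda>e. e 0 \<in> S \<and> e (Suc 0) \<in> S \<and> R (e 0) (e (Suc 0)))"
      using R by (simp add: numeral_2_eq_2)
    from decidable_not[OF this] have "decidable A 1 (\<lambda>e. \<forall>t<e 0. \<not> (t \<in> S \<and> e 0 \<in> S \<and> R t (e 0)))"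
      by (intro decidable_all_less) (simp_all add: computable_var)
    from decidable_conj[OF S this]
    have "decidable A 1 (\<lambda>e. e 0 \<in> S \<and> (\<forall>t<e 0. \<not> (t \<in> S \<and> e 0 \<in> S \<and> R t (e 0))))" .
    then have "decidable A 1 (\<lambda>e. e 0 \<in> D)" by (simp add: D_def)
    then show "computable A 1 (\<lambda>e. enumerate D (e 0))" by (rule computable_enumerate[OF inf])
    have in_D: "enumerate D n \<in> D" for n using enumerate_in_set[OF inf] .
    then show in_S: "enumerate D n \<in> S" for n by (simp add: D_def)
    have less: "\<not> R (enumerate D a) (enumerate D b)" if "a < b" for a b
      using enumerate_mono[OF that inf] in_D[of a] in_D[of b] by (auto simp: D_def)
    show "a = b" if "R (enumerate D a) (enumerate D b)" for a b
      using less[of a b] less[of b a] sym[OF that in_S in_S] that by (cases a b rule: linorder_cases) blast+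
    show "\<exists>a. R (enumerate D a) s" if "s \<in> S" for s
      using D_ex[OF that] enumerate_Ex[OF inf] by metis
  qed
qed

context class_forcing
begin

text \<open>An entry at the top condition is present below every condition, so if \<open>p\<close>
  forces \<open>{\<langle>\<sigma>, 1\<rangle>}\<close> and
  \<open>{\<langle>\<rho>, 1\<rangle>}\<close> to be equal, then some condition forces
  \<open>\<sigma> = \<rho>\<close>. This takes both indices down by one, at the cost of a new
  condition, until one name is empty. The class names \<open>X n\<close> have \<open>x n\<close> as
  their only entry and inherit the property.\<close>

lemma inequivalent_names:
  obtains x X where "\<And>n::nat. x n \<in> Names" "\<And>n::nat. X n \<in> CNames"
    "\<And>p m n. p \<in> Cond \<Longrightarrow> crel3 M FE p (x m) (x n) \<Longrightarrow> m = n"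
    "\<And>p m n. p \<in> Cond \<Longrightarrow> forces_class_eq M P L FE p (X m) (X n) \<Longrightarrow> m = n"
proof -
  obtain one where one: "one \<in> Cond" "\<And>p. p \<in> Cond \<Longrightarrow> p \<preceq> one" using ex_top by blast
  obtain o' where o': "\<And>x. \<not> x \<epsilon> o'" by (rule infinity) blast
  define x where "x n = rec_nat o' (\<lambda>_ s. up (pr s one) (pr s one)) n" for n
  have mem_x: "\<not> z \<epsilon> x 0" "z \<epsilon> x (Suc n) \<longleftrightarrow> z = pr (x n) one" for z n by (simp_all add: x_def o')
  have x: "x n \<in> Names" for n
  proof (induction n)
    case 0
    show ?case by (subst set_names_iff) (simp add: mem_x)
  next
    case (Suc n)
    then show ?case using one(1) by (subst set_names_iff) (auto simp: mem_x Cond_iff)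
  qed
  have "\<exists>X. \<forall>z. cmem M z X \<longleftrightarrow> is_pair M (x n) one z" for n
    by (rule comprehension) (rule definable_intros | simp)+
  then obtain X where X: "\<And>n z. cmem M z (X n) \<longleftrightarrow> z = pr (x n) one" unfolding is_pair_iff by metis
  have entries_x: "entries (x 0) = {}" "entries (x (Suc n)) = {(x n, one)}" "centries (X n) = {(x n, one)}" for n
    using x one(1) by (auto simp: entries_iff centries_iff mem_x X)
  have entry: "\<exists>q\<in>Cond. crel3 M FE q \<sigma> \<rho>" if "forces_sub p {(\<sigma>, one)} {(\<rho>, one)}" "p \<in> Cond" for p \<sigma> \<rho>
    using forces_entryE[OF forces_subD[OF that(1) _ that(2) below_refl[OF that(2)] one(2)[OF that(2)]] that(2) below_refl[OF that(2)]]
    by blast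
  have no_entry: "\<not> forces_sub p {(\<sigma>, one)} {}" if "p \<in> Cond" for p \<sigma>
    using forces_entryE[OF forces_subD[OF _ _ that below_refl[OF that] one(2)[OF that]] that below_refl[OF that]]
    by blast
  have FE: "m = n" if "p \<in> Cond" "crel3 M FE p (x m) (x n)" for p m n
    using that
  proof (induction m arbitrary: n p)
    case 0
    then show ?case using no_entry by (cases n) (auto simp: forces_eq_iff x entries_x)
  next
    case (Suc m)
    show ?case
    proof (cases n)
      case 0
      with Suc.prems no_entry show ?thesis by (auto simp: forces_eq_iff x entries_x)
    next
      case (Suc n')
      with Suc.prems have "forces_sub p {(x m, one)} {(x n', one)}" by (simp add: forces_eq_iff x entries_x)
      with entry Suc.prems(1) Suc.IH Suc show ?thesis by blast
    qed
  qed
  show thesis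
  proof (rule that[of x X])
    show "X n \<in> CNames" for n unfolding class_names_iff using X x one(1) by (auto simp: is_pair_iff Cond_iff)
    show "m = n" if "p \<in> Cond" "forces_class_eq M P L FE p (X m) (X n)" for p m n
    proof -
      have "forces_sub p {(x m, one)} {(x n, one)}" using that by (simp add: forces_class_eq_iff entries_x)
      with entry that FE show ?thesis by blast
    qed
  qed (use x FE in blast)+
qed

end

section \<open>Deciding \<open>G\<close>, the names and the diagram of the presentation\<close>

context coded_forcing
begin

definition "GE = formula_for (\<lambda>e E. e 0 \<in> Cond \<and> e (Suc 0) \<preceq> e 0)"
text \<open>Unlike \<open>FEQ\<close> it includes that both arguments are names:
  \<open>decidable_generic\<close> asks for monotonicity at all parameter values, and
  \<open>FE\<close> is known to be monotone on names only.\<close>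

definition "FEQN = formula_for (\<lambda>e E. e (Suc 0) \<in> Names \<and> e 0 \<in> Names \<and> crel3 M FE (e (Suc (Suc 0))) (e (Suc 0)) (e 0))"

lemma sat_GE: "sat M e E GE \<longleftrightarrow> e 0 \<in> Cond \<and> e (Suc 0) \<preceq> e 0"
proof -
  have "definable M False 2 0 (\<lambda>e E. e 0 \<in> Cond \<and> e (Suc 0) \<preceq> e 0)"
    unfolding Cond_iff by (rule definable_intros | simp)+
  then show ?thesis unfolding GE_def by (rule sat_formula_for)
qed

lemma sat_FEQN: "sat M e E FEQN \<longleftrightarrow>
    e (Suc 0) \<in> Names \<and> e 0 \<in> Names \<and> crel3 M FE (e (Suc (Suc 0))) (e (Suc 0)) (e 0)"
proof -
  obtain V where V: "\<And>\<sigma>. \<sigma> \<in> Names \<longleftrightarrow> cmem M \<sigma> V" using ex_class_set_names[of P] by blast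
  have "definable M False 3 0 (\<lambda>e E. e (Suc 0) \<in> Names \<and> e 0 \<in> Names \<and> crel3 M FE (e (Suc (Suc 0))) (e (Suc 0)) (e 0))"
    unfolding V by (rule definable_intros | simp)+
  then show ?thesis unfolding FEQN_def by (rule sat_formula_for)
qed

text \<open>That some \<open>pn n\<close> lies below a given condition is a mere existence
  statement. Genericity decides it, as eventually \<open>pn n\<close> lies below the condition or no
  extension of \<open>pn n\<close> does.\<close>

lemma decidable_G: "decidable A 1 (\<lambda>e. e 0 \<in> G)"
proof -
  let ?\<Psi> = "\<lambda>x. AllSet (Imp (SetEq (Var 0) (Par (x 0))) GE)"
  have sat: "sat M (case_nat p e) E (AllSet (Imp (SetEq (Var 0) (Par a)) GE)) \<longleftrightarrow> a \<in> Cond \<and> p \<preceq> a" for a p e E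
    by (auto simp: Sets_UNIV sat_GE)
  have "decidable A 1 (\<lambda>x. \<exists>n. holds (?\<Psi> x) (pn n))"
  proof (rule decidable_generic)
    show "computable A 1 (\<lambda>x. fm_code (?\<Psi> x))"
      by (intro computable_code_intros computable_const computable_var) simp
    show "holds (?\<Psi> x) q" if "holds (?\<Psi> x) p" "q \<preceq> p" "q \<in> Cond" "p \<in> Cond" for x p q
      using that below_trans unfolding sat by blast
  qed (simp only: sat)
  then show ?thesis unfolding sat by (simp add: G_def)
qed

lemma decidable_Names: "decidable A 1 (\<lambda>e. e 0 \<in> Names)"
proof -
  let ?\<Phi> = "\<lambda>x. AllSet (Imp (SetEq (Var 0) (Par (x 0))) NAME)"
  have sat: "sat M e E (AllSet (Imp (SetEq (Var 0) (Par a)) NAME)) \<longleftrightarrow> a \<in> Names" for a e E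
    by (auto simp: Sets_UNIV sat_NAME)
  have "decidable A 1 (\<lambda>x. sat M z z (?\<Phi> x))"
  proof (rule decidable_sat[OF Sets_UNIV Classes_UNIV])
    show "computable A 1 (\<lambda>x. fm_code (?\<Phi> x))"
      by (intro computable_code_intros computable_const computable_var) simp
  qed (simp only: sat)
  then show ?thesis unfolding sat .
qed

lemma decidable_CNames: "decidable A 1 (\<lambda>e. e 0 \<in> CNames)"
proof -
  let ?\<Phi> = "\<lambda>x. AllCls (Imp (ClsEq (Var 0) (Par (x 0))) CNAME)"
  have sat: "sat M e E (AllCls (Imp (ClsEq (Var 0) (Par a)) CNAME)) \<longleftrightarrow> a \<in> CNames" for a e E
    by (auto simp: Classes_UNIV sat_CNAME)
  have "decidable A 1 (\<lambda>x. sat M z z (?\<Phi> x))"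
  proof (rule decidable_sat[OF Sets_UNIV Classes_UNIV])
    show "computable A 1 (\<lambda>x. fm_code (?\<Phi> x))"
      by (intro computable_code_intros computable_const computable_var) simp
  qed (simp only: sat)
  then show ?thesis unfolding sat .
qed

lemma decidable_set_eq: "decidable A 2 (\<lambda>e. e 0 \<in> Names \<and> e 1 \<in> Names \<and> set_eq (e 0) (e 1))"
proof -
  let ?\<Psi> = "\<lambda>x. AllSet (Imp (SetEq (Var 0) (Par (x 0))) (AllSet (Imp (SetEq (Var 0) (Par (x 1))) FEQN)))"
  have sat: "sat M (case_nat p e) E (AllSet (Imp (SetEq (Var 0) (Par a)) (AllSet (Imp (SetEq (Var 0) (Par b)) FEQN)))) \<longleftrightarrow>
      a \<in> Names \<and> b \<in> Names \<and> crel3 M FE p a b" for a b p e E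
    by (auto simp: Sets_UNIV sat_FEQN)
  have "decidable A 2 (\<lambda>x. \<exists>n. holds (?\<Psi> x) (pn n))"
  proof (rule decidable_generic)
    show "computable A 2 (\<lambda>x. fm_code (?\<Psi> x))"
      by (intro computable_code_intros computable_const computable_var) simp_all
    show "holds (?\<Psi> x) q" if "holds (?\<Psi> x) p" "q \<preceq> p" "q \<in> Cond" "p \<in> Cond" for x p q
      using that forces_eq_mono unfolding sat by blast
  qed (simp only: sat)
  then show ?thesis unfolding sat by (simp add: set_eq_def)
qed

lemma decidable_cls_eq: "decidable A 2 (\<lambda>e. cls_eq (e 0) (e 1))"
proof -
  let ?\<Psi> = "\<lambda>x. AllCls (Imp (ClsEq (Var 0) (Par (x 0))) (AllCls (Imp (ClsEq (Var 0) (Par (x 1))) FCEQ)))"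
  have sat: "sat M (case_nat p e) E (AllCls (Imp (ClsEq (Var 0) (Par a)) (AllCls (Imp (ClsEq (Var 0) (Par b)) FCEQ)))) \<longleftrightarrow>
      forces_class_eq M P L FE p a b" for a b p e E
    by (auto simp: Classes_UNIV sat_FCEQ)
  have "decidable A 2 (\<lambda>x. \<exists>n. holds (?\<Psi> x) (pn n))"
  proof (rule decidable_generic)
    show "computable A 2 (\<lambda>x. fm_code (?\<Psi> x))"
      by (intro computable_code_intros computable_const computable_var) simp_all
    show "holds (?\<Psi> x) q" if "holds (?\<Psi> x) p" "q \<preceq> p" "q \<in> Cond" "p \<in> Cond" for x p q
      using that forces_sub_mono unfolding sat forces_class_eq_iff by blast
  qed (simp only: sat)
  then show ?thesis unfolding sat by (simp add: cls_eq_def)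
qed

text \<open>By the truth lemma a sentence belongs to the diagram iff some \<open>pn n\<close> forces
  it, and \<open>trans\<close> computes a formula expressing this, so
  \<open>decidable_generic\<close> applies. \<open>fm_of\<close> keeps the translation total, and
  \<open>closed_code\<close> rejects the numbers that code no sentence.\<close>

lemma decidable_so_diagram_N:
  assumes rs: "computable A 1 (\<lambda>e. rs (e 0))" "\<And>a. rs a \<in> Names" "\<And>a b. set_eq (rs a) (rs b) \<Longrightarrow> a = b"
      "\<And>\<sigma>. \<sigma> \<in> Names \<Longrightarrow> \<exists>a. set_eq (rs a) \<sigma>"
    and rc: "computable A 1 (\<lambda>e. rc (e 0))" "\<And>a. rc a \<in> CNames" "\<And>a b. cls_eq (rc a) (rc b) \<Longrightarrow> a = b"
      "\<And>\<Gamma>. \<Gamma> \<in> CNames \<Longrightarrow> \<exists>a. cls_eq (rc a) \<Gamma>"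
  shows "decidable A 1 (\<lambda>e. e 0 \<in> so_diagram (N rs rc))"
proof -
  have N: "Sets (N rs rc) = UNIV" "Classes (N rs rc) = UNIV"
    by (simp_all add: N_def[OF rs(2) rc(2) rs(3) rc(3) rs(4) rc(4)])
  \<comment> \<open>Any environment of names serves for sentences. One is fixed because monotonicity
    of forcing requires names as values, which the zero environment \<open>z\<close> need not
    provide.\<close>
  let ?e = "\<lambda>_::nat. rs 0" and ?E = "\<lambda>_::nat. rc 0"
  have cong: "forces rs rc p e E \<phi> = forces rs rc p ?e ?E \<phi>" if "closed_fm 0 0 \<phi>" for p e E \<phi>
    by (rule forces_cong[OF that]) simp_all
  let ?\<Psi> = "\<lambda>x. trans rs rc (fm_of 0 (x 0))"
  have sat: "sat M (case_nat p e) E (trans rs rc (fm_of 0 a)) \<longleftrightarrow> forces rs rc p ?e ?E (fm_of 0 a)" for a p e E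
    unfolding sat_trans using cong[OF fm_of(1)] .
  have "decidable A 1 (\<lambda>x. \<exists>n. holds (?\<Psi> x) (pn n))"
  proof (rule decidable_generic)
    show "computable A 1 (\<lambda>x. fm_code (?\<Psi> x))"
      by (intro forcing_translation.computable_trans rs(1) rc(1) computable_fm_of Sets_UNIV Classes_UNIV computable_var) simp
    show "holds (?\<Psi> x) q" if "holds (?\<Psi> x) p" "q \<preceq> p" "q \<in> Cond" "p \<in> Cond" for x p q
      using that forces_mono[of rs rc p ?e ?E, OF rs(2) rc(2)] rs(2) rc(2) unfolding sat by blast
  qed (simp only: sat)
  then have dec: "decidable A 1 (\<lambda>x. closed_code 0 (x 0) \<and> (\<exists>n. forces rs rc (pn n) ?e ?E (fm_of 0 (x 0))))"
    unfolding sat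
    by (intro decidable_conj decidable_closed_code Sets_UNIV Classes_UNIV computable_var) simp_all
  have truth: "sat (N rs rc) z z \<phi> \<longleftrightarrow> (\<exists>n. forces rs rc (pn n) ?e ?E \<phi>)" for \<phi>
    by (rule truth[of rs rc, OF rs(2) rc(2) rs(3) rc(3) rs(4) rc(4) expressible])
      (use rs(2) rc(2) in \<open>auto simp: set_eq_refl cls_eq_refl\<close>)
  have "x \<in> so_diagram (N rs rc) \<longleftrightarrow> closed_code 0 x \<and> (\<exists>n. forces rs rc (pn n) ?e ?E (fm_of 0 x))" for x
  proof
    assume x: "x \<in> so_diagram (N rs rc)"
    then obtain \<phi> where \<phi>: "x = fm_code \<phi>" "closed_fm 0 0 \<phi>" by (auto simp: so_diagram_def)
    then have "sat (N rs rc) z z \<phi>" using x so_diagram_iff[OF N] by blast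
    with \<phi> show "closed_code 0 x \<and> (\<exists>n. forces rs rc (pn n) ?e ?E (fm_of 0 x))"
      unfolding truth by (auto simp: fm_of_code closed_code_def)
  next
    assume x: "closed_code 0 x \<and> (\<exists>n. forces rs rc (pn n) ?e ?E (fm_of 0 x))"
    then obtain \<phi> where \<phi>: "x = fm_code \<phi>" "closed_fm 0 0 \<phi>" by (auto simp: closed_code_def)
    with x have "sat (N rs rc) z z \<phi>" unfolding truth by (simp add: fm_of_code)
    with \<phi> show "x \<in> so_diagram (N rs rc)" using so_diagram_iff[OF N] by blast
  qed
  with dec show ?thesis by simp
qed

end

lemma computable_fromI: "decidable A 1 (\<lambda>e. e 0 \<in> B) \<Longrightarrow> computable_from A B"
proof -
  assume "decidable A 1 (\<lambda>e. e 0 \<in> B)"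
  then obtain f where f: "\<And>e. computes A f (map e [0..<1]) (of_bool (e 0 \<in> B))"
    by (auto simp: decidable_def computable_def)
  have "computes A f [n] (if n \<in> B then 1 else 0)" for n
    using f[of "\<lambda>_. n"] by (cases "n \<in> B") simp_all
  then show ?thesis unfolding computable_from_def by blast
qed

theorem theorem6p3:
  fixes M :: "(nat, nat) struct" and P L FE FI :: nat
  assumes "GB M"
    and "on_omega M"
    and "forcing_notion M P L"
    and "atomic_forcing_relation M P L FE FI"
  shows "\<exists>G N. generic_filter M P L G \<and>
           on_omega N \<and> isomorphic N (generic_extension M P L FE FI G) \<and>
           computable_from (so_diagram M) G \<and>
           computable_from (so_diagram M) (so_diagram N)"
proof -
  interpret coded_forcing M P L FE FI
    by unfold_locales (use assms in \<open>auto simp: on_omega_def\<close>)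
  obtain x X where x: "\<And>n::nat. x n \<in> Names" "\<And>n::nat. X n \<in> CNames"
    "\<And>p m n. p \<in> Cond \<Longrightarrow> crel3 M FE p (x m) (x n) \<Longrightarrow> m = n"
    "\<And>p m n. p \<in> Cond \<Longrightarrow> forces_class_eq M P L FE p (X m) (X n) \<Longrightarrow> m = n"
    by (rule inequivalent_names) blast
  obtain rs where rs: "computable A 1 (\<lambda>e. rs (e 0))" "\<And>n. rs n \<in> Names" "\<And>a b. set_eq (rs a) (rs b) \<Longrightarrow> a = b"
    "\<And>s. s \<in> Names \<Longrightarrow> \<exists>a. set_eq (rs a) s"
  proof (rule computable_representatives[OF decidable_Names decidable_set_eq])
    show "m = n" if "set_eq (x m) (x n)" for m n using that x(3) pn_Cond by (auto simp: set_eq_def)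
  qed (use set_eq_refl set_eq_sym set_eq_trans x(1) in blast)+
  have "decidable A 2 (\<lambda>e. e 0 \<in> CNames \<and> e 1 \<in> CNames \<and> cls_eq (e 0) (e 1))"
    by (intro decidable_conj decidable_cls_eq decidable_CNames[unfolded decidable_def, THEN computable_comp1, folded decidable_def])
      (simp_all add: computable_var)
  then obtain rc where rc: "computable A 1 (\<lambda>e. rc (e 0))" "\<And>n. rc n \<in> CNames" "\<And>a b. cls_eq (rc a) (rc b) \<Longrightarrow> a = b"
    "\<And>s. s \<in> CNames \<Longrightarrow> \<exists>a. cls_eq (rc a) s"
  proof (rule computable_representatives[OF decidable_CNames])
    show "m = n" if "cls_eq (X m) (X n)" for m n using that x(4) pn_Cond by (auto simp: cls_eq_def)
  qed (use cls_eq_refl cls_eq_sym cls_eq_trans x(2) in blast)+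
  show ?thesis
  proof (intro exI conjI)
    show "generic_filter M P L G" by (rule generic_filter_G)
    show "on_omega (N rs rc)"
      by (simp add: on_omega_def N_def[OF rs(2) rc(2) rs(3) rc(3) rs(4) rc(4)])
    show "isomorphic (N rs rc) (generic_extension M P L FE FI G)"
      by (rule isomorphic_N[OF rs(2) rc(2) rs(3) rc(3) rs(4) rc(4)])
    show "computable_from (so_diagram M) G" by (rule computable_fromI[OF decidable_G])
    show "computable_from (so_diagram M) (so_diagram (N rs rc))"
      by (rule computable_fromI[OF decidable_so_diagram_N[OF rs rc]])
  qed
qed

end
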